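(* Let $\mathcal{G}$ be a locally compact Hausdorff étale groupoid such that $C_0(\mathcal{G}^{(0)})$ separates ideals of $C_r^*(\mathcal{G})$. If $\mathcal{G}$ is purely infinite and all open sets in $\mathcal{G}^{(0)}$ are groupoid small, then the $C^*$-algebra $C^*_r(\mathcal{G})$ is purely infinite.
   Context: Standing assumption: all groupoids have infinite unit space. $\mathcal{G}^{(0)}$ is the unit space, $s(\gamma)=\gamma^{-1}\gamma$, $r(\gamma)=\gamma\gamma^{-1}$, and $C^*_r(\mathcal G)$ is the reduced groupoid $C^*$-algebra, which contains $C_0(\mathcal G^{(0)})$. For $A,B\subset\mathcal G$, $AB$ is the set of all products $\alpha\beta$ of composable pairs with $\alpha\in A$, $\beta\in B$; thus $\mathcal G D=\{\gamma: s(\gamma)\in D\}$ for $D\subset \mathcal G^{(0)}$. $D\subset\mathcal G^{(0)}$ is $\mathcal G$-invariant if $r(\mathcal G D)=D$. An open bisection is an open set $U\subset\mathcal G$ such that $s|_U$ and $r|_U$ are homeomorphisms onto open subsets of $\mathcal G^{(0)}$. $C_0(\mathcal G^{(0)})$ separates ideals of $C_r^*(\mathcal G)$ if the map $I\mapsto I\cap C_0(\mathcal G^{(0)})$ from (closed two-sided) ideals of $C^*_r(\mathcal G)$ to the ideals of $C_0(\mathcal G^{(0)})$ determined by $\mathcal G$-invariant closed sets is injective. For $K\subset\mathcal G^{(0)}$ compact and $V\subset\mathcal G^{(0)}$ open, $K\prec_{\mathcal G}V$ means there are open bisections $A_1,\dots,A_n$ with $K\subset\bigcup_i s(A_i)$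 and with $r(A_1),\dots,r(A_n)$ pairwise disjoint subsets of $V$. For non-empty open $U,V\subset\mathcal G^{(0)}$, $U\prec_{\mathcal G,2}V$ means: for every compact $F\subset U$ there are disjoint non-empty open sets $O_1,O_2\subset V$ with $F\prec_{\mathcal G}O_1$ and $F\prec_{\mathcal G}O_2$. $\mathcal G$ is purely infinite if $O_1\prec_{\mathcal G,2}O_2$ for all non-empty open sets $O_1,O_2\subset\mathcal G^{(0)}$ with $O_1\subset r(\mathcal G O_2)$. An open set $M\subset\mathcal G^{(0)}$ is groupoid small if for any compact sets $C\subset\mathcal G\setminus\mathcal G^{(0)}$ and $K\subset M$ there are a compact set $F$ and an open set $O$ in $\mathcal G^{(0)}$ with $F\subset O\subset M$ such that $K\subset r(\mathcal G F)$ and $OCO=\emptyset$. A $C^*$-algebra $A$ is purely infinite (Kirchberg–Rørdam) if $A$ has no characters and, for all positive $a,b\in A$ with $b$ in the closed ideal generated by $a$, one has $b\precsim a$, i.e. there is a sequence $(r_n)$ in $A$ with $r_n^*ar_n\to b$. *)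

theory Defs
  imports "HOL-Analysis.Analysis"
begin

typedef 'i ell2 = "{f :: 'i \<Rightarrow> complex. (\<lambda>i. (cmod (f i))\<^sup>2) summable_on UNIV}"
  morphisms coef Abs_ell2
  by (rule exI[of _ "\<lambda>_. 0"]) simp

setup_lifting type_definition_ell2

lemma ell2_eqI: "(\<And>i. coef f i = coef g i) \<Longrightarrow> f = g"
  by (simp add: coef_inject[symmetric] fun_eq_iff)

lemma coef_square_summable: "(\<lambda>i. (cmod (coef f i))\<^sup>2) summable_on UNIV"
  using coef[of f] by simp

lemma coef_product_summable: "(\<lambda>i. cnj (coef f i) * coef g i) summable_on UNIV"
proof -
  have "(\<lambda>i. norm (cnj (coef f i) * coef g i)) summable_on UNIV"
    by (rule Infinite_Sum.abs_summable_product)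
      (use coef_square_summable[of f] coef_square_summable[of g] in
        \<open>simp_all add: norm_mult power2_eq_square\<close>)
  then show ?thesis
    by (rule abs_summable_summable)
qed

definition cinner :: "'i ell2 \<Rightarrow> 'i ell2 \<Rightarrow> complex" where
  "cinner f g = (\<Sum>\<^sub>\<infinity>i. cnj (coef f i) * coef g i)"

lemma square_summable_add:
  fixes f g :: "'i \<Rightarrow> complex"
  assumes "(\<lambda>i. (cmod (f i))\<^sup>2) summable_on UNIV" "(\<lambda>i. (cmod (g i))\<^sup>2) summable_on UNIV"
  shows "(\<lambda>i. (cmod (f i + g i))\<^sup>2) summable_on UNIV"
proof (rule summable_on_comparison_test)
  show "(\<lambda>i. 2 * ((cmod (f i))\<^sup>2 + (cmod (g i))\<^sup>2)) summable_on UNIV"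
    by (intro summable_on_cmult_right summable_on_add assms)
  fix i
  have "(cmod (f i + g i))\<^sup>2 \<le> (cmod (f i) + cmod (g i))\<^sup>2"
    by (intro power_mono norm_triangle_ineq) simp
  also have "\<dots> \<le> 2 * ((cmod (f i))\<^sup>2 + (cmod (g i))\<^sup>2)"
    using sum_squares_bound[of "cmod (f i)" "cmod (g i)"] by (simp add: power2_sum)
  finally show "(cmod (f i + g i))\<^sup>2 \<le> 2 * ((cmod (f i))\<^sup>2 + (cmod (g i))\<^sup>2)" .
qed simp

lemma square_summable_scale:
  fixes f :: "'i \<Rightarrow> complex"
  assumes "(\<lambda>i. (cmod (f i))\<^sup>2) summable_on UNIV"
  shows "(\<lambda>i. (cmod (c * f i))\<^sup>2) summable_on UNIV"
  using summable_on_cmult_right[OF assms, of "(cmod c)\<^sup>2"]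
  by (simp add: norm_mult power_mult_distrib)

lift_definition scale_ell2 :: "complex \<Rightarrow> 'i ell2 \<Rightarrow> 'i ell2" is "\<lambda>c f i. c * f i"
  by (rule square_summable_scale)

instantiation ell2 :: (type) real_inner
begin

lift_definition zero_ell2 :: "'a ell2" is "\<lambda>_. 0" by simp
lift_definition plus_ell2 :: "'a ell2 \<Rightarrow> 'a ell2 \<Rightarrow> 'a ell2" is "\<lambda>f g i. f i + g i"
  by (rule square_summable_add)
lift_definition uminus_ell2 :: "'a ell2 \<Rightarrow> 'a ell2" is "\<lambda>f i. - f i" by simp
definition minus_ell2 :: "'a ell2 \<Rightarrow> 'a ell2 \<Rightarrow> 'a ell2" where "minus_ell2 f g = f + (- g)"
definition scaleR_ell2 :: "real \<Rightarrow> 'a ell2 \<Rightarrow> 'a ell2"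
  where "scaleR_ell2 r f = scale_ell2 (complex_of_real r) f"
definition inner_ell2 :: "'a ell2 \<Rightarrow> 'a ell2 \<Rightarrow> real" where "inner_ell2 f g = Re (cinner f g)"
definition norm_ell2 :: "'a ell2 \<Rightarrow> real" where "norm_ell2 f = sqrt (inner f f)"
definition sgn_ell2 :: "'a ell2 \<Rightarrow> 'a ell2" where "sgn_ell2 f = scaleR (inverse (norm f)) f"
definition dist_ell2 :: "'a ell2 \<Rightarrow> 'a ell2 \<Rightarrow> real" where "dist_ell2 f g = norm (f - g)"
definition uniformity_ell2 :: "('a ell2 \<times> 'a ell2) filter" where
  "uniformity_ell2 = (INF e\<in>{0<..}. principal {(x, y). dist x y < e})"
definition open_ell2 :: "'a ell2 set \<Rightarrow> bool" where
  "open_ell2 U \<longleftrightarrow> (\<forall>x\<in>U. \<forall>\<^sub>F (x', y) in uniformity. x' = x \<longrightarrow> y \<in> U)"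

instance
proof
  fix f g h :: "'a ell2" and r s :: real and U :: "'a ell2 set"
  note coefs = zero_ell2.rep_eq plus_ell2.rep_eq uminus_ell2.rep_eq scale_ell2.rep_eq scaleR_ell2_def
  show "f + g + h = f + (g + h)" "f + g = g + f" "0 + f = f" "- f + f = 0"
    by (rule ell2_eqI, simp add: coefs)+
  show "f - g = f + - g"
    by (rule minus_ell2_def)
  show "r *\<^sub>R (f + g) = r *\<^sub>R f + r *\<^sub>R g" "(r + s) *\<^sub>R f = r *\<^sub>R f + s *\<^sub>R f"
    "r *\<^sub>R s *\<^sub>R f = (r * s) *\<^sub>R f" "1 *\<^sub>R f = f"
    by (rule ell2_eqI, simp add: coefs distrib_left distrib_right)+
  show "sgn f = scaleR (inverse (norm f)) f" "dist f g = norm (f - g)" "norm f = sqrt (inner f f)"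
    by (rule sgn_ell2_def dist_ell2_def norm_ell2_def)+
  show "uniformity = (INF e\<in>{0<..}. principal {(x, y :: 'a ell2). dist x y < e})"
    by (rule uniformity_ell2_def)
  show "open U \<longleftrightarrow> (\<forall>x\<in>U. \<forall>\<^sub>F (x', y) in uniformity. x' = x \<longrightarrow> y \<in> U)"
    by (rule open_ell2_def)
  have Re: "inner f g = (\<Sum>\<^sub>\<infinity>i. Re (cnj (coef f i) * coef g i))" for f g :: "'a ell2"
    unfolding inner_ell2_def cinner_def by (rule infsum_Re[symmetric]) (rule coef_product_summable)
  have sm: "(\<lambda>i. Re (cnj (coef f i) * coef g i)) summable_on UNIV" for f g :: "'a ell2"
    by (intro summable_on_Re coef_product_summable)
  show "inner f g = inner g f"
    unfolding Re by (intro infsum_cong) simp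
  show "inner (f + g) h = inner f h + inner g h"
    unfolding Re infsum_add[OF sm sm, symmetric] by (intro infsum_cong) (simp add: coefs algebra_simps)
  show "inner (r *\<^sub>R f) g = r * inner f g"
    unfolding Re infsum_cmult_right'[symmetric] by (intro infsum_cong) (simp add: coefs algebra_simps)
  show "0 \<le> inner f f"
    unfolding Re by (intro infsum_nonneg) simp
  show "inner f f = 0 \<longleftrightarrow> f = 0"
  proof
    assume *: "inner f f = 0"
    have "Re (cnj (coef f i) * coef f i) = 0" for i
      by (rule nonneg_infsum_le_0D[OF _ sm]) (use * in \<open>auto simp: Re\<close>)
    then have "coef f i = 0" for i
      by (simp add: complex_eq_iff sum_squares_eq_zero_iff)
    then show "f = 0"
      by (intro ell2_eqI) (simp add: coefs)
  qed (simp add: Re coefs)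
qed

end

lemma norm_scale_ell2: "norm (scale_ell2 c f) = cmod c * norm f"
proof -
  have "cinner (scale_ell2 c f) (scale_ell2 c f) = of_real ((cmod c)\<^sup>2) * cinner f f"
    unfolding cinner_def infsum_cmult_right'[symmetric]
    by (intro infsum_cong) (simp add: scale_ell2.rep_eq complex_norm_square mult_ac del: of_real_power)
  then show ?thesis
    by (simp add: norm_ell2_def inner_ell2_def real_sqrt_mult)
qed

lemma bounded_linear_scale_ell2: "bounded_linear (scale_ell2 c)"
  by (rule bounded_linear_intro[where K = "cmod c"])
    (auto intro!: ell2_eqI simp: norm_scale_ell2 scale_ell2.rep_eq plus_ell2.rep_eq
      scaleR_ell2_def algebra_simps)

text \<open>The bounded operators on \<^typ>\<open>'i ell2\<close>; all operators in the C*-algebras below are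
  complex linear, and for these the operator norm on \<^type>\<open>blinfun\<close> is the usual one.\<close>

type_synonym 'i op = "'i ell2 \<Rightarrow>\<^sub>L 'i ell2"

definition scale_op :: "complex \<Rightarrow> 'i op \<Rightarrow> 'i op" where
  "scale_op c T = Blinfun (\<lambda>f. scale_ell2 c (T f))"

lemma scale_op_apply: "scale_op c T f = scale_ell2 c (T f)"
  unfolding scale_op_def
  by (simp add: bounded_linear_Blinfun_apply
      bounded_linear_compose[OF bounded_linear_scale_ell2 blinfun.bounded_linear_right])

text \<open>By the Riesz representation theorem the adjoint exists exactly for the complex linear operators.\<close>

definition adj :: "'i op \<Rightarrow> 'i op" where
  "adj T = (THE S :: 'i op. \<forall>f g. cinner (T f) g = cinner f (S g))"

text \<open>In the following, \<open>A\<close> is a norm-closed *-subalgebra of \<^typ>\<open>'i op\<close>.\<close>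

definition closed_ideal :: "'i op set \<Rightarrow> 'i op set \<Rightarrow> bool" where
  "closed_ideal A I \<longleftrightarrow> I \<subseteq> A \<and> closed I \<and> 0 \<in> I
     \<and> (\<forall>x\<in>I. \<forall>y\<in>I. x + y \<in> I) \<and> (\<forall>c. \<forall>x\<in>I. scale_op c x \<in> I)
     \<and> (\<forall>a\<in>A. \<forall>x\<in>I. a o\<^sub>L x \<in> I \<and> x o\<^sub>L a \<in> I)"

definition ideal_generated :: "'i op set \<Rightarrow> 'i op \<Rightarrow> 'i op set" where
  "ideal_generated A a = \<Inter>{I. closed_ideal A I \<and> a \<in> I}"

definition character :: "'i op set \<Rightarrow> ('i op \<Rightarrow> complex) \<Rightarrow> bool" where
  "character A h \<longleftrightarrow>
     (\<forall>x\<in>A. \<forall>y\<in>A. h (x + y) = h x + h y) \<and> (\<forall>c. \<forall>x\<in>A. h (scale_op c x) = c * h x)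
     \<and> (\<forall>x\<in>A. \<forall>y\<in>A. h (x o\<^sub>L y) = h x * h y) \<and> (\<exists>x\<in>A. h x \<noteq> 0)"

definition positive_elements :: "'i op set \<Rightarrow> 'i op set" where
  "positive_elements A = {adj x o\<^sub>L x |x. x \<in> A}"

definition cuntz_below :: "'i op set \<Rightarrow> 'i op \<Rightarrow> 'i op \<Rightarrow> bool" where
  "cuntz_below A b a \<longleftrightarrow>
     (\<exists>r :: nat \<Rightarrow> 'i op. (\<forall>n. r n \<in> A) \<and> (\<lambda>n. adj (r n) o\<^sub>L a o\<^sub>L r n) \<longlonglongrightarrow> b)"

definition purely_infinite_cstar :: "'i op set \<Rightarrow> bool" where
  "purely_infinite_cstar A \<longleftrightarrow> (\<nexists>h. character A h)
     \<and> (\<forall>a\<in>positive_elements A. \<forall>b\<in>positive_elements A.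
          b \<in> ideal_generated A a \<longrightarrow> cuntz_below A b a)"

text \<open>The groupoid is the whole type \<^typ>\<open>'g\<close>; \<^term>\<open>gmult\<close> is meaningful on composable pairs only.\<close>

record 'g groupoid =
  composable :: "('g \<times> 'g) set"
  gmult :: "'g \<Rightarrow> 'g \<Rightarrow> 'g"
  ginv :: "'g \<Rightarrow> 'g"

definition is_groupoid :: "'g groupoid \<Rightarrow> bool" where
  "is_groupoid G \<longleftrightarrow>
     (\<forall>a. ginv G (ginv G a) = a)
     \<and> (\<forall>a b c. (a, b) \<in> composable G \<and> (b, c) \<in> composable G \<longrightarrow>
          (gmult G a b, c) \<in> composable G \<and> (a, gmult G b c) \<in> composable G
          \<and> gmult G (gmult G a b) c = gmult G a (gmult G b c))
     \<and> (\<forall>a. (a, ginv G a) \<in> composable G)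
     \<and> (\<forall>a b. (a, b) \<in> composable G \<longrightarrow>
          gmult G (ginv G a) (gmult G a b) = b \<and> gmult G (gmult G a b) (ginv G b) = a)"

definition src :: "'g groupoid \<Rightarrow> 'g \<Rightarrow> 'g" where
  "src G a = gmult G (ginv G a) a"

definition rng :: "'g groupoid \<Rightarrow> 'g \<Rightarrow> 'g" where
  "rng G a = gmult G a (ginv G a)"

definition units :: "'g groupoid \<Rightarrow> 'g set" where
  "units G = range (src G)"

definition set_mult :: "'g groupoid \<Rightarrow> 'g set \<Rightarrow> 'g set \<Rightarrow> 'g set" where
  "set_mult G A B = {gmult G a b |a b. a \<in> A \<and> b \<in> B \<and> (a, b) \<in> composable G}"

definition topological_groupoid :: "'g::topological_space groupoid \<Rightarrow> bool" where
  "topological_groupoid G \<longleftrightarrow> is_groupoid G \<and> continuous_on UNIV (ginv G)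
     \<and> continuous_on (composable G) (\<lambda>(a, b). gmult G a b)"

definition open_in_units :: "'g::topological_space groupoid \<Rightarrow> 'g set \<Rightarrow> bool" where
  "open_in_units G U \<longleftrightarrow> openin (top_of_set (units G)) U"

definition homeo_onto_open :: "'g::topological_space groupoid \<Rightarrow> ('g \<Rightarrow> 'g) \<Rightarrow> 'g set \<Rightarrow> bool" where
  "homeo_onto_open G f U \<longleftrightarrow> open_in_units G (f ` U) \<and> (\<exists>g. homeomorphism U (f ` U) f g)"

definition open_bisection :: "'g::topological_space groupoid \<Rightarrow> 'g set \<Rightarrow> bool" where
  "open_bisection G U \<longleftrightarrow> open U \<and> homeo_onto_open G (src G) U \<and> homeo_onto_open G (rng G) U"

definition etale_groupoid :: "'g::topological_space groupoid \<Rightarrow> bool" where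
  "etale_groupoid G \<longleftrightarrow> topological_groupoid G
     \<and> (\<forall>a. \<exists>U. open U \<and> a \<in> U \<and> homeo_onto_open G (src G) U)
     \<and> (\<forall>a. \<exists>U. open U \<and> a \<in> U \<and> homeo_onto_open G (rng G) U)"

definition lc_hausdorff_etale_groupoid :: "'g::t2_space groupoid \<Rightarrow> bool" where
  "lc_hausdorff_etale_groupoid G \<longleftrightarrow>
     locally_compact_space (euclidean :: 'g topology) \<and> etale_groupoid G"

definition Cc :: "('g::topological_space \<Rightarrow> complex) set" where
  "Cc = {f. continuous_on UNIV f \<and> compact (closure {a. f a \<noteq> 0})}"

text \<open>\<open>\<pi>(f)\<xi>(\<gamma>) = \<Sum>\<^bsub>\<alpha>\<beta>=\<gamma>\<^esub> f(\<alpha>) \<xi>(\<beta>)\<close>. Since the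
  space \<open>\<ell>\<^sup>2(G)\<close> is the direct sum of the spaces \<open>\<ell>\<^sup>2(s\<^sup>-\<^sup>1(x))\<close> over all units
  \<open>x\<close>, this \<open>\<pi>\<close> is the direct sum of the left regular representations
  \<open>\<pi>\<^sub>x\<close>, and the operator norm is the supremum of the norms of the \<open>\<pi>\<^sub>x(f)\<close>.\<close>

definition regular_representation ::
    "'g::topological_space groupoid \<Rightarrow> ('g \<Rightarrow> complex) \<Rightarrow> 'g op \<Rightarrow> bool" where
  "regular_representation G f T \<longleftrightarrow>
     (\<forall>\<xi> c. coef (T \<xi>) c =
        (\<Sum>\<^sub>\<infinity>a\<in>{a. rng G a = rng G c}. f a * coef \<xi> (gmult G (ginv G a) c)))"

definition reduced_cstar :: "'g::topological_space groupoid \<Rightarrow> 'g op set" where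
  "reduced_cstar G = closure {T. \<exists>f\<in>Cc. regular_representation G f T}"

definition C0_units :: "'g::topological_space groupoid \<Rightarrow> ('g \<Rightarrow> complex) set" where
  "C0_units G = {f. continuous_on (units G) f
     \<and> (\<forall>e>0. compact {x \<in> units G. e \<le> cmod (f x)})}"

text \<open>The copy of \<open>C\<^sub>0\<close> of the unit space inside \<^const>\<open>reduced_cstar\<close>: if
  \<open>f\<close> is supported on the unit space, then the sum defining \<open>\<pi>(f)\<close> has only the term
  \<open>a = rng G c\<close>.\<close>

definition diagonal :: "'g::topological_space groupoid \<Rightarrow> 'g op set" where
  "diagonal G = {T :: 'g op. \<exists>f\<in>C0_units G. \<forall>\<xi> c. coef (T \<xi>) c = f (rng G c) * coef \<xi> c}"

definition C0_separates_ideals :: "'g::topological_space groupoid \<Rightarrow> bool" where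
  "C0_separates_ideals G \<longleftrightarrow>
     inj_on (\<lambda>I. I \<inter> diagonal G) {I. closed_ideal (reduced_cstar G) I}"

definition compact_below :: "'g::topological_space groupoid \<Rightarrow> 'g set \<Rightarrow> 'g set \<Rightarrow> bool" where
  "compact_below G K V \<longleftrightarrow>
     (\<exists>(n::nat) A. (\<forall>i<n. open_bisection G (A i)) \<and> K \<subseteq> (\<Union>i<n. src G ` A i)
        \<and> (\<forall>i<n. rng G ` A i \<subseteq> V) \<and> disjoint_family_on (\<lambda>i. rng G ` A i) {..<n})"

definition open_below2 :: "'g::topological_space groupoid \<Rightarrow> 'g set \<Rightarrow> 'g set \<Rightarrow> bool" where
  "open_below2 G U V \<longleftrightarrow>
     (\<forall>F. compact F \<and> F \<subseteq> U \<longrightarrow>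
        (\<exists>O1 O2. open_in_units G O1 \<and> open_in_units G O2 \<and> O1 \<noteq> {} \<and> O2 \<noteq> {}
           \<and> O1 \<subseteq> V \<and> O2 \<subseteq> V \<and> O1 \<inter> O2 = {} \<and> compact_below G F O1 \<and> compact_below G F O2))"

definition purely_infinite_groupoid :: "'g::topological_space groupoid \<Rightarrow> bool" where
  "purely_infinite_groupoid G \<longleftrightarrow>
     (\<forall>O1 O2. open_in_units G O1 \<and> open_in_units G O2 \<and> O1 \<noteq> {} \<and> O2 \<noteq> {}
        \<and> O1 \<subseteq> rng G ` set_mult G UNIV O2 \<longrightarrow> open_below2 G O1 O2)"

definition groupoid_small :: "'g::topological_space groupoid \<Rightarrow> 'g set \<Rightarrow> bool" where
  "groupoid_small G M \<longleftrightarrow>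
     (\<forall>C K. compact C \<and> C \<subseteq> - units G \<and> compact K \<and> K \<subseteq> M \<longrightarrow>
        (\<exists>F U. compact F \<and> open_in_units G U \<and> F \<subseteq> U \<and> U \<subseteq> M
           \<and> K \<subseteq> rng G ` set_mult G UNIV F \<and> set_mult G (set_mult G U C) U = {}))"

end

theory Submission
  imports Defs
begin

text \<open>
  Write \<open>A\<close> for the reduced C*-algebra, let \<open>a = x\<^sup>*x\<close> and \<open>b = y\<^sup>*y\<close> be in \<open>A\<close> with \<open>b\<close> in the ideal
  generated by \<open>a\<close>, let \<open>e\<close> be the conditional expectation of \<open>a\<close> on the unit space, and let \<open>W\<close> be the
  invariant open set \<open>r(G{e > 0})\<close>. Since \<open>a\<close> vanishes under the regular representations at all units
  outside \<open>W\<close>, so do \<open>b\<close> and \<open>y\<close>. The operators with this property form an ideal which has the same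
  intersection with the diagonal as the closure of the operators \<open>\<pi>(f)\<close> with \<open>f\<close> compactly supported
  over \<open>W\<close>; by separation of ideals the two ideals coincide, so \<open>y\<close> is a limit of such \<open>\<pi>(f)\<close>.

  It therefore suffices to find, for a compact \<open>K \<subseteq> W\<close>, some \<open>V\<close> in \<open>A\<close> such that \<open>V\<^sup>*aV\<close> is close to a
  function \<open>h\<close> in the diagonal with \<open>h = 1\<close> on \<open>K\<close>. Choose \<open>\<eta> > 0\<close> so small that \<open>K \<subseteq> r(G{e > 2\<eta>})\<close> and
  approximate \<open>a\<close> by \<open>\<pi>(g)\<close>. Groupoid smallness of \<open>{e > \<eta>}\<close> gives an open \<open>Y \<subseteq> {e > \<eta>}\<close> over which
  \<open>\<pi>(g)\<close> acts diagonally and such that \<open>K \<subseteq> r(GY)\<close>; pure infiniteness moves \<open>K\<close> into \<open>Y\<close> by bisections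
  \<open>A\<^sub>i\<close> with disjoint ranges. For a partition of unity \<open>k\<^sub>i\<close> on \<open>K\<close> subordinate to the \<open>s(A\<^sub>i)\<close>, let \<open>V\<close> be given
  by the function \<open>\<surd>(k\<^sub>i(s(\<gamma>)) / e(r(\<gamma>)))\<close> on \<open>A\<^sub>i\<close>. Then \<open>V\<^sup>*eV = \<Sum>\<^sub>i k\<^sub>i\<close>, and \<open>\<parallel>V\<parallel>\<^sup>2 \<le> 1/\<eta>\<close> independently of the
  number of bisections, which controls the error.

  The same construction with \<open>e = 1\<close> and two disjoint target sets yields \<open>V\<^sub>1\<close>, \<open>V\<^sub>2\<close> with \<open>V\<^sub>1\<^sup>*V\<^sub>2 = 0\<close> while
  both \<open>V\<^sub>i\<^sup>*V\<^sub>i\<close> act as a unit on a given \<open>\<pi>(f)\<close>. Hence a character vanishes on all \<open>\<pi>(f)\<close>, and it is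
  contractive because \<open>A\<close> is complete.
\<close>

section \<open>Operators on the square summable functions\<close>

lemmas coef_simps = plus_ell2.rep_eq uminus_ell2.rep_eq zero_ell2.rep_eq scale_ell2.rep_eq

lemma coef_diff: "coef (f - g) i = coef f i - coef g i"
  by (simp only: minus_ell2_def coef_simps) simp

lemma coef_sum: "coef (\<Sum>j\<in>S. f j) i = (\<Sum>j\<in>S. coef (f j) i)"
  by (induction S rule: infinite_finite_induct) (simp_all add: coef_simps)

lemma coef_scaleR: "coef (r *\<^sub>R f) i = of_real r * coef f i"
  by (simp add: scaleR_ell2_def coef_simps)

lemma has_sum_cinner: "((\<lambda>i. cnj (coef f i) * coef g i) has_sum cinner f g) UNIV"
  unfolding cinner_def by (rule has_sum_infsum[OF coef_product_summable])

lemma cinner_commute: "cinner f g = cnj (cinner g f)"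
  unfolding cinner_def infsum_cnj[symmetric] by (intro infsum_cong) simp

lemma cinner_add_right: "cinner f (g + h) = cinner f g + cinner f h"
  unfolding cinner_def infsum_add[OF coef_product_summable coef_product_summable, symmetric]
  by (intro infsum_cong) (simp add: coef_simps distrib_left)

lemma cinner_scale_right: "cinner f (scale_ell2 c g) = c * cinner f g"
  unfolding cinner_def infsum_cmult_right'[symmetric]
  by (intro infsum_cong) (simp add: coef_simps)

lemma scale_minus_one: "scale_ell2 (- 1) f = - f"
  by (intro ell2_eqI) (simp add: coef_simps)

lemma cinner_diff_right: "cinner f (g - h) = cinner f g - cinner f h"
  using cinner_add_right[of f g "- h"] cinner_scale_right[of f "- 1" h]
  by (simp add: scale_minus_one)

lemma cinner_add_left: "cinner (f + g) h = cinner f h + cinner g h"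
  by (metis cinner_commute cinner_add_right complex_cnj_add)

lemma cinner_scale_left: "cinner (scale_ell2 c f) g = cnj c * cinner f g"
  by (metis cinner_commute cinner_scale_right complex_cnj_mult)

lemma cinner_diff_left: "cinner (f - g) h = cinner f h - cinner g h"
  by (metis cinner_commute cinner_diff_right complex_cnj_diff)

lemma cinner_self: "cinner f f = of_real ((norm f)\<^sup>2)"
proof (rule complex_eqI)
  show "Im (cinner f f) = Im (complex_of_real ((norm f)\<^sup>2))"
    by (metis Reals_cnj_iff cinner_commute complex_is_Real_iff Im_complex_of_real)
qed (simp add: norm_ell2_def inner_ell2_def[symmetric])

lemma norm_cinner_le: "cmod (cinner f g) \<le> norm f * norm g"
proof (cases "cinner f g = 0")
  case False
  \<comment> \<open>The phase \<open>c\<close> rotates \<open>g\<close> until the inner product is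
    real and nonnegative; the real Cauchy-Schwarz inequality then applies without loss.\<close>
  define c where "c = cnj (cinner f g) / cmod (cinner f g)"
  have c1: "cmod c = 1"
    using False by (simp add: c_def norm_divide)
  have "cinner f (scale_ell2 c g) = of_real (cmod (cinner f g))"
    using False complex_norm_square[of "cinner f g"]
    by (simp add: cinner_scale_right c_def field_simps power2_eq_square)
  then have "cmod (cinner f g) = inner f (scale_ell2 c g)"
    by (simp add: inner_ell2_def)
  also have "\<dots> \<le> norm f * norm (scale_ell2 c g)"
    by (rule norm_cauchy_schwarz)
  finally show ?thesis
    by (simp add: norm_scale_ell2 c1)
qed simp

lemma bounded_linear_cinner: "bounded_linear (cinner f)"
proof (rule bounded_linear_intro[where K = "norm f"])
  show "norm (cinner f g) \<le> norm g * norm f" for g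
    using norm_cinner_le[of f g] by (simp only: mult.commute)
qed (simp_all add: cinner_add_right scaleR_ell2_def cinner_scale_right scaleR_conv_of_real)

lemma ell2_eq_by_cinner: "(\<And>h. cinner h f = cinner h g) \<Longrightarrow> f = g"
  using cinner_self[of "f - g"] by (simp add: cinner_diff_right)

text \<open>Testing with \<open>g = f\<close> suffices. The lemma lets operators that contain
  adjoints be estimated through their sesquilinear forms.\<close>

lemma norm_le_by_cinner:
  assumes "\<And>g. cmod (cinner g f) \<le> B * norm g" "0 \<le> B"
  shows "norm f \<le> B"
proof (cases "norm f = 0")
  case False
  have "norm f * norm f \<le> B * norm f"
    using assms(1)[of f] unfolding cinner_self norm_of_real power2_eq_square by simp
  then show ?thesis using False by simp
qed (use assms in auto)

lemma has_sum_norm_ell2: "((\<lambda>i. (cmod (coef f i))\<^sup>2) has_sum (norm f)\<^sup>2) UNIV"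
proof -
  have "((\<lambda>i. Re (cnj (coef f i) * coef f i)) has_sum Re (cinner f f)) UNIV"
    by (rule has_sum_Re[OF has_sum_cinner])
  moreover have "Re (cnj z * z) = (cmod z)\<^sup>2" for z
    unfolding cmod_power2 by (simp add: power2_eq_square)
  ultimately show ?thesis by (simp add: cinner_self)
qed

lemma norm_coef_le: "cmod (coef f i) \<le> norm f"
proof -
  have "(\<Sum>\<^sub>\<infinity>j\<in>{i}. (cmod (coef f j))\<^sup>2) \<le> (\<Sum>\<^sub>\<infinity>j. (cmod (coef f j))\<^sup>2)"
    by (intro infsum_mono_neutral) (auto simp: coef_square_summable)
  then have "(cmod (coef f i))\<^sup>2 \<le> (norm f)\<^sup>2"
    by (simp add: infsumI[OF has_sum_norm_ell2])
  then show ?thesis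
    by (rule power2_le_imp_le) simp
qed

lemma bounded_linear_coef: "bounded_linear (\<lambda>f. coef f i)"
  by (rule bounded_linear_intro[where K = 1])
    (auto simp: coef_simps scaleR_ell2_def norm_coef_le scaleR_conv_of_real)

lemma tendsto_coef: "(f \<longlongrightarrow> l) F \<Longrightarrow> ((\<lambda>n. coef (f n) i) \<longlongrightarrow> coef l i) F"
  by (rule bounded_linear.tendsto[OF bounded_linear_coef])

lift_definition delta :: "'i \<Rightarrow> 'i ell2" is "\<lambda>i j. if j = i then 1 else 0"
  by (rule finite_nonzero_values_imp_summable_on)
    (rule finite_subset[of _ "{i}" for i], auto)

lemmas coef_delta = delta.rep_eq

lemma cinner_delta_left: "cinner (delta i) f = coef f i"
proof -
  have "cinner (delta i) f = (\<Sum>\<^sub>\<infinity>j\<in>{i}. cnj (coef (delta i) j) * coef f j)"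
    unfolding cinner_def by (intro infsum_cong_neutral) (auto simp: coef_delta)
  then show ?thesis by (simp add: coef_delta)
qed

lemma cinner_delta_right: "cinner f (delta i) = cnj (coef f i)"
  by (subst cinner_commute) (simp add: cinner_delta_left)

lemma norm_delta: "norm (delta i) = 1"
proof -
  have "(norm (delta i))\<^sup>2 = 1"
    using cinner_self[of "delta i"] by (simp add: cinner_delta_left coef_delta del: of_real_power)
  then show ?thesis by (simp add: power2_eq_1_iff) (use norm_ge_zero[of "delta i"] in linarith)
qed

text \<open>By Pythagoras the squared distance from \<open>f\<close> to its partial sum over
  \<open>S\<close> is the squared norm of \<open>f\<close> minus the partial sum of squares, which
  tends to zero.\<close>

lemma delta_expansion:
  "((\<lambda>S. \<Sum>i\<in>S. scale_ell2 (coef f i) (delta i)) \<longlongrightarrow> f) (finite_subsets_at_top UNIV)"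
proof -
  define p where "p S = (\<Sum>i\<in>S. scale_ell2 (coef f i) (delta i))" for S
  have coef_p: "coef (p S) j = (if j \<in> S then coef f j else 0)" if "finite S" for S j
    using that by (simp add: p_def coef_sum coef_simps coef_delta if_distrib sum.delta cong: if_cong)
  have eq: "(norm (p S - f))\<^sup>2 = (norm f)\<^sup>2 - (\<Sum>i\<in>S. (cmod (coef f i))\<^sup>2)" if "finite S" for S
  proof -
    have "((\<lambda>i. (if i \<in> S then (cmod (coef f i))\<^sup>2 else 0)) has_sum (\<Sum>i\<in>S. (cmod (coef f i))\<^sup>2)) UNIV"
      using has_sum_finite[OF that, of "\<lambda>i. (cmod (coef f i))\<^sup>2"]
      by (subst (asm) has_sum_cong_neutral[where T = UNIV and g = "\<lambda>i. (if i \<in> S then (cmod (coef f i))\<^sup>2 else 0)"]) auto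
    note has_sum_add[OF has_sum_norm_ell2[of f] has_sum_cmult_right[OF this, of "- 1"]]
    moreover have "(cmod (coef f i))\<^sup>2 + - 1 * (if i \<in> S then (cmod (coef f i))\<^sup>2 else 0)
        = (cmod (coef (p S - f) i))\<^sup>2" for i
      by (simp add: coef_diff coef_p[OF that])
    ultimately have "((\<lambda>i. (cmod (coef (p S - f) i))\<^sup>2) has_sum
        (norm f)\<^sup>2 + - 1 * (\<Sum>i\<in>S. (cmod (coef f i))\<^sup>2)) UNIV"
      by simp
    then have "(norm (p S - f))\<^sup>2 = (norm f)\<^sup>2 + - 1 * (\<Sum>i\<in>S. (cmod (coef f i))\<^sup>2)"
      using has_sum_norm_ell2 has_sum_unique by blast
    then show ?thesis by simp
  qed
  have "((\<lambda>S. (norm f)\<^sup>2 - (\<Sum>i\<in>S. (cmod (coef f i))\<^sup>2)) \<longlongrightarrow> (norm f)\<^sup>2 - (norm f)\<^sup>2)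
          (finite_subsets_at_top UNIV)"
    by (intro tendsto_intros has_sum_norm_ell2[unfolded has_sum_def])
  then have "((\<lambda>S. (norm f)\<^sup>2 - (\<Sum>i\<in>S. (cmod (coef f i))\<^sup>2)) \<longlongrightarrow> 0) (finite_subsets_at_top UNIV)"
    by simp
  then have "((\<lambda>S. (norm (p S - f))\<^sup>2) \<longlongrightarrow> 0) (finite_subsets_at_top UNIV)"
    by (rule Lim_transform_eventually) (intro eventually_finite_subsets_at_top_weakI, simp add: eq)
  then have "((\<lambda>S. sqrt ((norm (p S - f))\<^sup>2)) \<longlongrightarrow> sqrt 0) (finite_subsets_at_top UNIV)"
    by (rule tendsto_real_sqrt)
  then have "((\<lambda>S. norm (p S - f)) \<longlongrightarrow> 0) (finite_subsets_at_top UNIV)"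
    by simp
  then show ?thesis
    unfolding p_def by (simp add: tendsto_norm_zero_iff LIM_zero_iff)
qed

text \<open>Both functionals commute with the limit in the basis expansion. Agreement is only asked
  for basis vectors in the support of \<open>f\<close>, so that statements about vectors supported
  in a subset of the groupoid follow too.\<close>

lemma ell2_functional_unique:
  assumes P: "bounded_linear P" "\<And>c f. P (scale_ell2 c f) = c * P f"
    and Q: "bounded_linear Q" "\<And>c f. Q (scale_ell2 c f) = c * Q f"
    and agree: "\<And>i. coef f i \<noteq> 0 \<Longrightarrow> P (delta i) = Q (delta i)"
  shows "P f = (Q f :: complex)"
proof (rule tendsto_unique)
  let ?p = "\<lambda>S. \<Sum>i\<in>S. scale_ell2 (coef f i) (delta i)"
  show "((\<lambda>S. P (?p S)) \<longlongrightarrow> P f) (finite_subsets_at_top UNIV)"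
    by (rule bounded_linear.tendsto[OF P(1) delta_expansion])
  have "P (scale_ell2 (coef f i) (delta i)) = Q (scale_ell2 (coef f i) (delta i))" for i
    using agree[of i] by (cases "coef f i = 0") (simp_all add: P(2) Q(2))
  then have "P (?p S) = Q (?p S)" for S
    by (simp add: linear_sum[OF bounded_linear.linear[OF P(1)]]
        linear_sum[OF bounded_linear.linear[OF Q(1)]])
  then show "((\<lambda>S. P (?p S)) \<longlongrightarrow> Q f) (finite_subsets_at_top UNIV)"
    using bounded_linear.tendsto[OF Q(1) delta_expansion] by simp
qed simp

text \<open>Completeness here makes the operator space complete, which is what allows a geometric
  series of operators to be summed in \<open>character_contractive\<close>.\<close>

instance ell2 :: (type) banach
proof
  fix X :: "nat \<Rightarrow> 'a ell2"
  assume X: "Cauchy X"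
  have "convergent (\<lambda>n. coef (X n) i)" for i
    by (intro Cauchy_convergent bounded_linear.Cauchy[OF bounded_linear_coef X])
  then obtain g where g: "(\<lambda>n. coef (X n) i) \<longlonglongrightarrow> g i" for i
    using that[of "\<lambda>i. lim (\<lambda>n. coef (X n) i)"] by (simp add: convergent_LIMSEQ_iff)
  \<comment> \<open>Letting \<open>m\<close> tend to infinity inside a finite sum gives a bound
    uniform in \<open>S\<close>, at a point where \<open>g\<close> is not yet known to be square
    summable.\<close>
  have fin: "(\<Sum>i\<in>S. (cmod (coef (X n) i - g i))\<^sup>2) \<le> e\<^sup>2"
    if "finite S" and N: "\<And>m. m \<ge> N \<Longrightarrow> norm (X n - X m) \<le> e" for S n N e
  proof (rule LIMSEQ_le_const2)
    show "(\<lambda>m. \<Sum>i\<in>S. (cmod (coef (X n) i - coef (X m) i))\<^sup>2) \<longlonglongrightarrow> (\<Sum>i\<in>S. (cmod (coef (X n) i - g i))\<^sup>2)"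
      by (intro tendsto_intros g)
    have "(\<Sum>i\<in>S. (cmod (coef (X n) i - coef (X m) i))\<^sup>2) \<le> e\<^sup>2" if "m \<ge> N" for m
    proof -
      have "(\<Sum>i\<in>S. (cmod (coef (X n - X m) i))\<^sup>2) \<le> (norm (X n - X m))\<^sup>2"
        using infsumI[OF has_sum_norm_ell2[of "X n - X m"]] \<open>finite S\<close>
        by (metis finite_sum_le_infsum coef_square_summable subset_UNIV zero_le_power2)
      also have "\<dots> \<le> e\<^sup>2"
        using N[OF that] by (intro power_mono) auto
      finally show ?thesis by (simp add: coef_diff)
    qed
    then show "\<exists>N. \<forall>m\<ge>N. (\<Sum>i\<in>S. (cmod (coef (X n) i - coef (X m) i))\<^sup>2) \<le> e\<^sup>2" by blast
  qed
  have Cau: "\<exists>N. \<forall>n\<ge>N. \<forall>m\<ge>N. norm (X n - X m) \<le> e" if "e > 0" for e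
    using X that unfolding Cauchy_def dist_norm by (meson less_imp_le)
  obtain N1 where N1: "\<And>n m. n \<ge> N1 \<Longrightarrow> m \<ge> N1 \<Longrightarrow> norm (X n - X m) \<le> 1"
    using Cau[of 1] by auto
  \<comment> \<open>Square summability of \<open>g\<close> itself follows by writing it as
    \<open>X N1\<close> plus the negative of this difference.\<close>
  have "(\<lambda>i. (cmod (coef (X N1) i - g i))\<^sup>2) summable_on UNIV"
    by (intro nonneg_bdd_above_summable_on bdd_aboveI2[where M = "1\<^sup>2"] fin) (use N1 in auto)
  then have "(\<lambda>i. (cmod (- 1 * (coef (X N1) i - g i)))\<^sup>2) summable_on UNIV"
    by (rule square_summable_scale)
  from square_summable_add[OF coef_square_summable[of "X N1"] this]
  have sg: "(\<lambda>i. (cmod (g i))\<^sup>2) summable_on UNIV" by simp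
  define G where "G = Abs_ell2 g"
  have G: "coef G i = g i" for i
    unfolding G_def using sg by (subst Abs_ell2_inverse) auto
  have "X \<longlonglongrightarrow> G"
  proof (rule LIMSEQ_I)
    fix r :: real assume "r > 0"
    then obtain N where N: "\<And>n m. n \<ge> N \<Longrightarrow> m \<ge> N \<Longrightarrow> norm (X n - X m) \<le> r / 2"
      using Cau[of "r / 2"] by auto
    have "norm (X n - G) < r" if "n \<ge> N" for n
    proof -
      have "(norm (X n - G))\<^sup>2 \<le> (r / 2)\<^sup>2"
        unfolding infsumI[OF has_sum_norm_ell2, symmetric]
        by (intro infsum_le_finite_sums coef_square_summable) (unfold coef_diff G, rule fin[where N = N], use N that in auto)
      then have "norm (X n - G) \<le> r / 2"
        using \<open>r > 0\<close> by (auto dest: power2_le_imp_le)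
      then show ?thesis using \<open>r > 0\<close> by linarith
    qed
    then show "\<exists>N. \<forall>n\<ge>N. norm (X n - G) < r" by blast
  qed
  then show "convergent X" by (auto simp: convergent_def)
qed

section \<open>Complex linear operators and their adjoints\<close>

text \<open>The type of operators only records real linearity, so compatibility with complex scalars
  has to be carried as a predicate.\<close>

definition complex_linear :: "'i op \<Rightarrow> bool" where
  "complex_linear T \<longleftrightarrow> (\<forall>c f. T (scale_ell2 c f) = scale_ell2 c (T f))"

lemma complex_linearD: "complex_linear T \<Longrightarrow> T (scale_ell2 c f) = scale_ell2 c (T f)"
  by (simp add: complex_linear_def)

lemma scale_add: "scale_ell2 c (f + g) = scale_ell2 c f + scale_ell2 c g"
  by (intro ell2_eqI) (simp add: coef_simps algebra_simps)

lemma scale_diff: "scale_ell2 c (f - g) = scale_ell2 c f - scale_ell2 c g"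
  by (intro ell2_eqI) (simp add: coef_simps coef_diff algebra_simps)

lemma scale_ell2_scale: "scale_ell2 c (scale_ell2 d f) = scale_ell2 (c * d) f"
  by (intro ell2_eqI) (simp add: coef_simps)

lemma scaleR_scale: "r *\<^sub>R scale_ell2 c f = scale_ell2 c (r *\<^sub>R f)"
  by (simp add: scaleR_ell2_def scale_ell2_scale mult.commute)

lemma complex_linear_add: "complex_linear S \<Longrightarrow> complex_linear T \<Longrightarrow> complex_linear (S + T)"
  by (simp add: complex_linear_def blinfun.add_left scale_add)

lemma complex_linear_diff: "complex_linear S \<Longrightarrow> complex_linear T \<Longrightarrow> complex_linear (S - T)"
  by (simp add: complex_linear_def blinfun.diff_left scale_diff)

lemma complex_linear_compose: "complex_linear S \<Longrightarrow> complex_linear T \<Longrightarrow> complex_linear (S o\<^sub>L T)"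
  by (simp add: complex_linear_def)

lemma complex_linear_scale: "complex_linear T \<Longrightarrow> complex_linear (scale_op c T)"
  by (simp add: complex_linear_def scale_op_apply scale_ell2_scale mult.commute)

lemma complex_linear_coefI:
  fixes T :: "'i op"
  assumes "\<And>c f i. coef (T (scale_ell2 c f)) i = c * coef (T f) i"
  shows "complex_linear T"
  unfolding complex_linear_def by (auto intro!: ell2_eqI simp: assms coef_simps)

lemma tendsto_blinfun_apply: "(X \<longlongrightarrow> T) F \<Longrightarrow> ((\<lambda>n. blinfun_apply (X n) f) \<longlongrightarrow> T f) F"
  by (intro blinfun.tendsto) auto

lemma closed_complex_linear: "closed {T :: 'i op. complex_linear T}"
proof -
  have "closed {T :: 'i op. T (scale_ell2 c f) = scale_ell2 c (T f)}" for c f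
    by (intro closed_Collect_eq bounded_linear.continuous_on[OF bounded_linear_scale_ell2]
        continuous_intros)
  then have "closed (\<Inter>c f. {T :: 'i op. T (scale_ell2 c f) = scale_ell2 c (T f)})"
    by blast
  moreover have "(\<Inter>c f. {T :: 'i op. T (scale_ell2 c f) = scale_ell2 c (T f)})
      = {T :: 'i op. complex_linear T}"
    by (auto simp: complex_linear_def)
  ultimately show ?thesis by simp
qed

lemma complex_linear_zero_on_basis:
  fixes T :: "'i op"
  assumes T: "complex_linear T" and "\<And>i. coef f i \<noteq> 0 \<Longrightarrow> T (delta i) = 0"
  shows "blinfun_apply T f = 0"
proof (rule ell2_eqI)
  fix j
  have "coef (T f) j = (\<lambda>_. 0) f"
    by (rule ell2_functional_unique)
      (use assms in \<open>auto simp: complex_linearD coef_simps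
        intro: bounded_linear_zero bounded_linear_compose[OF bounded_linear_coef blinfun.bounded_linear_right]\<close>)
  then show "coef (T f) j = coef 0 j" by (simp add: coef_simps)
qed

text \<open>The coefficients of the adjoint at \<open>g\<close> are forced to be
  \<open>s g i\<close>; the work lies in their square summability. A finite truncation
  \<open>u\<close> of the candidate satisfies \<open>norm u ^ 2 = cinner (T u) g\<close>, which is
  at most \<open>norm T * norm u * norm g\<close>, and one factor \<open>norm u\<close>
  cancels.\<close>

lemma adjoint_exists:
  fixes T :: "'i op"
  assumes T: "complex_linear T"
  shows "\<exists>S :: 'i op. \<forall>f g. cinner (T f) g = cinner f (S g)"
proof -
  define s where "s g i = cinner (T (delta i)) g" for g i
  have fin: "(\<Sum>i\<in>F. (cmod (s g i))\<^sup>2) \<le> (norm T * norm g)\<^sup>2" if "finite F" for F g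
  proof -
    define u where "u = (\<Sum>i\<in>F. scale_ell2 (s g i) (delta i))"
    define A where "A = (\<Sum>i\<in>F. (cmod (s g i))\<^sup>2)"
    have A0: "0 \<le> A" unfolding A_def by (intro sum_nonneg) auto
    have sumL: "cinner (\<Sum>i\<in>F. h i) k = (\<Sum>i\<in>F. cinner (h i) k)" for h and k :: "'i ell2"
      using that by (induction F) (auto simp: cinner_add_left cinner_def[of 0] coef_simps)
    have "cinner (T u) g = of_real A"
      unfolding u_def A_def
      by (simp add: blinfun.sum_right sumL complex_linearD[OF T] cinner_scale_left s_def[symmetric]
          complex_norm_square mult.commute del: of_real_power)
    moreover have "cinner u u = of_real A"
      unfolding A_def
      by (subst (1) u_def) (use that in \<open>simp add: sumL cinner_scale_left cinner_delta_left u_def coef_sum coef_simps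
        coef_delta complex_norm_square mult.commute if_distrib sum.delta cong: if_cong del: of_real_power\<close>)
    then have "(norm u)\<^sup>2 = A"
      by (simp add: cinner_self flip: of_real_power)
    moreover have "cmod (cinner (T u) g) \<le> norm T * norm u * norm g"
      by (intro order_trans[OF norm_cinner_le] mult_right_mono norm_blinfun) auto
    ultimately have *: "(norm u)\<^sup>2 \<le> norm T * norm g * norm u"
      using A0 by (simp add: mult.commute mult.left_commute)
    have "norm u \<le> norm T * norm g"
    proof (cases "norm u = 0")
      case False
      then show ?thesis using * by (simp add: power2_eq_square)
    qed simp
    then show ?thesis
      using \<open>(norm u)\<^sup>2 = A\<close> unfolding A_def by (metis norm_ge_zero power_mono)
  qed
  have sq: "(\<lambda>i. (cmod (s g i))\<^sup>2) summable_on UNIV" for g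
    by (intro nonneg_bdd_above_summable_on bdd_aboveI2[where M = "(norm T * norm g)\<^sup>2"] fin) auto
  define S0 where "S0 g = Abs_ell2 (s g)" for g
  have S0: "coef (S0 g) i = s g i" for g i
    unfolding S0_def using sq by (subst Abs_ell2_inverse) auto
  have bl: "bounded_linear S0"
  proof (rule bounded_linear_intro[where K = "norm T"])
    show "S0 (f + g) = S0 f + S0 g" for f g
      by (intro ell2_eqI) (simp add: S0 s_def coef_simps cinner_add_right)
    show "S0 (r *\<^sub>R f) = r *\<^sub>R S0 f" for r f
      by (intro ell2_eqI) (simp add: S0 s_def coef_simps scaleR_ell2_def cinner_scale_right)
    show "norm (S0 g) \<le> norm g * norm T" for g
    proof (rule power2_le_imp_le)
      show "(norm (S0 g))\<^sup>2 \<le> (norm g * norm T)\<^sup>2"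
        unfolding infsumI[OF has_sum_norm_ell2, symmetric] S0
        by (intro infsum_le_finite_sums sq) (use fin[of _ g] in \<open>simp add: mult.commute\<close>)
    qed simp
  qed
  have "cinner (T f) g = cinner f (S0 g)" for f g
  proof -
    have "cinner g (T f) = cinner (S0 g) f"
    proof (rule ell2_functional_unique)
      show "bounded_linear (\<lambda>f. cinner g (T f))"
        by (rule bounded_linear_compose[OF bounded_linear_cinner blinfun.bounded_linear_right])
      show "bounded_linear (cinner (S0 g))"
        by (rule bounded_linear_cinner)
      show "cinner g (T (scale_ell2 c f)) = c * cinner g (T f)"
        "cinner (S0 g) (scale_ell2 c f) = c * cinner (S0 g) f" for c f
        by (simp_all add: complex_linearD[OF T] cinner_scale_right)
      show "cinner g (T (delta i)) = cinner (S0 g) (delta i)" for i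
        by (simp add: cinner_delta_right S0 s_def) (rule cinner_commute)
    qed
    then show ?thesis by (metis cinner_commute)
  qed
  then show ?thesis
    by (intro exI[of _ "Blinfun S0"]) (simp add: bounded_linear_Blinfun_apply[OF bl])
qed

lemma adj_unique:
  fixes S T :: "'i op"
  assumes "\<And>f g. cinner (T f) g = cinner f (blinfun_apply S g)"
  shows "adj T = S"
  unfolding adj_def
proof (rule the_equality)
  fix S' :: "'i op" assume "\<forall>f g. cinner (T f) g = cinner f (S' g)"
  then have "cinner f (S' g) = cinner f (S g)" for f g
    by (metis assms)
  then show "S' = S"
    by (intro blinfun_eqI ell2_eq_by_cinner)
qed (use assms in blast)

lemma cinner_adj:
  assumes "complex_linear T"
  shows "cinner (T f) g = cinner f (adj T g)"
  using adjoint_exists[OF assms] adj_unique by metis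

lemma complex_linear_adj:
  assumes "complex_linear T"
  shows "complex_linear (adj T)"
  unfolding complex_linear_def
  by (intro allI ell2_eq_by_cinner) (metis assms cinner_adj cinner_scale_right)

lemma adj_diff:
  assumes "complex_linear S" "complex_linear T"
  shows "adj (S - T) = adj S - adj T"
  by (rule adj_unique) (simp add: blinfun.diff_left cinner_diff_left cinner_diff_right cinner_adj assms)

lemma adj_compose:
  assumes "complex_linear S" "complex_linear T"
  shows "adj (S o\<^sub>L T) = adj T o\<^sub>L adj S"
  by (rule adj_unique) (simp add: cinner_adj assms)

lemma norm_adj_le:
  assumes "complex_linear T"
  shows "norm (adj T) \<le> norm T"
proof (rule norm_blinfun_bound)
  fix g
  show "norm (adj T g) \<le> norm T * norm g"
  proof (rule norm_le_by_cinner)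
    fix h
    have "cmod (cinner h (adj T g)) \<le> norm (T h) * norm g"
      unfolding cinner_adj[OF assms, symmetric] by (rule norm_cinner_le)
    also have "\<dots> \<le> norm T * norm h * norm g"
      by (intro mult_right_mono norm_blinfun) auto
    finally show "cmod (cinner h (adj T g)) \<le> norm T * norm g * norm h"
      by (simp add: mult_ac)
  qed simp
qed simp

lemma tendsto_adj:
  assumes "\<And>n. complex_linear (X n)" "complex_linear T" "X \<longlonglongrightarrow> T"
  shows "(\<lambda>n. adj (X n)) \<longlonglongrightarrow> adj T"
proof (rule Lim_transform_bound[where g = "\<lambda>n. X n - T", THEN LIM_zero_cancel])
  show "\<forall>\<^sub>F n in sequentially. norm (adj (X n) - adj T) \<le> norm (X n - T)"
    using assms(1,2) by (intro always_eventually allI) (metis adj_diff norm_adj_le complex_linear_diff)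
qed (use assms LIM_zero in blast)

lemma norm_adj_self:
  assumes "complex_linear T"
  shows "cinner f ((adj T o\<^sub>L T) f) = of_real ((norm (T f))\<^sup>2)"
  by (simp add: cinner_adj[OF assms, symmetric] cinner_self)

text \<open>Injectivity of the index map means that every coefficient of \<open>f\<close> is used at
  most once, so the bound on the weights bounds the operator. Multiplication operators are the case
  of the identity map; bisections give the other use.\<close>

lemma weighted_shift_exists:
  assumes inj: "inj_on \<theta> S" and w: "\<And>c. c \<in> S \<Longrightarrow> cmod (w c) \<le> B" and "0 \<le> B"
  shows "\<exists>T :: 'i op. complex_linear T \<and> norm T \<le> B
    \<and> (\<forall>f c. coef (T f) c = (if c \<in> S then w c * coef f (\<theta> c) else 0))"
proof -
  define t where "t f c = (if c \<in> S then w c * coef f (\<theta> c) else 0)" for f c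
  have dom: "((\<lambda>c. if c \<in> S then B\<^sup>2 * (cmod (coef f (\<theta> c)))\<^sup>2 else 0) has_sum
      B\<^sup>2 * (\<Sum>\<^sub>\<infinity>d\<in>\<theta> ` S. (cmod (coef f d))\<^sup>2)) UNIV" for f
  proof -
    have "((\<lambda>d. (cmod (coef f d))\<^sup>2) has_sum (\<Sum>\<^sub>\<infinity>d\<in>\<theta> ` S. (cmod (coef f d))\<^sup>2)) (\<theta> ` S)"
      by (intro has_sum_infsum summable_on_subset_banach[OF coef_square_summable]) auto
    then have "((\<lambda>c. B\<^sup>2 * (cmod (coef f (\<theta> c)))\<^sup>2) has_sum B\<^sup>2 * (\<Sum>\<^sub>\<infinity>d\<in>\<theta> ` S. (cmod (coef f d))\<^sup>2)) S"
      unfolding has_sum_reindex[OF inj] o_def by (rule has_sum_cmult_right)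
    then show ?thesis
      by (rule has_sum_cong_neutral[THEN iffD1, rotated -1]) auto
  qed
  have le: "(cmod (t f c))\<^sup>2 \<le> (if c \<in> S then B\<^sup>2 * (cmod (coef f (\<theta> c)))\<^sup>2 else 0)" for f c
    by (auto simp: t_def norm_mult power_mult_distrib intro!: mult_right_mono power_mono w)
  have sq: "(\<lambda>c. (cmod (t f c))\<^sup>2) summable_on UNIV" for f
    by (rule summable_on_comparison_test[OF has_sum_imp_summable[OF dom[of f]]]) (use le in auto)
  define T0 where "T0 f = Abs_ell2 (t f)" for f
  have T0: "coef (T0 f) c = t f c" for f c
    unfolding T0_def using sq by (subst Abs_ell2_inverse) auto
  have bd: "norm (T0 f) \<le> B * norm f" for f
  proof (rule power2_le_imp_le)
    have "(norm (T0 f))\<^sup>2 \<le> B\<^sup>2 * (\<Sum>\<^sub>\<infinity>d\<in>\<theta> ` S. (cmod (coef f d))\<^sup>2)"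
      using has_sum_mono[OF has_sum_norm_ell2[of "T0 f"] dom[of f]] le by (simp add: T0)
    also have "\<dots> \<le> B\<^sup>2 * (\<Sum>\<^sub>\<infinity>d. (cmod (coef f d))\<^sup>2)"
      by (intro mult_left_mono infsum_mono_neutral summable_on_subset_banach[OF coef_square_summable])
        (auto simp: coef_square_summable)
    finally show "(norm (T0 f))\<^sup>2 \<le> (B * norm f)\<^sup>2"
      by (simp add: infsumI[OF has_sum_norm_ell2] power_mult_distrib)
  qed (use \<open>0 \<le> B\<close> in simp)
  have bl: "bounded_linear T0"
    by (rule bounded_linear_intro[where K = B])
      (use bd in \<open>auto intro!: ell2_eqI simp: T0 t_def coef_simps coef_scaleR algebra_simps\<close>)
  show ?thesis
    by (intro exI[of _ "Blinfun T0"] conjI norm_blinfun_bound complex_linear_coefI)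
      (use bd \<open>0 \<le> B\<close> in \<open>auto simp: bounded_linear_Blinfun_apply[OF bl] T0 t_def coef_simps\<close>)
qed

lemma scale_op_add: "scale_op c (S + T) = scale_op c S + scale_op c T"
  by (rule blinfun_eqI) (simp add: scale_op_apply blinfun.add_left scale_add)

lemma tendsto_compose:
  fixes X Y :: "'b \<Rightarrow> 'i op"
  shows "(X \<longlongrightarrow> S) F \<Longrightarrow> (Y \<longlongrightarrow> T) F \<Longrightarrow> ((\<lambda>n. X n o\<^sub>L Y n) \<longlongrightarrow> S o\<^sub>L T) F"
  by (rule bounded_bilinear.tendsto[OF bounded_bilinear_blinfun_compose])

lemma norm_scale_op_le: "norm (scale_op c T) \<le> cmod c * norm T"
proof (rule norm_blinfun_bound)
  show "norm (scale_op c T f) \<le> cmod c * norm T * norm f" for f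
    by (simp add: scale_op_apply norm_scale_ell2 mult.assoc mult_left_mono norm_blinfun)
qed simp

lemma bounded_linear_scale_op: "bounded_linear (scale_op c)"
proof (rule bounded_linear_intro[where K = "cmod c"])
  show "norm (scale_op c T) \<le> norm T * cmod c" for T :: "'a op"
    using norm_scale_op_le[of c T] by (simp only: mult.commute)
  show "scale_op c (r *\<^sub>R T) = r *\<^sub>R scale_op c T" for r and T :: "'a op"
    by (rule blinfun_eqI) (simp only: scale_op_apply blinfun.scaleR_left scaleR_scale)
qed (rule scale_op_add)

section \<open>Partitions of unity on locally compact Hausdorff spaces\<close>

lemma Hausdorff_euclidean_t2: "Hausdorff_space (euclidean :: 'a::t2_space topology)"
  unfolding Hausdorff_space_def by (simp add: disjnt_def) (metis hausdorff)

lemma compact_neighbourhood_within: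
  fixes K :: "'a::t2_space set"
  assumes lc: "locally_compact_space (euclidean :: 'a topology)"
    and K: "compact K" "K \<subseteq> U" "open U"
  obtains V C where "open V" "compact C" "K \<subseteq> V" "V \<subseteq> C" "C \<subseteq> U"
proof -
  have "neighbourhood_base_of (compactin euclidean) (euclidean :: 'a topology)"
    using lc locally_compact_space_neighbourhood_base Hausdorff_euclidean_t2 by blast
  then have "\<exists>V C. open V \<and> compact C \<and> x \<in> V \<and> V \<subseteq> C \<and> C \<subseteq> U" if "x \<in> K" for x
    using K(2,3) that unfolding neighbourhood_base_of by (simp add: subset_iff)
  then obtain V C where VC: "\<And>x. x \<in> K \<Longrightarrow> open (V x) \<and> compact (C x) \<and> x \<in> V x \<and> V x \<subseteq> C x \<and> C x \<subseteq> U"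
    by metis
  obtain D where D: "D \<subseteq> K" "finite D" "K \<subseteq> (\<Union>x\<in>D. V x)"
    using compactE_image[OF K(1), of K V] VC by blast
  show ?thesis
    by (rule that[of "\<Union>x\<in>D. V x" "\<Union>x\<in>D. C x"]) (use D VC in \<open>blast intro: open_UN compact_UN\<close>)+
qed

text \<open>Locally compact Hausdorff spaces are completely regular, so a compact set can be
  separated from a closed one without normality. Separating \<open>K\<close> from the complement of
  \<open>V\<close> places the support inside the compact set \<open>C\<close>.\<close>

lemma bump_function:
  fixes K :: "'a::t2_space set"
  assumes lc: "locally_compact_space (euclidean :: 'a topology)"
    and K: "compact K" "K \<subseteq> U" "open U"
  obtains f :: "'a \<Rightarrow> real" and C where "continuous_on UNIV f" "\<And>x. 0 \<le> f x" "\<And>x. f x \<le> 1"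
    "\<And>x. x \<in> K \<Longrightarrow> f x = 1" "compact C" "C \<subseteq> U" "\<And>x. x \<notin> C \<Longrightarrow> f x = 0"
proof -
  obtain V C where VC: "open V" "compact C" "K \<subseteq> V" "V \<subseteq> C" "C \<subseteq> U"
    using compact_neighbourhood_within[OF assms] .
  have "completely_regular_space (euclidean :: 'a topology)"
    using lc Hausdorff_euclidean_t2 by (intro locally_compact_regular_imp_completely_regular_space) auto
  then obtain f where f: "continuous_map (euclidean :: 'a topology) (top_of_set {0..1::real}) f"
      "f ` (- V) \<subseteq> {0}" "f ` K \<subseteq> {1}"
    using Urysohn_completely_regular_compact_closed[of 0 1 "euclidean :: 'a topology" K "- V"] VC K
    by (auto simp: disjnt_def)
  have "f x \<in> {0..1}" for x
    using f(1) by (auto simp: continuous_map_in_subtopology)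
  then show ?thesis
    using f VC by (intro that[of f C]) (fastforce simp: continuous_map_in_subtopology)+
qed

text \<open>The bump functions are combined by a telescoping product instead of being divided by
  their sum, so the resulting functions are continuous on the whole space and their sum never
  exceeds 1.\<close>

lemma partition_of_unity:
  fixes K :: "'a::t2_space set" and n :: nat
  assumes lc: "locally_compact_space (euclidean :: 'a topology)"
    and K: "compact K" "K \<subseteq> (\<Union>i<n. U i)" "\<And>i. i < n \<Longrightarrow> open (U i)"
  obtains k :: "nat \<Rightarrow> 'a \<Rightarrow> real" and C where "\<And>i. i < n \<Longrightarrow> continuous_on UNIV (k i)"
    "\<And>i x. i < n \<Longrightarrow> 0 \<le> k i x" "\<And>i x. i < n \<Longrightarrow> k i x \<le> 1" "\<And>x. (\<Sum>i<n. k i x) \<le> 1"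
    "\<And>x. x \<in> K \<Longrightarrow> (\<Sum>i<n. k i x) = 1"
    "\<And>i. i < n \<Longrightarrow> compact (C i)" "\<And>i. i < n \<Longrightarrow> C i \<subseteq> U i" "\<And>i x. i < n \<Longrightarrow> x \<notin> C i \<Longrightarrow> k i x = 0"
proof -
  have "\<exists>i V C. i < n \<and> open V \<and> compact C \<and> x \<in> V \<and> V \<subseteq> C \<and> C \<subseteq> U i" if "x \<in> K" for x
  proof -
    obtain i where i: "i < n" "x \<in> U i" using K(2) \<open>x \<in> K\<close> by blast
    then show ?thesis
      using compact_neighbourhood_within[OF lc, of "{x}" "U i"] K(3)[OF i(1)]
      by (metis compact_sing empty_subsetI insert_subset)
  qed
  then obtain \<iota> V P where VP: "\<And>x. x \<in> K \<Longrightarrow> \<iota> x < n \<and> open (V x) \<and> compact (P x)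
      \<and> x \<in> V x \<and> V x \<subseteq> P x \<and> P x \<subseteq> U (\<iota> x)"
    by metis
  obtain D where D: "D \<subseteq> K" "finite D" "K \<subseteq> (\<Union>x\<in>D. V x)"
    using compactE_image[OF K(1), of K V] VP by blast
  \<comment> \<open>The compact neighbourhoods are grouped by the index of the open set that was
    chosen to contain them.\<close>
  define Q where "Q i = (\<Union>x\<in>{x\<in>D. \<iota> x = i}. P x)" for i
  have "\<exists>f C. continuous_on UNIV f \<and> (\<forall>x. 0 \<le> f x) \<and> (\<forall>x. f x \<le> (1::real)) \<and> (\<forall>x\<in>Q i. f x = 1)
      \<and> compact C \<and> C \<subseteq> U i \<and> (\<forall>x. x \<notin> C \<longrightarrow> f x = 0)" if "i < n" for i
  proof -
    have "compact (Q i)"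
      unfolding Q_def using D VP by (auto intro!: compact_UN)
    moreover have "Q i \<subseteq> U i"
      unfolding Q_def using D(1) VP by blast
    ultimately show ?thesis
      using bump_function[OF lc, of "Q i" "U i"] K(3)[OF that] by (metis (no_types, lifting))
  qed
  then have "\<forall>i\<in>{..<n}. \<exists>f C. continuous_on UNIV f \<and> (\<forall>x. 0 \<le> f x) \<and> (\<forall>x. f x \<le> (1::real))
      \<and> (\<forall>x\<in>Q i. f x = 1) \<and> compact C \<and> C \<subseteq> U i \<and> (\<forall>x. x \<notin> C \<longrightarrow> f x = 0)"
    by simp
  then obtain f C where "\<forall>i\<in>{..<n}. continuous_on UNIV (f i) \<and> (\<forall>x. 0 \<le> f i x) \<and> (\<forall>x. f i x \<le> (1::real))
      \<and> (\<forall>x\<in>Q i. f i x = 1) \<and> compact (C i) \<and> C i \<subseteq> U i \<and> (\<forall>x. x \<notin> C i \<longrightarrow> f i x = 0)"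
    unfolding bchoice_iff by blast
  then have f: "\<And>i. i < n \<Longrightarrow> continuous_on UNIV (f i)"
      "\<And>i x. i < n \<Longrightarrow> 0 \<le> f i x" "\<And>i x. i < n \<Longrightarrow> f i x \<le> 1"
      "\<And>i x. i < n \<Longrightarrow> x \<in> Q i \<Longrightarrow> f i x = 1"
      "\<And>i. i < n \<Longrightarrow> compact (C i)" "\<And>i. i < n \<Longrightarrow> C i \<subseteq> U i" "\<And>i x. i < n \<Longrightarrow> x \<notin> C i \<Longrightarrow> f i x = 0"
    by simp_all
  \<comment> \<open>Each factor \<open>1 - f j x\<close> is the share left over by index
    \<open>j\<close>; what remains at the end is the full product, which vanishes on
    \<open>K\<close>.\<close>
  define k where "k i x = f i x * (\<Prod>j<i. 1 - f j x)" for i x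
  have k_sum: "(\<Sum>i<m. k i x) = 1 - (\<Prod>j<m. 1 - f j x)" for m x
    by (induction m) (simp_all add: k_def algebra_simps)
  have p0: "0 \<le> (\<Prod>j<m. 1 - f j x)" and p1: "(\<Prod>j<m. 1 - f j x) \<le> 1" if "m \<le> n" for m x
    using that f by (auto intro!: prod_nonneg prod_le_1)
  show ?thesis
  proof (rule that[of k C])
    fix i x assume "i < n"
    then show "continuous_on UNIV (k i)"
      unfolding k_def by (intro continuous_intros f(1)) auto
    show "0 \<le> k i x"
      unfolding k_def using \<open>i < n\<close> p0[of i x] f(2)[of i x] by simp
    show "k i x \<le> 1"
      unfolding k_def using \<open>i < n\<close> p0[of i x] p1[of i x] f(2)[of i x] f(3)[of i x] by (simp add: mult_le_one)
  next
    show "(\<Sum>i<n. k i x) \<le> 1" for x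
      using p0[of n x] by (simp add: k_sum)
  next
    fix x assume "x \<in> K"
    then obtain y where y: "y \<in> D" "x \<in> V y" using D by blast
    then have "\<iota> y < n" "x \<in> Q (\<iota> y)" unfolding Q_def using VP D by blast+
    then have "(\<Prod>j<n. 1 - f j x) = 0"
      using f(4) by (intro prod_zero) auto
    then show "(\<Sum>i<n. k i x) = 1" by (simp add: k_sum)
  qed (use f in \<open>auto simp: k_def\<close>)
qed

section \<open>Etale groupoids\<close>

locale discrete_groupoid =
  fixes G :: "'g groupoid"
  assumes is_groupoid: "is_groupoid G"
begin

abbreviation source ("\<sigma>") where "source \<equiv> src G"
abbreviation range_map ("\<rho>") where "range_map \<equiv> rng G"
abbreviation inverse_map ("\<iota>") where "inverse_map \<equiv> ginv G"
abbreviation product (infixl "\<cdot>" 70) where "product \<equiv> gmult G"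

lemma inv_inv [simp]: "\<iota> (\<iota> a) = a"
  using is_groupoid by (simp add: is_groupoid_def)

lemma composable_inv: "(a, \<iota> a) \<in> composable G" "(\<iota> a, a) \<in> composable G"
  using is_groupoid unfolding is_groupoid_def by metis+

lemma composable_assoc:
  assumes "(a, b) \<in> composable G" "(b, c) \<in> composable G"
  shows "(a \<cdot> b, c) \<in> composable G" "(a, b \<cdot> c) \<in> composable G" "a \<cdot> b \<cdot> c = a \<cdot> (b \<cdot> c)"
  using is_groupoid assms unfolding is_groupoid_def by blast+

lemma composable_cancel:
  assumes "(a, b) \<in> composable G"
  shows "\<iota> a \<cdot> (a \<cdot> b) = b" "a \<cdot> b \<cdot> \<iota> b = a"
  using is_groupoid assms unfolding is_groupoid_def by blast+

lemma mult_inv_right: "a \<cdot> \<iota> a = \<rho> a" and mult_inv_left: "\<iota> a \<cdot> a = \<sigma> a"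
  by (simp_all add: src_def rng_def)

text \<open>This turns the abstract composability relation into an equation between units, the form
  in which all later side conditions can be simplified.\<close>

lemma composable_iff: "(a, b) \<in> composable G \<longleftrightarrow> \<sigma> a = \<rho> b"
proof
  assume ab: "(a, b) \<in> composable G"
  note 1 = composable_assoc[OF ab composable_inv(1)]
  \<comment> \<open>Bracketing \<open>a\<close>, \<open>b\<close> and the inverse of
    \<open>b\<close> in two ways shows that \<open>\<rho> b\<close> is a right unit for
    \<open>a\<close>; cancelling \<open>a\<close> identifies it with
    \<open>\<sigma> a\<close>.\<close>
  have "a \<cdot> \<rho> b = a"
    using 1(3) composable_cancel[OF ab] by (simp add: rng_def)
  then show "\<sigma> a = \<rho> b"
    using composable_cancel(1)[OF 1(2)] by (simp add: rng_def src_def)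
next
  assume eq: "\<sigma> a = \<rho> b"
  have "(a, \<sigma> a) \<in> composable G" "(\<sigma> a, b) \<in> composable G"
    using composable_assoc(2)[OF composable_inv(1) composable_inv(2), of a]
      composable_assoc(1)[OF composable_inv(1) composable_inv(2), of b]
    by (simp_all add: eq src_def[of G a, symmetric] rng_def[of G b, symmetric])
  note 2 = composable_assoc(1)[OF this]
  have "a \<cdot> \<sigma> a = a"
    using composable_assoc(3)[OF composable_inv(1) composable_inv(2), of a]
      composable_cancel(2)[OF composable_inv(1), of a] by (simp add: src_def)
  then show "(a, b) \<in> composable G" using 2 by simp
qed

lemma range_inv [simp]: "\<rho> (\<iota> a) = \<sigma> a" and source_inv [simp]: "\<sigma> (\<iota> a) = \<rho> a"
  by (simp_all add: src_def rng_def)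

lemma cancel_left [simp]: "\<sigma> a = \<rho> b \<Longrightarrow> \<iota> a \<cdot> (a \<cdot> b) = b"
  and cancel_right [simp]: "\<sigma> a = \<rho> b \<Longrightarrow> a \<cdot> b \<cdot> \<iota> b = a"
  using composable_cancel composable_iff by auto

lemma cancel_left' [simp]: "\<rho> a = \<rho> b \<Longrightarrow> a \<cdot> (\<iota> a \<cdot> b) = b"
  using cancel_left[of "\<iota> a" b] by simp

lemma cancel_right' [simp]: "\<sigma> a = \<sigma> b \<Longrightarrow> a \<cdot> \<iota> b \<cdot> b = a"
  using cancel_right[of a "\<iota> b"] by simp

lemma mult_assoc: "\<sigma> a = \<rho> b \<Longrightarrow> \<sigma> b = \<rho> c \<Longrightarrow> a \<cdot> b \<cdot> c = a \<cdot> (b \<cdot> c)"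
  using composable_assoc composable_iff by auto

lemma source_mult [simp]: "\<sigma> a = \<rho> b \<Longrightarrow> \<sigma> (a \<cdot> b) = \<sigma> b"
  using composable_assoc(1)[OF _ composable_inv(1), of a b] by (simp add: composable_iff)

lemma range_mult [simp]: "\<sigma> a = \<rho> b \<Longrightarrow> \<rho> (a \<cdot> b) = \<rho> a"
  using composable_assoc(2)[OF composable_inv(2), of a b] by (simp add: composable_iff)

lemma range_range [simp]: "\<rho> (\<rho> a) = \<rho> a"
  and source_range [simp]: "\<sigma> (\<rho> a) = \<rho> a"
  and range_source [simp]: "\<rho> (\<sigma> a) = \<sigma> a"
  and source_source [simp]: "\<sigma> (\<sigma> a) = \<sigma> a"
  using range_mult[of a "\<iota> a"] source_mult[of a "\<iota> a"] range_mult[of "\<iota> a" a] source_mult[of "\<iota> a" a]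
  by (simp_all add: mult_inv_left mult_inv_right)

lemma mult_source [simp]: "a \<cdot> \<sigma> a = a"
  using cancel_left'[of a a] by (simp add: mult_inv_left)

lemma range_mult_self [simp]: "\<rho> a \<cdot> a = a"
  using cancel_right'[of a a] by (simp add: mult_inv_right)

lemma inv_mult: "\<sigma> a = \<rho> b \<Longrightarrow> \<iota> (a \<cdot> b) = \<iota> b \<cdot> \<iota> a"
proof -
  assume ab: "\<sigma> a = \<rho> b"
  have "a \<cdot> b \<cdot> (\<iota> b \<cdot> \<iota> a) = \<rho> a"
    using ab by (simp add: mult_assoc[symmetric] mult_inv_right)
  then have "\<iota> (a \<cdot> b) \<cdot> \<rho> a = \<iota> b \<cdot> \<iota> a"
    using cancel_left[of "a \<cdot> b" "\<iota> b \<cdot> \<iota> a"] ab by simp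
  then show ?thesis
    using mult_source[of "\<iota> (a \<cdot> b)"] ab by simp
qed

lemma units_iff: "x \<in> units G \<longleftrightarrow> \<rho> x = x"
  unfolding units_def by (metis range_source source_range rangeE rangeI)

lemma units_iff_source: "x \<in> units G \<longleftrightarrow> \<sigma> x = x"
  unfolding units_iff by (metis range_source source_range)

lemma range_in_units [simp]: "\<rho> a \<in> units G" and source_in_units [simp]: "\<sigma> a \<in> units G"
  by (simp_all add: units_iff)

lemma inv_unit [simp]: "x \<in> units G \<Longrightarrow> \<iota> x = x"
  by (metis mult_source units_iff units_iff_source range_inv source_inv mult_inv_left range_mult_self)

text \<open>It singles out the one arrow that contributes when a function is convolved with the
  basis vector at \<open>d\<close>.\<close>

lemma quotient_eq_iff: "\<rho> a = \<rho> c \<Longrightarrow> \<iota> a \<cdot> c = d \<longleftrightarrow> \<sigma> d = \<sigma> c \<and> a = c \<cdot> \<iota> d"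
  by (metis cancel_left cancel_right cancel_right' inv_inv range_inv source_inv source_mult inv_mult range_mult)

lemma rng_set_mult_UNIV: "\<rho> ` set_mult G UNIV F = {\<rho> a | a. \<sigma> a \<in> F}" if "F \<subseteq> units G"
proof -
  have "set_mult G UNIV F = {a. \<sigma> a \<in> F}"
    using that unfolding set_mult_def composable_iff
    by (auto simp: units_iff subset_iff) (metis mult_source range_source)+
  then show ?thesis by auto
qed

end

section \<open>Continuous functions with compact support\<close>

lemma CcI:
  assumes "continuous_on UNIV f" "compact K" "\<And>x. x \<notin> K \<Longrightarrow> f x = 0"
  shows "f \<in> (Cc :: ('a::t2_space \<Rightarrow> complex) set)"
proof -
  have "closure {a. f a \<noteq> 0} \<subseteq> K"
    using assms by (intro closure_minimal compact_imp_closed) auto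
  then have "compact (closure {a. f a \<noteq> 0})"
    using compact_Int_closed[OF assms(2), of "closure {a. f a \<noteq> 0}"] by (simp add: Int_absorb1)
  then show ?thesis using assms by (simp add: Cc_def)
qed

lemma CcE:
  assumes "f \<in> Cc"
  obtains K where "compact K" "\<And>x. x \<notin> K \<Longrightarrow> f x = 0"
proof
  show "compact (closure {a. f a \<noteq> 0})"
    using assms by (simp_all add: Cc_def)
  show "f x = 0" if "x \<notin> closure {a. f a \<noteq> 0}" for x
    using that closure_subset[of "{a. f a \<noteq> 0}"] by auto
qed

lemma Cc_continuous: "f \<in> Cc \<Longrightarrow> continuous_on S f"
  by (auto simp: Cc_def intro: continuous_on_subset)

lemma Cc_add:
  fixes f g :: "'a::t2_space \<Rightarrow> complex"
  assumes "f \<in> Cc" "g \<in> Cc"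
  shows "(\<lambda>x. f x + g x) \<in> Cc"
proof -
  obtain K where "compact K" "\<And>x. x \<notin> K \<Longrightarrow> f x = 0"
    by (rule CcE[OF assms(1)]) (blast intro: that)
  moreover obtain L where "compact L" "\<And>x. x \<notin> L \<Longrightarrow> g x = 0"
    by (rule CcE[OF assms(2)]) (blast intro: that)
  ultimately show ?thesis
    by (intro CcI[where K = "K \<union> L" and f = "\<lambda>x. f x + g x"] continuous_on_add compact_Un
        assms[THEN Cc_continuous]) simp_all
qed

lemma Cc_sum:
  fixes f :: "'i \<Rightarrow> 'a::t2_space \<Rightarrow> complex"
  assumes "\<And>i. i \<in> I \<Longrightarrow> f i \<in> Cc"
  shows "(\<lambda>x. \<Sum>i\<in>I. f i x) \<in> Cc"
  using assms
  by (induction I rule: infinite_finite_induct) (simp_all add: CcI[where K = "{}"] Cc_add)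

lemma Cc_mult_left:
  fixes f :: "'a::t2_space \<Rightarrow> complex"
  assumes "f \<in> Cc" "continuous_on UNIV g"
  shows "(\<lambda>x. g x * f x) \<in> Cc"
proof -
  obtain K where "compact K" "\<And>x. x \<notin> K \<Longrightarrow> f x = 0"
    by (rule CcE[OF assms(1)]) (blast intro: that)
  then show ?thesis
    by (intro CcI[where K = K] continuous_on_mult assms(2) Cc_continuous[OF assms(1)]) simp_all
qed

section \<open>Topology of locally compact Hausdorff etale groupoids\<close>

locale lc_groupoid =
  fixes G :: "'g::t2_space groupoid"
  assumes lc_etale: "lc_hausdorff_etale_groupoid G"
begin

sublocale discrete_groupoid G
  using lc_etale unfolding lc_hausdorff_etale_groupoid_def etale_groupoid_def topological_groupoid_def
  by unfold_locales blast

lemma locally_compact: "locally_compact_space (euclidean :: 'g topology)"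
  using lc_etale unfolding lc_hausdorff_etale_groupoid_def by blast

lemma topological: "topological_groupoid G"
  using lc_etale unfolding lc_hausdorff_etale_groupoid_def etale_groupoid_def by blast

lemma continuous_inv [continuous_intros]:
  "continuous_on S f \<Longrightarrow> continuous_on S (\<lambda>x. \<iota> (f x))"
  using topological unfolding topological_groupoid_def
  by (metis continuous_on_compose2 subset_UNIV)

lemma continuous_mult [continuous_intros]:
  assumes "continuous_on S f" "continuous_on S h" "\<And>x. x \<in> S \<Longrightarrow> \<sigma> (f x) = \<rho> (h x)"
  shows "continuous_on S (\<lambda>x. f x \<cdot> h x)"
proof -
  have "continuous_on (composable G) (\<lambda>(a, b). a \<cdot> b)"
    using topological unfolding topological_groupoid_def by blast
  then have "continuous_on S (\<lambda>x. (\<lambda>(a, b). a \<cdot> b) (f x, h x))"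
    by (rule continuous_on_compose2) (use assms in \<open>auto intro!: continuous_intros simp: composable_iff\<close>)
  then show ?thesis by simp
qed

lemma continuous_range [continuous_intros]:
  "continuous_on S f \<Longrightarrow> continuous_on S (\<lambda>x. \<rho> (f x))"
  unfolding rng_def by (intro continuous_intros) auto

lemma continuous_source [continuous_intros]:
  "continuous_on S f \<Longrightarrow> continuous_on S (\<lambda>x. \<sigma> (f x))"
  unfolding src_def by (intro continuous_intros) auto

lemma closed_units: "closed (units G)"
proof -
  have "units G = {x. \<rho> x = x}" by (auto simp: units_iff)
  then show ?thesis by (simp add: closed_Collect_eq continuous_range continuous_on_id)
qed

lemma range_neighbourhood: "\<exists>U. open U \<and> a \<in> U \<and> homeo_onto_open G \<rho> U"
  using lc_etale unfolding lc_hausdorff_etale_groupoid_def etale_groupoid_def by blast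

lemma homeo_onto_open_inj: "homeo_onto_open G f U \<Longrightarrow> inj_on f U"
  unfolding homeo_onto_open_def homeomorphism_def by (metis inj_on_inverseI)

text \<open>Near a unit both \<open>y\<close> and \<open>\<rho> y\<close> lie in a set on which the
  range map is injective. They have the same range, hence coincide, so every such \<open>y\<close>
  is a unit.\<close>

lemma open_units: "open (units G)"
proof (subst open_subopen, intro ballI)
  fix x assume x: "x \<in> units G"
  obtain U where U: "open U" "x \<in> U" "inj_on \<rho> U"
    using range_neighbourhood[of x] homeo_onto_open_inj by blast
  have "\<rho> y = y" if "y \<in> U" "\<rho> y \<in> U" for y
    using inj_onD[OF U(3), of "\<rho> y" y] that by simp
  then have "U \<inter> \<rho> -` U \<subseteq> units G"
    by (auto simp: units_iff)
  moreover have "open (U \<inter> \<rho> -` U)"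
    using U by (intro open_Int open_vimage continuous_intros)
  ultimately show "\<exists>T. open T \<and> x \<in> T \<and> T \<subseteq> units G"
    using U x by (intro exI[of _ "U \<inter> \<rho> -` U"]) (auto simp: units_iff)
qed

lemma open_in_units_iff: "open_in_units G U \<longleftrightarrow> open U \<and> U \<subseteq> units G"
  by (auto simp: open_in_units_def openin_open_eq open_units)

lemma open_range_image:
  assumes "open V"
  shows "open (\<rho> ` V)"
proof (subst open_subopen, intro ballI)
  fix x assume "x \<in> \<rho> ` V"
  then obtain a where a: "a \<in> V" "x = \<rho> a" by blast
  obtain U where U: "open U" "a \<in> U" "homeo_onto_open G \<rho> U"
    using range_neighbourhood[of a] by blast
  then obtain g where g: "homeomorphism U (\<rho> ` U) \<rho> g" and op: "open (\<rho> ` U)"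
    by (auto simp: homeo_onto_open_def open_in_units_iff)
  have "openin (top_of_set (\<rho> ` U)) (\<rho> ` (U \<inter> V))"
    using homeomorphism_imp_open_map[OF g, of "U \<inter> V"] \<open>open V\<close> by (simp add: openin_open_Int)
  then have "open (\<rho> ` (U \<inter> V))"
    using op by (simp add: openin_open_eq)
  then show "\<exists>T. open T \<and> x \<in> T \<and> T \<subseteq> \<rho> ` V"
    using a U by blast
qed

lemma open_source_image:
  assumes "open V"
  shows "open (\<sigma> ` V)"
proof -
  have "\<sigma> ` V = \<rho> ` (\<iota> -` V)"
  proof (intro equalityI image_subsetI)
    show "\<sigma> a \<in> \<rho> ` (\<iota> -` V)" if "a \<in> V" for a
      using that by (intro image_eqI[of _ _ "\<iota> a"]) simp_all
    show "\<rho> a \<in> \<sigma> ` V" if "a \<in> \<iota> -` V" for a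
      using that by (intro image_eqI[of _ _ "\<iota> a"]) simp_all
  qed
  moreover have "open (\<iota> -` V)"
    using assms by (intro open_vimage continuous_intros)
  ultimately show ?thesis by (simp add: open_range_image)
qed

text \<open>Finitely many sets on which the range map is injective cover \<open>K\<close>, and each
  meets the fibre at most once. This makes all sums defining convolutions finite.\<close>

lemma finite_range_fibre:
  assumes "compact K"
  shows "finite {a \<in> K. \<rho> a = x}"
proof -
  have "\<exists>U. open U \<and> a \<in> U \<and> inj_on \<rho> U" for a
    using range_neighbourhood[of a] homeo_onto_open_inj by blast
  then obtain U where U: "\<And>a. open (U a) \<and> a \<in> U a \<and> inj_on \<rho> (U a)"
    by metis
  then have "K \<subseteq> (\<Union>a\<in>K. U a)" by blast
  then obtain D where D: "finite D" "K \<subseteq> (\<Union>a\<in>D. U a)"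
    using compactE_image[OF assms, of K U] U by metis
  have "finite {a \<in> U d. \<rho> a = x}" for d
  proof (rule finite_imageD)
    show "finite (\<rho> ` {a \<in> U d. \<rho> a = x})"
      by (rule finite_subset[of _ "{x}"]) auto
    show "inj_on \<rho> {a \<in> U d. \<rho> a = x}"
      using U[of d] by (auto intro: inj_on_subset)
  qed
  then have "finite (\<Union>d\<in>D. {a \<in> U d. \<rho> a = x})"
    using D by blast
  then show ?thesis
    by (rule finite_subset[rotated]) (use D in blast)
qed

lemma finite_fibre_support:
  assumes "f \<in> Cc"
  shows "finite {a. \<rho> a = x \<and> f a \<noteq> 0}"
proof -
  obtain K where K: "compact K" "\<And>x. x \<notin> K \<Longrightarrow> f x = 0"
    by (rule CcE[OF assms(1)]) (blast intro: that)
  show ?thesis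
    by (rule finite_subset[OF _ finite_range_fibre[OF K(1), of x]]) (use K in blast)
qed

lemma fibre_sum_eq:
  assumes "f \<in> Cc"
  shows "(\<Sum>\<^sub>\<infinity>a\<in>{a. \<rho> a = x}. f a * u a) = (\<Sum>a\<in>{a. \<rho> a = x \<and> f a \<noteq> 0}. f a * u a)"
proof -
  have "(\<Sum>\<^sub>\<infinity>a\<in>{a. \<rho> a = x}. f a * u a) = (\<Sum>\<^sub>\<infinity>a\<in>{a. \<rho> a = x \<and> f a \<noteq> 0}. f a * u a)"
    by (intro infsum_cong_neutral) auto
  then show ?thesis by (simp add: finite_fibre_support[OF assms])
qed

lemma compact_set_mult:
  assumes "compact K" "compact L"
  shows "compact (set_mult G K L)"
proof -
  have "closed {p :: 'g \<times> 'g. \<sigma> (fst p) = \<rho> (snd p)}"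
    by (intro closed_Collect_eq continuous_intros)
  then have "compact ((K \<times> L) \<inter> {p. \<sigma> (fst p) = \<rho> (snd p)})"
    using assms by (intro compact_Int_closed compact_Times)
  then have "compact ((\<lambda>p. fst p \<cdot> snd p) ` ((K \<times> L) \<inter> {p. \<sigma> (fst p) = \<rho> (snd p)}))"
    by (rule compact_continuous_image[rotated]) (auto intro!: continuous_intros)
  also have "(\<lambda>p. fst p \<cdot> snd p) ` ((K \<times> L) \<inter> {p. \<sigma> (fst p) = \<rho> (snd p)}) = set_mult G K L"
    by (force simp: set_mult_def composable_iff)
  finally show ?thesis .
qed

section \<open>Convolution of compactly supported functions\<close>

definition convolution :: "('g \<Rightarrow> complex) \<Rightarrow> ('g \<Rightarrow> complex) \<Rightarrow> 'g \<Rightarrow> complex" where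
  "convolution f h c = (\<Sum>\<^sub>\<infinity>a\<in>{a. \<rho> a = \<rho> c}. f a * h (\<iota> a \<cdot> c))"

lemma convolution_nonzero:
  assumes "convolution f h c \<noteq> 0"
  obtains a b where "f a \<noteq> 0" "h b \<noteq> 0" "\<sigma> a = \<rho> b" "c = a \<cdot> b"
proof -
  have "\<exists>a. \<rho> a = \<rho> c \<and> f a * h (\<iota> a \<cdot> c) \<noteq> 0"
  proof (rule ccontr)
    assume "\<not> ?thesis"
    then have "convolution f h c = 0"
      unfolding convolution_def by (intro infsum_0) auto
    then show False using assms by simp
  qed
  then show ?thesis
    by (metis cancel_left' mult_zero_left mult_zero_right range_mult source_inv range_inv that)
qed

text \<open>When the range map is injective on \<open>U\<close>, the sum has at most one nonzero
  term, at the arrow of \<open>U\<close> with the range of \<open>c\<close>, and this arrow depends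
  continuously on \<open>c\<close>. Where the range of \<open>c\<close> misses that of the support,
  the convolution is zero; the two regions are open and cover the groupoid.\<close>

lemma convolution_slice_continuous:
  assumes f: "continuous_on UNIV f" and h: "continuous_on UNIV h"
    and C: "compact C" "C \<subseteq> U" "\<And>x. x \<notin> C \<Longrightarrow> f x = 0"
    and U: "open U" "homeo_onto_open G \<rho> U"
  shows "continuous_on UNIV (convolution f h)"
proof -
  obtain g where g: "homeomorphism U (\<rho> ` U) \<rho> g" and op: "open (\<rho> ` U)"
    using U by (auto simp: homeo_onto_open_def open_in_units_iff)
  have gr: "g (\<rho> a) = a" if "a \<in> U" for a
    using g that by (simp add: homeomorphism_def)
  have rg: "\<rho> (g x) = x" "g x \<in> U" if "x \<in> \<rho> ` U" for x
    using gr that by auto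
  have cg: "continuous_on (\<rho> ` U) g"
    using g by (simp add: homeomorphism_def)
  define N where "N = \<rho> -` \<rho> ` U"
  define M where "M = \<rho> -` (- \<rho> ` C)"
  have openN: "open N" unfolding N_def by (intro open_vimage op continuous_intros)
  have "closed (\<rho> ` C)"
    by (intro compact_imp_closed compact_continuous_image C continuous_intros)
  then have openM: "open M" unfolding M_def by (intro open_vimage continuous_intros) auto
  have cN: "continuous_on N (\<lambda>c. f (g (\<rho> c)) * h (\<iota> (g (\<rho> c)) \<cdot> c))"
    by (intro continuous_intros continuous_on_compose2[OF cg] continuous_on_compose2[OF f]
        continuous_on_compose2[OF h]) (auto simp: N_def gr)
  have "convolution f h c = f (g (\<rho> c)) * h (\<iota> (g (\<rho> c)) \<cdot> c)" if "c \<in> N" for c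
  proof -
    have "convolution f h c = (\<Sum>\<^sub>\<infinity>a\<in>{g (\<rho> c)}. f a * h (\<iota> a \<cdot> c))"
      unfolding convolution_def
    proof (intro infsum_cong_neutral)
      fix a assume "a \<in> {a. \<rho> a = \<rho> c} - {g (\<rho> c)}"
      then have "a \<notin> C" using C(2) gr[of a] by auto
      then show "f a * h (\<iota> a \<cdot> c) = 0" by (simp add: C(3))
    qed (use that rg in \<open>auto simp: N_def\<close>)
    then show ?thesis by simp
  qed
  then have 1: "continuous_on N (convolution f h)"
    using cN by (simp cong: continuous_on_cong)
  have "convolution f h c = 0" if "c \<in> M" for c
    unfolding convolution_def using that C(3) unfolding M_def
    by (intro infsum_0) (metis (mono_tags, lifting) ComplD imageI mem_Collect_eq mult_zero_left vimageE)
  then have 2: "continuous_on M (convolution f h)"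
    by (simp cong: continuous_on_cong)
  have "N \<union> M = UNIV"
    using image_mono[OF C(2), of \<rho>] unfolding N_def M_def by blast
  then show ?thesis
    using continuous_on_open_Un[OF openN openM 1 2] by simp
qed

lemma convolution_support:
  assumes "\<And>x. x \<notin> K \<Longrightarrow> f x = 0" "\<And>x. x \<notin> L \<Longrightarrow> h x = 0" "c \<notin> set_mult G K L"
  shows "convolution f h c = 0"
proof (rule ccontr)
  assume "convolution f h c \<noteq> 0"
  then obtain a b where "f a \<noteq> 0" "h b \<noteq> 0" "\<sigma> a = \<rho> b" "c = a \<cdot> b"
    by (rule convolution_nonzero)
  then show False
    using assms unfolding set_mult_def composable_iff by blast
qed

text \<open>A partition of unity cuts \<open>f\<close> into slices supported in sets on which the
  range map is injective, and convolution is additive in its first argument.\<close>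

lemma convolution_Cc:
  assumes f: "f \<in> Cc" and h: "h \<in> Cc"
  shows "convolution f h \<in> Cc"
proof -
  obtain K where K: "compact K" "\<And>x. x \<notin> K \<Longrightarrow> f x = 0"
    by (rule CcE[OF f]) (blast intro: that)
  obtain L where L: "compact L" "\<And>x. x \<notin> L \<Longrightarrow> h x = 0"
    by (rule CcE[OF h]) (blast intro: that)
  obtain U where U: "\<And>a. open (U a) \<and> a \<in> U a \<and> homeo_onto_open G \<rho> (U a)"
    using range_neighbourhood by metis
  then have "K \<subseteq> (\<Union>a\<in>K. U a)" by blast
  then obtain D where D: "finite D" "K \<subseteq> (\<Union>a\<in>D. U a)"
    using U K(1) by (elim compactE_image[of K K U]) blast+
  \<comment> \<open>The finite subcover is enumerated because the partition of unity is indexed by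
    an initial segment of the naturals.\<close>
  obtain e where e: "bij_betw e {..<card D} D"
    using ex_bij_betw_nat_finite[OF D(1)] by (auto simp: atLeast0LessThan)
  define n where "n = card D"
  have "D = e ` {..<n}"
    using bij_betw_imp_surj_on[OF e] by (simp add: n_def)
  then have cover: "K \<subseteq> (\<Union>i<n. U (e i))"
    using D(2) by simp
  obtain k :: "nat \<Rightarrow> 'g \<Rightarrow> real" and C where k: "\<And>i. i < n \<Longrightarrow> continuous_on UNIV (k i)"
    "\<And>x. x \<in> K \<Longrightarrow> (\<Sum>i<n. k i x) = 1"
    "\<And>i. i < n \<Longrightarrow> compact (C i)" "\<And>i. i < n \<Longrightarrow> C i \<subseteq> U (e i)" "\<And>i x. i < n \<Longrightarrow> x \<notin> C i \<Longrightarrow> k i x = 0"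
    by (rule partition_of_unity[OF locally_compact K(1) cover]) (use U that in blast)+
  define fk where "fk i x = of_real (k i x) * f x" for i x
  have fk_sum: "f x = (\<Sum>i<n. fk i x)" for x
    unfolding fk_def sum_distrib_right[symmetric] of_real_sum[symmetric]
    using k(2)[of x] K(2)[of x] by (cases "x \<in> K") auto
  have fk_Cc: "fk i \<in> Cc" if "i < n" for i
    unfolding fk_def using that k(1) by (intro Cc_mult_left f continuous_intros) auto
  have "convolution f h c = (\<Sum>i<n. convolution (fk i) h c)" for c
  proof -
    let ?S = "{a. \<rho> a = \<rho> c \<and> f a \<noteq> 0}"
    have fin: "(\<Sum>\<^sub>\<infinity>a\<in>{a. \<rho> a = \<rho> c}. u a * f a * h (\<iota> a \<cdot> c)) = (\<Sum>a\<in>?S. u a * f a * h (\<iota> a \<cdot> c))"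
      for u :: "'g \<Rightarrow> complex"
    proof -
      have "(\<Sum>\<^sub>\<infinity>a\<in>{a. \<rho> a = \<rho> c}. u a * f a * h (\<iota> a \<cdot> c)) = (\<Sum>\<^sub>\<infinity>a\<in>?S. u a * f a * h (\<iota> a \<cdot> c))"
        by (intro infsum_cong_neutral) auto
      then show ?thesis by (simp add: finite_fibre_support[OF f])
    qed
    have "convolution f h c = (\<Sum>a\<in>?S. f a * h (\<iota> a \<cdot> c))"
      using fin[of "\<lambda>_. 1"] by (simp add: convolution_def)
    also have "\<dots> = (\<Sum>a\<in>?S. \<Sum>i<n. fk i a * h (\<iota> a \<cdot> c))"
      by (intro sum.cong) (simp_all add: sum_distrib_right[symmetric] fk_sum[symmetric])
    also have "\<dots> = (\<Sum>i<n. convolution (fk i) h c)"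
      by (subst sum.swap) (simp add: convolution_def fk_def fin)
    finally show ?thesis .
  qed
  moreover have "continuous_on UNIV (convolution (fk i) h)" if "i < n" for i
  proof (rule convolution_slice_continuous)
    show "continuous_on UNIV (fk i)" "continuous_on UNIV h"
      using Cc_continuous fk_Cc[OF that] h by blast+
    show "fk i x = 0" if "x \<notin> C i" for x
      using k(5)[OF \<open>i < n\<close> that] by (simp add: fk_def)
    show "compact (C i)" "C i \<subseteq> U (e i)" "open (U (e i))" "homeo_onto_open G \<rho> (U (e i))"
      using k(3,4)[OF that] U[of "e i"] by simp_all
  qed
  then have 3: "continuous_on UNIV (\<lambda>c. \<Sum>i<n. convolution (fk i) h c)"
    by (intro continuous_on_sum) simp
  moreover note 3
  ultimately have "continuous_on UNIV (convolution f h)"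
    by simp
  then show ?thesis
    by (rule CcI[OF _ compact_set_mult[OF K(1) L(1)]]) (rule convolution_support[OF K(2) L(2)])
qed

lemma Cc_star:
  assumes "f \<in> Cc"
  shows "(\<lambda>x. cnj (f (\<iota> x))) \<in> Cc"
proof -
  obtain K where K: "compact K" "\<And>x. x \<notin> K \<Longrightarrow> f x = 0"
    by (rule CcE[OF assms(1)]) (blast intro: that)
  show ?thesis
  proof (rule CcI)
    show "continuous_on UNIV (\<lambda>x. cnj (f (\<iota> x)))"
      by (intro continuous_intros continuous_on_compose2[OF Cc_continuous[OF assms, of UNIV]]) auto
    show "compact (\<iota> ` K)"
      by (intro compact_continuous_image K continuous_intros)
    show "cnj (f (\<iota> x)) = 0" if "x \<notin> \<iota> ` K" for x
      using that K(2)[of "\<iota> x"] by (metis complex_cnj_zero image_eqI inv_inv)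
  qed
qed

end

section \<open>The left regular representation\<close>

lemma has_sum_sum_finite:
  fixes f :: "'i \<Rightarrow> 'a \<Rightarrow> 'b::topological_comm_monoid_add"
  assumes "\<And>i. i \<in> I \<Longrightarrow> (f i has_sum s i) S"
  shows "((\<lambda>x. \<Sum>i\<in>I. f i x) has_sum (\<Sum>i\<in>I. s i)) S"
  using assms by (induction I rule: infinite_finite_induct) (simp_all add: has_sum_0 has_sum_add)

lemma multiplication_operator_exists:
  assumes "\<And>c. cmod (u c) \<le> B" "0 \<le> B"
  shows "\<exists>M :: 'i op. complex_linear M \<and> norm M \<le> B \<and> (\<forall>f c. coef (M f) c = u c * coef f c)"
  using weighted_shift_exists[of id UNIV u B] assms by simp

lemma Cc_bounded:
  fixes f :: "'a::t2_space \<Rightarrow> complex"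
  assumes "f \<in> Cc"
  obtains B where "0 \<le> B" "\<And>x. cmod (f x) \<le> B"
proof -
  obtain K where K: "compact K" "\<And>x. x \<notin> K \<Longrightarrow> f x = 0"
    by (rule CcE[OF assms]) (blast intro: that)
  have "bounded (f ` K)"
    by (intro compact_imp_bounded compact_continuous_image Cc_continuous assms K)
  then obtain B where B: "\<And>x. x \<in> K \<Longrightarrow> cmod (f x) \<le> B"
    by (auto simp: bounded_iff)
  show ?thesis
  proof (rule that[of "max B 0"])
    show "cmod (f x) \<le> max B 0" for x
      using B[of x] K(2)[of x] by (cases "x \<in> K") auto
  qed simp
qed

context lc_groupoid
begin

abbreviation rep :: "('g \<Rightarrow> complex) \<Rightarrow> 'g op \<Rightarrow> bool" where
  "rep \<equiv> regular_representation G"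

lemma rep_apply:
  assumes "f \<in> Cc" "rep f T"
  shows "coef (T \<xi>) c = (\<Sum>a\<in>{a. \<rho> a = \<rho> c \<and> f a \<noteq> 0}. f a * coef \<xi> (\<iota> a \<cdot> c))"
  using assms(2) fibre_sum_eq[OF assms(1)] unfolding regular_representation_def by simp

lemma rep_linear:
  assumes "f \<in> Cc" "rep f T"
  shows "complex_linear T"
  by (rule complex_linear_coefI)
    (simp add: rep_apply[OF assms] coef_simps sum_distrib_left mult.left_commute)

lemma rep_delta_aux:
  assumes "f \<in> Cc"
  shows "(\<Sum>a\<in>{a. \<rho> a = \<rho> c \<and> f a \<noteq> 0}. f a * coef (delta d) (\<iota> a \<cdot> c))
    = (if \<sigma> c = \<sigma> d then f (c \<cdot> \<iota> d) else 0)"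
proof -
  have "f a * coef (delta d) (\<iota> a \<cdot> c) = (if a = c \<cdot> \<iota> d then (if \<sigma> c = \<sigma> d then f (c \<cdot> \<iota> d) else 0) else 0)"
    if "\<rho> a = \<rho> c" for a
    using quotient_eq_iff[OF that, of d] by (auto simp: coef_delta)
  then have "(\<Sum>a\<in>{a. \<rho> a = \<rho> c \<and> f a \<noteq> 0}. f a * coef (delta d) (\<iota> a \<cdot> c))
      = (\<Sum>a\<in>{a. \<rho> a = \<rho> c \<and> f a \<noteq> 0}. if a = c \<cdot> \<iota> d then (if \<sigma> c = \<sigma> d then f (c \<cdot> \<iota> d) else 0) else 0)"
    by (intro sum.cong) auto
  also have "\<dots> = (if \<sigma> c = \<sigma> d then f (c \<cdot> \<iota> d) else 0)"
    using finite_fibre_support[OF assms, of "\<rho> c"] by (auto simp: sum.delta')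
  finally show ?thesis .
qed

lemma rep_delta:
  assumes "f \<in> Cc" "rep f T"
  shows "coef (T (delta d)) c = (if \<sigma> c = \<sigma> d then f (c \<cdot> \<iota> d) else 0)"
  by (simp add: rep_apply[OF assms] rep_delta_aux[OF assms(1)])

text \<open>For fixed \<open>c\<close> both sides are bounded functionals of the vector, the right
  one because its sum is finite, so it is enough to compare matrix entries.\<close>

lemma repI:
  assumes f: "f \<in> Cc" and T: "complex_linear T"
    and matrix: "\<And>d c. coef (T (delta d)) c = (if \<sigma> c = \<sigma> d then f (c \<cdot> \<iota> d) else 0)"
  shows "rep f T"
  unfolding regular_representation_def
proof (intro allI)
  fix \<xi> c
  have "coef (T \<xi>) c = (\<Sum>a\<in>{a. \<rho> a = \<rho> c \<and> f a \<noteq> 0}. f a * coef \<xi> (\<iota> a \<cdot> c))"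
  proof (rule ell2_functional_unique)
    show "bounded_linear (\<lambda>\<xi>. coef (T \<xi>) c)"
      by (rule bounded_linear_compose[OF bounded_linear_coef blinfun.bounded_linear_right])
    show "bounded_linear (\<lambda>\<xi>. \<Sum>a\<in>{a. \<rho> a = \<rho> c \<and> f a \<noteq> 0}. f a * coef \<xi> (\<iota> a \<cdot> c))"
      by (intro bounded_linear_sum bounded_linear_const_mult bounded_linear_coef)
  qed (simp_all add: complex_linearD[OF T] coef_simps matrix rep_delta_aux[OF f] sum_distrib_left mult.left_commute)
  then show "coef (T \<xi>) c = (\<Sum>\<^sub>\<infinity>a\<in>{a. \<rho> a = \<rho> c}. f a * coef \<xi> (\<iota> a \<cdot> c))"
    by (simp add: fibre_sum_eq[OF f])
qed

lemma rep_add: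
  assumes "f \<in> Cc" "rep f S" "h \<in> Cc" "rep h T"
  shows "rep (\<lambda>x. f x + h x) (S + T)"
  by (rule repI)
    (simp_all add: assms Cc_add complex_linear_add[OF rep_linear[OF assms(1,2)] rep_linear[OF assms(3,4)]] blinfun.add_left coef_simps
      rep_delta[OF assms(1,2)] rep_delta[OF assms(3,4)])

lemma rep_zero: "rep (\<lambda>_. 0) 0"
  by (rule repI) (simp_all add: CcI[where K = "{}"] complex_linear_def coef_simps ell2_eqI)

lemma rep_sum:
  assumes "\<And>i. i \<in> I \<Longrightarrow> f i \<in> Cc" "\<And>i. i \<in> I \<Longrightarrow> rep (f i) (T i)"
  shows "rep (\<lambda>x. \<Sum>i\<in>I. f i x) (\<Sum>i\<in>I. T i)"
  using assms by (induction I rule: infinite_finite_induct) (simp_all add: rep_zero rep_add Cc_sum)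

lemma rep_scale:
  assumes "f \<in> Cc" "rep f T"
  shows "rep (\<lambda>x. z * f x) (scale_op z T)"
  by (rule repI)
    (simp_all add: assms Cc_mult_left complex_linear_scale[OF rep_linear[OF assms]] scale_op_apply coef_simps
      rep_delta[OF assms])

lemma rep_adj:
  assumes "f \<in> Cc" "rep f T"
  shows "rep (\<lambda>x. cnj (f (\<iota> x))) (adj T)"
proof (rule repI)
  show "coef (adj T (delta d)) c = (if \<sigma> c = \<sigma> d then cnj (f (\<iota> (c \<cdot> \<iota> d))) else 0)" for d c
  proof -
    have "coef (adj T (delta d)) c = cnj (coef (T (delta c)) d)"
      by (simp add: cinner_delta_left[symmetric] cinner_adj[OF rep_linear[OF assms], symmetric] cinner_delta_right)
    then show ?thesis
      by (simp add: rep_delta[OF assms] inv_mult)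
  qed
qed (simp_all add: assms Cc_star complex_linear_adj[OF rep_linear[OF assms]])

lemma rep_compose:
  assumes f: "f \<in> Cc" "rep f S" and h: "h \<in> Cc" "rep h T"
  shows "rep (convolution f h) (S o\<^sub>L T)"
proof (rule repI)
  show "coef ((S o\<^sub>L T) (delta d)) c = (if \<sigma> c = \<sigma> d then convolution f h (c \<cdot> \<iota> d) else 0)" for d c
  proof (cases "\<sigma> c = \<sigma> d")
    case True
    have "coef ((S o\<^sub>L T) (delta d)) c
        = (\<Sum>a\<in>{a. \<rho> a = \<rho> c \<and> f a \<noteq> 0}. f a * h (\<iota> a \<cdot> (c \<cdot> \<iota> d)))"
      by (simp add: rep_apply[OF f] rep_delta[OF h] True mult_assoc)
    also have "\<dots> = convolution f h (c \<cdot> \<iota> d)"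
      by (simp add: convolution_def True fibre_sum_eq[OF f(1)])
    finally show ?thesis by (simp add: True)
  qed (simp add: rep_apply[OF f] rep_delta[OF h])
qed (simp_all add: convolution_Cc f(1) h(1) complex_linear_compose rep_linear[OF f] rep_linear[OF h])

text \<open>An off-diagonal matrix entry of the representation evaluates \<open>f\<close> at a
  non-unit, where it is zero.\<close>

lemma rep_multiplication:
  assumes f: "f \<in> Cc" "\<And>x. x \<notin> units G \<Longrightarrow> f x = 0"
    and M: "complex_linear M" "\<And>\<xi> c. coef (M \<xi>) c = f (\<rho> c) * coef \<xi> c"
  shows "rep f M"
proof (rule repI[OF f(1) M(1)])
  fix d c
  show "coef (M (delta d)) c = (if \<sigma> c = \<sigma> d then f (c \<cdot> \<iota> d) else 0)"
  proof (cases "\<sigma> c = \<sigma> d \<and> c \<noteq> d")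
    case True
    then have "c \<cdot> \<iota> d \<notin> units G"
      using cancel_right'[of c d] by (metis range_mult range_mult_self units_iff units_iff_source source_mult range_inv source_inv)
    then show ?thesis using True by (simp add: M(2) f(2) coef_delta)
  qed (auto simp: M(2) coef_delta mult_inv_right)
qed

text \<open>A non-unit arrow that contributed would have both its range and its source in
  \<open>Y\<close>, hence would survive in the empty product of \<open>Y\<close>, \<open>C\<close>
  and \<open>Y\<close>.\<close>

lemma rep_off_diagonal_zero:
  assumes f: "f \<in> Cc" "rep f T" and C: "\<And>a. f a \<noteq> 0 \<Longrightarrow> a \<notin> units G \<Longrightarrow> a \<in> C"
    and Y: "Y \<subseteq> units G" "set_mult G (set_mult G Y C) Y = {}"
    and \<xi>: "\<And>c. coef \<xi> c \<noteq> 0 \<Longrightarrow> \<rho> c \<in> Y" and c: "\<rho> c \<in> Y"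
  shows "coef (T \<xi>) c = f (\<rho> c) * coef \<xi> c"
proof -
  have "f a * coef \<xi> (\<iota> a \<cdot> c) = (if a = \<rho> c then f (\<rho> c) * coef \<xi> c else 0)"
    if "\<rho> a = \<rho> c" for a
  proof (cases "a \<in> units G")
    case True
    then have "a = \<rho> c" using that by (simp add: units_iff)
    then show ?thesis by simp
  next
    case False
    have "f a * coef \<xi> (\<iota> a \<cdot> c) = 0"
    proof (rule ccontr)
      assume "\<not> ?thesis"
      then have a: "a \<in> C" "\<sigma> a \<in> Y"
        using C False \<xi>[of "\<iota> a \<cdot> c"] that by auto
      have "\<rho> a \<cdot> a \<in> set_mult G Y C"
        unfolding set_mult_def composable_iff using a c that by force
      then have "\<rho> a \<cdot> a \<cdot> \<sigma> a \<in> set_mult G (set_mult G Y C) Y"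
        unfolding set_mult_def[of G "set_mult G Y C"] composable_iff using a by force
      then show False using Y by simp
    qed
    then show ?thesis using False by auto
  qed
  then have "(\<Sum>a\<in>{a. \<rho> a = \<rho> c \<and> f a \<noteq> 0}. f a * coef \<xi> (\<iota> a \<cdot> c))
      = (\<Sum>a\<in>{a. \<rho> a = \<rho> c \<and> f a \<noteq> 0}. if a = \<rho> c then f (\<rho> c) * coef \<xi> c else 0)"
    by (intro sum.cong) auto
  also have "\<dots> = f (\<rho> c) * coef \<xi> c"
    using finite_fibre_support[OF f(1), of "\<rho> c"] by (auto simp: sum.delta')
  finally show ?thesis by (simp add: rep_apply[OF f])
qed

section \<open>Transport of functions along bisections\<close>

text \<open>This realises \<open>k\<close> as the compression of \<open>e\<close> by one bisection,
  that is \<open>adj V\<close> times \<open>e\<close> times \<open>V\<close> equals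
  \<open>M\<close>. The identity is stated as a sum for the sesquilinear form because
  \<open>e\<close> is only assumed continuous, so no multiplication operator for it need
  exist.\<close>

lemma bisection_transport:
  fixes k e :: "'g \<Rightarrow> real"
  assumes A: "open_bisection G A"
    and k: "continuous_on UNIV k" "\<And>x. 0 \<le> k x" "\<And>x. x \<notin> C \<Longrightarrow> k x = 0" "compact C" "C \<subseteq> \<sigma> ` A"
    and e: "continuous_on UNIV e" "\<And>x. x \<in> \<rho> ` A \<Longrightarrow> 0 < e x"
    and M: "\<And>\<xi> c. coef (M \<xi>) c = of_real (k (\<rho> c)) * coef \<xi> c"
  shows "\<exists>v V. v \<in> Cc \<and> rep v V \<and> (\<forall>\<xi> c. coef (V \<xi>) c \<noteq> 0 \<longrightarrow> \<rho> c \<in> \<rho> ` A)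
    \<and> (\<forall>\<xi> \<zeta>. ((\<lambda>c. of_real (e (\<rho> c)) * (cnj (coef (V \<xi>) c) * coef (V \<zeta>) c))
        has_sum cinner \<xi> (M \<zeta>)) UNIV)"
proof -
  have "open A" using A by (simp add: open_bisection_def)
  obtain gs where gs: "homeomorphism A (\<sigma> ` A) \<sigma> gs"
    using A by (auto simp: open_bisection_def homeo_onto_open_def)
  have inj: "inj_on \<rho> A" "inj_on \<sigma> A"
    using A homeo_onto_open_inj by (auto simp: open_bisection_def)
  \<comment> \<open>The square root is chosen so that its square, weighted by \<open>e\<close> at
    the range, gives back \<open>k\<close> at the source.\<close>
  define v0 where "v0 a = (if a \<in> A then sqrt (k (\<sigma> a) / e (\<rho> a)) else 0)" for a
  define v where "v a = complex_of_real (v0 a)" for a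
  define L where "L = gs ` C"
  have "continuous_on C gs"
    using homeomorphism_cont2[OF gs] k(5) by (rule continuous_on_subset)
  then have L: "compact L"
    unfolding L_def using k(4) by (rule compact_continuous_image)
  have v0L: "v0 a = 0" if "a \<notin> L" for a
  proof (cases "a \<in> A")
    case True
    then have "gs (\<sigma> a) = a" using gs by (simp add: homeomorphism_def)
    then have "\<sigma> a \<notin> C" using that unfolding L_def by force
    then show ?thesis using k(3) by (simp add: v0_def)
  qed (simp add: v0_def)
  have "L \<subseteq> A"
    unfolding L_def using gs k(5) by (auto simp: homeomorphism_def)
  have "continuous_on A (\<lambda>a. sqrt (k (\<sigma> a) / e (\<rho> a)))"
    by (intro continuous_intros continuous_on_compose2[OF k(1)] continuous_on_compose2[OF e(1)])
      (use e(2) in \<open>force+\<close>)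
  then have 1: "continuous_on A v0"
    by (simp add: v0_def cong: continuous_on_cong)
  have 2: "continuous_on (- L) v0"
    by (rule continuous_on_eq[of _ "\<lambda>_. 0"]) (simp_all add: v0L)
  have "continuous_on (A \<union> - L) v0"
    by (rule continuous_on_open_Un[OF \<open>open A\<close> _ 1 2]) (simp add: L compact_imp_closed open_Compl)
  \<comment> \<open>Extension by zero stays continuous since the compact support \<open>L\<close>
    lies inside the open set \<open>A\<close>.\<close>
  moreover have "A \<union> - L = UNIV" using \<open>L \<subseteq> A\<close> by blast
  ultimately have "continuous_on UNIV v0" by simp
  then have vCc: "v \<in> Cc"
    unfolding v_def by (intro CcI[OF _ L] continuous_intros) (simp_all add: v0L)
  obtain B where B: "0 \<le> B" "\<And>x. cmod (v x) \<le> B"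
    by (rule Cc_bounded[OF vCc]) (use that in blast)
  define \<tau> where "\<tau> = inv_into A \<rho>"
  have \<tau>: "\<tau> x \<in> A" "\<rho> (\<tau> x) = x" if "x \<in> \<rho> ` A" for x
    using that unfolding \<tau>_def by (simp_all add: inv_into_into f_inv_into_f)
  have \<tau>': "\<tau> (\<rho> a) = a" if "a \<in> A" for a
    using that inj unfolding \<tau>_def by simp
  define S where "S = {c. \<rho> c \<in> \<rho> ` A}"
  \<comment> \<open>The unique arrow of \<open>A\<close> with the range of \<open>c\<close> is
    divided out from the left, so the operator becomes a weighted shift along this map; injectivity
    of the source map on \<open>A\<close> makes the shift injective.\<close>
  define \<theta> where "\<theta> c = \<iota> (\<tau> (\<rho> c)) \<cdot> c" for c
  have \<theta>: "\<rho> (\<theta> c) = \<sigma> (\<tau> (\<rho> c))" "\<tau> (\<rho> c) \<cdot> \<theta> c = c" if "c \<in> S" for c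
    using that \<tau> by (simp_all add: S_def \<theta>_def)
  have inj_\<theta>: "inj_on \<theta> S"
  proof (rule inj_onI)
    fix c d assume cd: "c \<in> S" "d \<in> S" "\<theta> c = \<theta> d"
    then have "\<sigma> (\<tau> (\<rho> c)) = \<sigma> (\<tau> (\<rho> d))"
      using \<theta>(1)[of c] \<theta>(1)[of d] by simp
    then have "\<tau> (\<rho> c) = \<tau> (\<rho> d)"
      by (rule inj_onD[OF inj(2)]) (use cd \<tau>(1) in \<open>simp_all add: S_def\<close>)
    then show "c = d" using \<theta>(2)[OF cd(1)] \<theta>(2)[OF cd(2)] cd(3) by metis
  qed
  obtain V where V: "complex_linear V"
      "\<And>\<xi> c. coef (V \<xi>) c = (if c \<in> S then v (\<tau> (\<rho> c)) * coef \<xi> (\<theta> c) else 0)"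
    using weighted_shift_exists[OF inj_\<theta>, of "\<lambda>c. v (\<tau> (\<rho> c))" B, OF B(2) B(1)] by metis
  have "rep v V"
    unfolding regular_representation_def
  proof (intro allI)
    fix \<xi> c
    have "(\<Sum>\<^sub>\<infinity>a\<in>{a. \<rho> a = \<rho> c}. v a * coef \<xi> (\<iota> a \<cdot> c))
        = (\<Sum>\<^sub>\<infinity>a\<in>{a. a = \<tau> (\<rho> c) \<and> c \<in> S}. v a * coef \<xi> (\<iota> a \<cdot> c))"
    proof (rule infsum_cong_neutral)
      fix a assume a: "a \<in> {a. \<rho> a = \<rho> c} - {a. a = \<tau> (\<rho> c) \<and> c \<in> S}"
      have "a \<notin> A"
      proof
        assume "a \<in> A"
        then have "\<rho> a \<in> \<rho> ` A" "\<tau> (\<rho> a) = a" by (simp_all only: imageI \<tau>')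
        then show False using a by (simp add: S_def)
      qed
      then show "v a * coef \<xi> (\<iota> a \<cdot> c) = 0" by (simp add: v_def v0_def)
    qed (auto simp: S_def \<tau>)
    then show "coef (V \<xi>) c = (\<Sum>\<^sub>\<infinity>a\<in>{a. \<rho> a = \<rho> c}. v a * coef \<xi> (\<iota> a \<cdot> c))"
      by (cases "c \<in> S") (simp_all add: V(2) \<theta>_def)
  qed
  moreover have "((\<lambda>c. of_real (e (\<rho> c)) * (cnj (coef (V \<xi>) c) * coef (V \<zeta>) c)) has_sum cinner \<xi> (M \<zeta>)) UNIV"
    for \<xi> \<zeta>
  proof -
    define H where "H d = cnj (coef \<xi> d) * coef (M \<zeta>) d" for d
    have "(H has_sum cinner \<xi> (M \<zeta>)) UNIV"
      unfolding H_def by (rule has_sum_cinner)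
    \<comment> \<open>Arrows outside the image of the shift have their range outside the sources of
      \<open>A\<close>, where \<open>k\<close> is zero, so restricting the sum loses
      nothing.\<close>
    also have "?this \<longleftrightarrow> (H has_sum cinner \<xi> (M \<zeta>)) (\<theta> ` S)"
    proof (rule has_sum_cong_neutral)
      fix d assume d: "d \<in> UNIV - \<theta> ` S"
      have "\<rho> d \<notin> C"
      proof
        assume "\<rho> d \<in> C"
        then obtain a where a: "a \<in> A" "\<rho> d = \<sigma> a" using k(5) by auto
        then have "a \<cdot> d \<in> S" "\<theta> (a \<cdot> d) = d"
          by (simp_all add: S_def \<theta>_def \<tau>')
        then show False using d by force
      qed
      then show "H d = 0" by (simp add: H_def M k(3))
    qed auto
    also have "\<dots> \<longleftrightarrow> ((H \<circ> \<theta>) has_sum cinner \<xi> (M \<zeta>)) S"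
      by (rule has_sum_reindex[OF inj_\<theta>])
    also have "\<dots> \<longleftrightarrow> ((\<lambda>c. of_real (e (\<rho> c)) * (cnj (coef (V \<xi>) c) * coef (V \<zeta>) c)) has_sum cinner \<xi> (M \<zeta>)) UNIV"
    proof (rule has_sum_cong_neutral)
      fix c assume "c \<in> S \<inter> UNIV"
      then have c: "c \<in> S" by simp
      then have t: "\<tau> (\<rho> c) \<in> A" "\<rho> (\<tau> (\<rho> c)) = \<rho> c" "0 < e (\<rho> c)"
        using \<tau> e(2) by (auto simp: S_def)
      have "v0 (\<tau> (\<rho> c)) * v0 (\<tau> (\<rho> c)) = k (\<rho> (\<theta> c)) / e (\<rho> c)"
        using t k(2) by (simp add: v0_def \<theta>(1)[OF c])
      then have "e (\<rho> c) * (v0 (\<tau> (\<rho> c)) * v0 (\<tau> (\<rho> c))) = k (\<rho> (\<theta> c))"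
        using t(3) by simp
      then have "complex_of_real (e (\<rho> c)) * (v (\<tau> (\<rho> c)) * v (\<tau> (\<rho> c))) = of_real (k (\<rho> (\<theta> c)))"
        unfolding v_def of_real_mult[symmetric] by simp
      then show "(H \<circ> \<theta>) c = of_real (e (\<rho> c)) * (cnj (coef (V \<xi>) c) * coef (V \<zeta>) c)"
        by (simp add: H_def M V(2) c v_def mult_ac)
    qed (auto simp: V(2))
    finally show ?thesis .
  qed
  moreover have "\<rho> c \<in> \<rho> ` A" if "coef (V \<xi>) c \<noteq> 0" for \<xi> c
    using that by (auto simp: V(2) S_def split: if_splits)
  ultimately show ?thesis using vCc by blast
qed

text \<open>The operators for the single bisections are added. Their outputs live over disjoint sets
  of units, so all cross terms vanish and the forms add up to that of the sum \<open>h\<close> of a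
  partition of unity. The bound 1 on \<open>H\<close> is therefore independent of the number of
  bisections.\<close>

lemma compact_below_transport:
  fixes e :: "'g \<Rightarrow> real"
  assumes K: "compact K" "compact_below G K Y"
    and e: "continuous_on UNIV e" "\<And>x. x \<in> Y \<Longrightarrow> 0 < e x"
  obtains v V h and H :: "'g op" where "v \<in> Cc" "rep v V" "\<And>\<xi> c. coef (V \<xi>) c \<noteq> 0 \<Longrightarrow> \<rho> c \<in> Y"
    "\<And>x. x \<in> K \<Longrightarrow> h x = 1" "complex_linear H" "norm H \<le> 1" "\<And>\<xi> c. coef (H \<xi>) c = of_real (h (\<rho> c)) * coef \<xi> c"
    "\<And>\<xi> \<zeta>. ((\<lambda>c. of_real (e (\<rho> c)) * (cnj (coef (V \<xi>) c) * coef (V \<zeta>) c)) has_sum cinner \<xi> (H \<zeta>)) UNIV"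
proof -
  obtain n :: nat and A where A: "\<And>i. i < n \<Longrightarrow> open_bisection G (A i)" "K \<subseteq> (\<Union>i<n. \<sigma> ` A i)"
      "\<And>i. i < n \<Longrightarrow> \<rho> ` A i \<subseteq> Y" "disjoint_family_on (\<lambda>i. \<rho> ` A i) {..<n}"
    using K(2) unfolding compact_below_def by blast
  have op: "open (\<sigma> ` A i)" if "i < n" for i
    using A(1)[OF that] by (simp add: open_bisection_def open_source_image)
  obtain k :: "nat \<Rightarrow> 'g \<Rightarrow> real" and C where k: "\<And>i. i < n \<Longrightarrow> continuous_on UNIV (k i)"
    "\<And>i x. i < n \<Longrightarrow> 0 \<le> k i x" "\<And>i x. i < n \<Longrightarrow> k i x \<le> 1" "\<And>x. (\<Sum>i<n. k i x) \<le> 1"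
    "\<And>x. x \<in> K \<Longrightarrow> (\<Sum>i<n. k i x) = 1"
    "\<And>i. i < n \<Longrightarrow> compact (C i)" "\<And>i. i < n \<Longrightarrow> C i \<subseteq> \<sigma> ` A i" "\<And>i x. i < n \<Longrightarrow> x \<notin> C i \<Longrightarrow> k i x = 0"
    by (rule partition_of_unity[OF locally_compact K(1) A(2) op]) (use that in blast)+
  define h where "h x = (\<Sum>i<n. k i x)" for x
  have "0 \<le> h x" "h x \<le> 1" for x
    using k(2,4) by (auto simp: h_def intro: sum_nonneg)
  then obtain H :: "'g op" where H: "complex_linear H" "norm H \<le> 1" "\<And>\<xi> c. coef (H \<xi>) c = of_real (h (\<rho> c)) * coef \<xi> c"
    using multiplication_operator_exists[of "\<lambda>c. of_real (h (\<rho> c))" 1] by auto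
  define M where "M i = (SOME M :: 'g op. \<forall>\<xi> c. coef (M \<xi>) c = of_real (k i (\<rho> c)) * coef \<xi> c)" for i
  have M: "coef (M i \<xi>) c = of_real (k i (\<rho> c)) * coef \<xi> c" if "i < n" for i \<xi> c
  proof -
    have "\<exists>M :: 'g op. \<forall>\<xi> c. coef (M \<xi>) c = of_real (k i (\<rho> c)) * coef \<xi> c"
      using multiplication_operator_exists[of "\<lambda>c. of_real (k i (\<rho> c))" 1] k(2,3)[OF that] by auto
    from someI_ex[OF this] show ?thesis unfolding M_def by blast
  qed
  define Q where "Q i v V \<longleftrightarrow> v \<in> Cc \<and> rep v V \<and> (\<forall>\<xi> c. coef (V \<xi>) c \<noteq> 0 \<longrightarrow> \<rho> c \<in> \<rho> ` A i)
    \<and> (\<forall>\<xi> \<zeta>. ((\<lambda>c. of_real (e (\<rho> c)) * (cnj (coef (V \<xi>) c) * coef (V \<zeta>) c))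
        has_sum cinner \<xi> (M i \<zeta>)) UNIV)" for i v V
  have "\<exists>v V. Q i v V" if "i < n" for i
    unfolding Q_def
  proof (rule bisection_transport[OF A(1)[OF that]])
    show "k i x = 0" if "x \<notin> C i" for x
      using k(8) \<open>i < n\<close> that by blast
  qed (use k that e A(3)[OF that] M[OF that] in auto)
  then have "\<forall>i\<in>{..<n}. \<exists>v V. Q i v V" by simp
  then obtain v V where "\<forall>i\<in>{..<n}. Q i (v i) (V i)"
    unfolding bchoice_iff by blast
  then have Q: "Q i (v i) (V i)" if "i < n" for i using that by simp
  have V: "coef ((\<Sum>i<n. V i) \<xi>) c = (\<Sum>i<n. coef (V i \<xi>) c)" for \<xi> c
    by (simp add: blinfun.sum_left coef_sum)
  show ?thesis
  proof (rule that)
    show "(\<lambda>x. \<Sum>i<n. v i x) \<in> Cc" "rep (\<lambda>x. \<Sum>i<n. v i x) (\<Sum>i<n. V i)"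
      using Q unfolding Q_def by (auto intro: Cc_sum rep_sum)
    show "h x = 1" if "x \<in> K" for x
      using k(5)[OF that] by (simp add: h_def)
    show "\<rho> c \<in> Y" if nz: "coef ((\<Sum>i<n. V i) \<xi>) c \<noteq> 0" for \<xi> c
    proof -
      obtain i where "i < n" "coef (V i \<xi>) c \<noteq> 0"
        using sum.not_neutral_contains_not_neutral[OF nz[unfolded V]] by auto
      then show ?thesis using Q A(3) unfolding Q_def by blast
    qed
    fix \<xi> \<zeta>
    have "((\<lambda>c. \<Sum>i<n. of_real (e (\<rho> c)) * (cnj (coef (V i \<xi>) c) * coef (V i \<zeta>) c))
        has_sum (\<Sum>i<n. cinner \<xi> (M i \<zeta>))) UNIV"
      using Q unfolding Q_def by (intro has_sum_sum_finite) simp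
    moreover have "(\<Sum>i<n. of_real (e (\<rho> c)) * (cnj (coef (V i \<xi>) c) * coef (V i \<zeta>) c))
        = of_real (e (\<rho> c)) * (cnj (coef ((\<Sum>i<n. V i) \<xi>) c) * coef ((\<Sum>i<n. V i) \<zeta>) c)" for c
    proof -
      \<comment> \<open>If both factors were nonzero for distinct indices, the range of
        \<open>c\<close> would lie in two disjoint sets.\<close>
      have off: "cnj (coef (V i \<xi>) c) * coef (V j \<zeta>) c = (if j = i then cnj (coef (V i \<xi>) c) * coef (V i \<zeta>) c else 0)"
        if "i < n" "j < n" for i j
      proof (cases "coef (V i \<xi>) c = 0 \<or> coef (V j \<zeta>) c = 0 \<or> i = j")
        case False
        then have "\<rho> c \<in> \<rho> ` A i" "\<rho> c \<in> \<rho> ` A j"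
          using Q that unfolding Q_def by blast+
        then show ?thesis
          using A(4) that False unfolding disjoint_family_on_def by fastforce
      qed auto
      have "cnj (coef ((\<Sum>i<n. V i) \<xi>) c) * coef ((\<Sum>i<n. V i) \<zeta>) c
          = (\<Sum>i<n. \<Sum>j<n. cnj (coef (V i \<xi>) c) * coef (V j \<zeta>) c)"
        by (simp add: V sum_product)
      also have "\<dots> = (\<Sum>i<n. \<Sum>j<n. if j = i then cnj (coef (V i \<xi>) c) * coef (V i \<zeta>) c else 0)"
        using off by (intro sum.cong) auto
      also have "\<dots> = (\<Sum>i<n. cnj (coef (V i \<xi>) c) * coef (V i \<zeta>) c)"
        by (intro sum.cong) (auto simp: sum.delta)
      finally show ?thesis by (simp add: sum_distrib_left)
    qed
    moreover have "H \<zeta> = (\<Sum>i<n. M i \<zeta>)"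
      by (rule ell2_eqI) (simp add: H(3) coef_sum M h_def sum_distrib_right)
    then have "(\<Sum>i<n. cinner \<xi> (M i \<zeta>)) = cinner \<xi> (H \<zeta>)"
      by (simp add: linear_sum[OF bounded_linear.linear[OF bounded_linear_cinner]])
    ultimately show "((\<lambda>c. of_real (e (\<rho> c)) * (cnj (coef ((\<Sum>i<n. V i) \<xi>) c) * coef ((\<Sum>i<n. V i) \<zeta>) c))
        has_sum cinner \<xi> (H \<zeta>)) UNIV"
      by simp
  qed (fact H)+
qed

end

section \<open>The reduced C*-algebra and its ideals\<close>

text \<open>One argument with approximating sequences serves for sums, products and scalar multiples
  in the algebra and in its ideals.\<close>

lemma closure_binary:
  fixes F :: "'a::metric_space \<Rightarrow> 'b::metric_space \<Rightarrow> 'c::metric_space"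
  assumes lim: "\<And>x y. x \<longlonglongrightarrow> s \<Longrightarrow> y \<longlonglongrightarrow> t \<Longrightarrow> (\<lambda>n. F (x n) (y n)) \<longlonglongrightarrow> F s t"
    and F: "\<And>x y. x \<in> X \<Longrightarrow> y \<in> Y \<Longrightarrow> F x y \<in> Z"
    and s: "s \<in> closure X" and t: "t \<in> closure Y"
  shows "F s t \<in> closure Z"
proof -
  obtain x where x: "\<And>n. x n \<in> X" "x \<longlonglongrightarrow> s"
    using s unfolding closure_sequential by blast
  obtain y where y: "\<And>n. y n \<in> Y" "y \<longlonglongrightarrow> t"
    using t unfolding closure_sequential by blast
  show ?thesis
    unfolding closure_sequential
    by (intro exI[of _ "\<lambda>n. F (x n) (y n)"] conjI allI F x(1) y(1) lim[OF x(2) y(2)])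
qed

context lc_groupoid
begin

abbreviation rep_algebra :: "'g op set" where
  "rep_algebra \<equiv> {T. \<exists>f\<in>Cc. rep f T}"

lemma reduced_approx:
  assumes "T \<in> reduced_cstar G" "0 < e"
  obtains f S where "f \<in> Cc" "rep f S" "norm (T - S) < e"
proof -
  obtain S where "S \<in> rep_algebra" "dist S T < e"
    using assms unfolding reduced_cstar_def closure_approachable by blast
  then show ?thesis
    using that by (auto simp: dist_norm norm_minus_commute)
qed

lemma rep_in_reduced: "f \<in> Cc \<Longrightarrow> rep f T \<Longrightarrow> T \<in> reduced_cstar G"
  unfolding reduced_cstar_def by (rule subsetD[OF closure_subset]) blast

lemma closed_reduced: "closed (reduced_cstar G)"
  by (simp add: reduced_cstar_def)

lemma reduced_linear: "T \<in> reduced_cstar G \<Longrightarrow> complex_linear T"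
  using closure_minimal[OF _ closed_complex_linear, of rep_algebra] rep_linear
  unfolding reduced_cstar_def by blast

lemma reduced_add: "S \<in> reduced_cstar G \<Longrightarrow> T \<in> reduced_cstar G \<Longrightarrow> S + T \<in> reduced_cstar G"
  unfolding reduced_cstar_def
  by (rule closure_binary[where F = "(+)", OF tendsto_add]) (auto intro: rep_add Cc_add)

lemma reduced_compose: "S \<in> reduced_cstar G \<Longrightarrow> T \<in> reduced_cstar G \<Longrightarrow> S o\<^sub>L T \<in> reduced_cstar G"
  unfolding reduced_cstar_def
  by (rule closure_binary[where F = "(o\<^sub>L)", OF tendsto_compose]) (auto intro: rep_compose convolution_Cc)

lemma closure_scale_op:
  assumes "\<And>T. T \<in> X \<Longrightarrow> scale_op z T \<in> X" "T \<in> closure X"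
  shows "scale_op z T \<in> closure X"
  by (rule closure_binary[where F = "\<lambda>T _. scale_op z T" and Y = X, OF _ _ assms(2,2)])
    (use assms in \<open>auto intro: bounded_linear.tendsto[OF bounded_linear_scale_op]\<close>)

lemma reduced_scale: "T \<in> reduced_cstar G \<Longrightarrow> scale_op z T \<in> reduced_cstar G"
  unfolding reduced_cstar_def
  by (rule closure_scale_op) (use rep_scale Cc_mult_left[OF _ continuous_on_const] in blast)+

lemma reduced_adj:
  assumes "T \<in> reduced_cstar G"
  shows "adj T \<in> reduced_cstar G"
proof -
  obtain X where X: "\<And>n. X n \<in> rep_algebra" "X \<longlonglongrightarrow> T"
    using assms unfolding reduced_cstar_def closure_sequential by blast
  \<comment> \<open>Adjoints are only controlled for complex linear operators, so the approximating
    sequence has to be taken inside the representation algebra.\<close>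
  have "complex_linear (X n)" for n
    using X(1)[of n] rep_linear by blast
  then have "(\<lambda>n. adj (X n)) \<longlonglongrightarrow> adj T"
    by (rule tendsto_adj[OF _ reduced_linear[OF assms] X(2)])
  moreover have "adj (X n) \<in> rep_algebra" for n
    using X(1)[of n] rep_adj Cc_star by blast
  ultimately show ?thesis
    unfolding reduced_cstar_def closure_sequential
    by (intro exI[of _ "\<lambda>n. adj (X n)"] conjI allI)
qed

lemma reduced_diff: "S \<in> reduced_cstar G \<Longrightarrow> T \<in> reduced_cstar G \<Longrightarrow> S - T \<in> reduced_cstar G"
proof -
  have "scale_op (- 1) T = - T" for T :: "'g op"
    by (rule blinfun_eqI) (simp add: scale_op_apply blinfun.minus_left scale_minus_one)
  then show "S \<in> reduced_cstar G \<Longrightarrow> T \<in> reduced_cstar G \<Longrightarrow> S - T \<in> reduced_cstar G"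
    using reduced_add[of S "- T"] reduced_scale[of T "- 1"] by simp
qed

section \<open>Ideals attached to invariant sets of units\<close>

definition invariant :: "'g set \<Rightarrow> bool" where
  "invariant W \<longleftrightarrow> (\<forall>a. \<sigma> a \<in> W \<longleftrightarrow> \<rho> a \<in> W)"

text \<open>Constraining ranges is enough: for invariant \<open>W\<close> the sources of arrows in
  \<open>K\<close> lie in \<open>W\<close> as well.\<close>

definition supported_rep :: "'g set \<Rightarrow> 'g op set" where
  "supported_rep W = {T. \<exists>f K. f \<in> Cc \<and> rep f T \<and> compact K \<and> \<rho> ` K \<subseteq> W \<and> (\<forall>x. x \<notin> K \<longrightarrow> f x = 0)}"

text \<open>For invariant \<open>W\<close> the test vectors form the direct sum of the Hilbert
  spaces of the source fibres over units outside \<open>W\<close>, so \<open>T\<close> is required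
  to vanish in the regular representations at those units.\<close>

definition vanishing_off :: "'g set \<Rightarrow> 'g op set" where
  "vanishing_off W = {T \<in> reduced_cstar G. \<forall>\<xi>. (\<forall>c. \<rho> c \<in> W \<longrightarrow> coef \<xi> c = 0) \<longrightarrow> T \<xi> = 0}"

lemma supported_repI:
  "f \<in> Cc \<Longrightarrow> rep f T \<Longrightarrow> compact K \<Longrightarrow> \<rho> ` K \<subseteq> W \<Longrightarrow> (\<And>x. x \<notin> K \<Longrightarrow> f x = 0) \<Longrightarrow> T \<in> supported_rep W"
  unfolding supported_rep_def by blast

lemma supported_repE:
  assumes "T \<in> supported_rep W"
  obtains f K where "f \<in> Cc" "rep f T" "compact K" "\<rho> ` K \<subseteq> W" "\<And>x. x \<notin> K \<Longrightarrow> f x = 0"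
  using assms unfolding supported_rep_def by auto

lemma supported_rep_subset: "supported_rep W \<subseteq> rep_algebra"
  unfolding supported_rep_def by blast

lemma supported_rep_compose:
  assumes "invariant W" "S \<in> rep_algebra" "T \<in> supported_rep W"
  shows "S o\<^sub>L T \<in> supported_rep W" "T o\<^sub>L S \<in> supported_rep W"
proof -
  obtain h where h: "h \<in> Cc" "rep h S" using assms by blast
  obtain L where L: "compact L" "\<And>x. x \<notin> L \<Longrightarrow> h x = 0"
    by (rule CcE[OF h(1)]) (use that in blast)
  obtain f K where f: "f \<in> Cc" "rep f T" "compact K" "\<rho> ` K \<subseteq> W" "\<And>x. x \<notin> K \<Longrightarrow> f x = 0"
    using supported_repE[OF assms(3)] by metis
  show "S o\<^sub>L T \<in> supported_rep W"
  proof (rule supported_repI)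
    show "compact (set_mult G L K)" by (rule compact_set_mult[OF L(1) f(3)])
    show "\<rho> ` set_mult G L K \<subseteq> W"
    proof
      fix x assume "x \<in> \<rho> ` set_mult G L K"
      then obtain a b where ab: "b \<in> K" "\<sigma> a = \<rho> b" "x = \<rho> (a \<cdot> b)"
        unfolding set_mult_def composable_iff by auto
      then have "\<sigma> a \<in> W" using f(4) by auto
      then have "\<rho> a \<in> W" using assms(1) unfolding invariant_def by blast
      then show "x \<in> W" using ab by simp
    qed
    show "convolution h f x = 0" if "x \<notin> set_mult G L K" for x
      by (rule convolution_support[OF L(2) f(5) that])
  qed (use h f in \<open>auto intro: rep_compose convolution_Cc\<close>)
  show "T o\<^sub>L S \<in> supported_rep W"
  proof (rule supported_repI)
    show "compact (set_mult G K L)" by (rule compact_set_mult[OF f(3) L(1)])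
    show "\<rho> ` set_mult G K L \<subseteq> W"
      using f(4) unfolding set_mult_def composable_iff by auto
    show "convolution f h x = 0" if "x \<notin> set_mult G K L" for x
      by (rule convolution_support[OF f(5) L(2) that])
  qed (use h f in \<open>auto intro: rep_compose convolution_Cc\<close>)
qed

lemma supported_rep_add:
  assumes "S \<in> supported_rep W" "T \<in> supported_rep W"
  shows "S + T \<in> supported_rep W"
proof -
  obtain f K where f: "f \<in> Cc" "rep f S" "compact K" "\<rho> ` K \<subseteq> W" "\<And>x. x \<notin> K \<Longrightarrow> f x = 0"
    using supported_repE[OF assms(1)] by metis
  obtain h L where h: "h \<in> Cc" "rep h T" "compact L" "\<rho> ` L \<subseteq> W" "\<And>x. x \<notin> L \<Longrightarrow> h x = 0"
    using supported_repE[OF assms(2)] by metis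
  show ?thesis
    by (rule supported_repI[where K = "K \<union> L", OF Cc_add[OF f(1) h(1)] rep_add[OF f(1,2) h(1,2)] compact_Un[OF f(3) h(3)]])
      (use f(4,5) h(4,5) in auto)
qed

lemma supported_rep_scale:
  assumes "T \<in> supported_rep W"
  shows "scale_op z T \<in> supported_rep W"
proof -
  obtain f K where f: "f \<in> Cc" "rep f T" "compact K" "\<rho> ` K \<subseteq> W" "\<And>x. x \<notin> K \<Longrightarrow> f x = 0"
    using supported_repE[OF assms(1)] by metis
  show ?thesis
    by (rule supported_repI[OF Cc_mult_left[OF f(1) continuous_on_const] rep_scale[OF f(1,2)] f(3,4)])
      (simp add: f(5))
qed

lemma closed_ideal_supported:
  assumes "invariant W"
  shows "closed_ideal (reduced_cstar G) (closure (supported_rep W))"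
  unfolding closed_ideal_def
proof (intro conjI ballI allI)
  show "closure (supported_rep W) \<subseteq> reduced_cstar G"
    unfolding reduced_cstar_def by (intro closure_mono supported_rep_subset)
  have "0 \<in> supported_rep W"
    by (rule supported_repI[of "\<lambda>_. 0" _ "{}"]) (auto simp: rep_zero intro: CcI[where K = "{}"])
  then show "0 \<in> closure (supported_rep W)"
    using closure_subset by blast
  fix S assume S: "S \<in> closure (supported_rep W)"
  show "S + T \<in> closure (supported_rep W)" if "T \<in> closure (supported_rep W)" for T
    by (rule closure_binary[where F = "(+)", OF tendsto_add supported_rep_add S that])
  show "scale_op z S \<in> closure (supported_rep W)" for z
    by (rule closure_scale_op[OF supported_rep_scale S])
  fix T assume "T \<in> reduced_cstar G"
  then have T: "T \<in> closure rep_algebra" by (simp add: reduced_cstar_def)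
  show "T o\<^sub>L S \<in> closure (supported_rep W)"
    by (rule closure_binary[where F = "(o\<^sub>L)", OF tendsto_compose supported_rep_compose(1)[OF assms] T S])
  show "S o\<^sub>L T \<in> closure (supported_rep W)"
    by (rule closure_binary[where F = "(o\<^sub>L)", OF tendsto_compose supported_rep_compose(2)[OF assms] S T])
qed simp

text \<open>Multiplication by an arrow does not cross between an invariant set and its complement.
  This gives the ideal property of \<open>vanishing_off\<close> for factors on the right.\<close>

lemma reduced_preserves_vanishing:
  assumes W: "invariant W" and T: "T \<in> reduced_cstar G" and \<xi>: "\<And>c. \<rho> c \<in> W \<Longrightarrow> coef \<xi> c = 0" and c: "\<rho> c \<in> W"
  shows "coef (T \<xi>) c = 0"
proof -
  have rep0: "coef (S \<xi>) c = 0" if "S \<in> rep_algebra" for S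
  proof -
    obtain f where f: "f \<in> Cc" "rep f S" using \<open>S \<in> rep_algebra\<close> by blast
    have *: "f a * coef \<xi> (\<iota> a \<cdot> c) = 0" if "\<rho> a = \<rho> c" for a
      using \<xi>[of "\<iota> a \<cdot> c"] that c W unfolding invariant_def by (metis mult_zero_right range_inv range_mult source_inv)
    show ?thesis
      unfolding rep_apply[OF f] by (rule sum.neutral) (use * in blast)
  qed
  obtain X where X: "\<And>n. X n \<in> rep_algebra" "X \<longlonglongrightarrow> T"
    using T unfolding reduced_cstar_def closure_sequential by blast
  have "(\<lambda>n. coef (X n \<xi>) c) \<longlonglongrightarrow> coef (T \<xi>) c"
    by (intro tendsto_coef tendsto_blinfun_apply X(2))
  moreover have "coef (X n \<xi>) c = 0" for n
    by (rule rep0[OF X(1)])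
  ultimately show ?thesis
    by (simp add: LIMSEQ_const_iff)
qed

lemma closed_ideal_vanishing:
  assumes "invariant W"
  shows "closed_ideal (reduced_cstar G) (vanishing_off W)"
  unfolding closed_ideal_def
proof (intro conjI ballI allI)
  show "vanishing_off W \<subseteq> reduced_cstar G" by (auto simp: vanishing_off_def)
  have "vanishing_off W = reduced_cstar G \<inter> (\<Inter>\<xi>\<in>{\<xi>. \<forall>c. \<rho> c \<in> W \<longrightarrow> coef \<xi> c = 0}. {T. blinfun_apply T \<xi> = 0})"
    by (auto simp: vanishing_off_def)
  moreover have "closed {T :: 'g op. blinfun_apply T \<xi> = 0}" for \<xi>
    by (intro closed_Collect_eq continuous_intros)
  ultimately show "closed (vanishing_off W)"
    by (simp add: closed_reduced closed_Int closed_INT)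
  show "0 \<in> vanishing_off W"
    using rep_in_reduced[OF _ rep_zero] by (simp add: vanishing_off_def CcI[where K = "{}"])
  fix S assume S: "S \<in> vanishing_off W"
  show "S + T \<in> vanishing_off W" if "T \<in> vanishing_off W" for T
    using S that by (simp add: vanishing_off_def reduced_add blinfun.add_left)
  have "scale_ell2 z (0 :: 'g ell2) = 0" for z
    by (rule ell2_eqI) (simp add: coef_simps)
  then show "scale_op z S \<in> vanishing_off W" for z
    using S by (simp add: vanishing_off_def reduced_scale scale_op_apply)
  fix T assume T: "T \<in> reduced_cstar G"
  show "T o\<^sub>L S \<in> vanishing_off W"
    using S T by (simp add: vanishing_off_def reduced_compose blinfun.zero_right)
  show "S o\<^sub>L T \<in> vanishing_off W"
    using S T reduced_preserves_vanishing[OF assms T] by (simp add: vanishing_off_def reduced_compose)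
qed

lemma supported_subset_vanishing:
  assumes "invariant W"
  shows "closure (supported_rep W) \<subseteq> vanishing_off W"
proof (rule closure_minimal)
  show "closed (vanishing_off W)"
    using closed_ideal_vanishing[OF assms] by (simp add: closed_ideal_def)
  show "supported_rep W \<subseteq> vanishing_off W"
  proof
    fix T assume T: "T \<in> supported_rep W"
    obtain f K where f: "f \<in> Cc" "rep f T" "compact K" "\<rho> ` K \<subseteq> W" "\<And>x. x \<notin> K \<Longrightarrow> f x = 0"
      using supported_repE[OF T] by metis
    have "T \<xi> = 0" if \<xi>: "\<And>c. \<rho> c \<in> W \<Longrightarrow> coef \<xi> c = 0" for \<xi>
    proof (rule ell2_eqI)
      fix c
      have *: "f a * coef \<xi> (\<iota> a \<cdot> c) = 0" if "\<rho> a = \<rho> c" for a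
      proof (cases "a \<in> K")
        case True
        then have "\<sigma> a \<in> W" using f(4) assms by (auto simp: invariant_def)
        then show ?thesis using \<xi>[of "\<iota> a \<cdot> c"] that by simp
      qed (simp add: f(5))
      have "coef (T \<xi>) c = 0"
        unfolding rep_apply[OF f(1,2)] by (rule sum.neutral) (use * in blast)
      then show "coef (T \<xi>) c = coef 0 c"
        by (simp add: coef_simps)
    qed
    then show "T \<in> vanishing_off W"
      using rep_in_reduced[OF f(1,2)] by (simp add: vanishing_off_def)
  qed
qed

text \<open>Evaluation at the basis vectors of units shows that \<open>f\<close> is zero off
  \<open>W\<close>. Its superlevel sets are then compact subsets of \<open>W\<close>, and truncating
  \<open>f\<close> to them changes it little.\<close>

lemma diagonal_vanishing_subset_supported:
  assumes W: "invariant W"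
  shows "vanishing_off W \<inter> diagonal G \<subseteq> closure (supported_rep W)"
proof
  fix T assume T: "T \<in> vanishing_off W \<inter> diagonal G"
  then obtain f where f: "f \<in> C0_units G" "\<And>\<xi> c. coef (T \<xi>) c = f (\<rho> c) * coef \<xi> c"
    by (auto simp: diagonal_def)
  have fW: "f x = 0" if "x \<in> units G" "x \<notin> W" for x
  proof -
    have "T (delta x) = 0"
      using T that by (auto simp: vanishing_off_def coef_delta units_iff)
    then show ?thesis
      using f(2)[of "delta x" x] that by (simp add: coef_delta coef_simps units_iff)
  qed
  show "T \<in> closure (supported_rep W)"
    unfolding closure_approachable
  proof (intro allI impI)
    fix \<epsilon>' :: real assume "0 < \<epsilon>'"
    define \<epsilon> where "\<epsilon> = \<epsilon>' / 2"
    have \<epsilon>: "0 < \<epsilon>" using \<open>0 < \<epsilon>'\<close> by (simp add: \<epsilon>_def)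
    \<comment> \<open>With this factor, \<open>t x * f x\<close> keeps the phase of
      \<open>f x\<close> and lowers its modulus by \<open>\<epsilon>\<close>, cutting off at zero.
      The maximum in the denominator keeps the quotient continuous where \<open>f\<close>
      vanishes.\<close>
    define t where "t x = max 0 (cmod (f x) - \<epsilon>) / max (cmod (f x)) \<epsilon>" for x
    define g where "g x = (if x \<in> units G then of_real (t x) * f x else 0)" for x
    define K where "K = {x \<in> units G. \<epsilon> \<le> cmod (f x)}"
    have "x \<in> W" if "x \<in> K" for x
      using fW[of x] that \<epsilon> by (cases "x \<in> W") (simp_all add: K_def)
    then have K: "compact K" "\<rho> ` K \<subseteq> W"
      using f(1) \<epsilon> by (auto simp: K_def C0_units_def units_iff)
    have gK: "g x = 0" if "x \<notin> K" for x
      using that by (auto simp: g_def K_def t_def max_def)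
    have cf: "continuous_on (units G) f"
      using f(1) by (simp add: C0_units_def)
    have "max (cmod (f x)) \<epsilon> \<noteq> 0" for x using \<epsilon> by auto
    then have "continuous_on (units G) (\<lambda>x. of_real (t x) * f x)"
      unfolding t_def by (intro continuous_intros cf) auto
    then have 1: "continuous_on (units G) g"
      by (rule continuous_on_eq) (simp add: g_def)
    have 2: "continuous_on (- units G) g"
      by (rule continuous_on_eq[of _ "\<lambda>_. 0"]) (simp_all add: g_def)
    have "continuous_on (units G \<union> - units G) g"
      by (rule continuous_on_open_Un[OF open_units _ 1 2]) (simp add: closed_units open_Compl)
    then have "continuous_on UNIV g" by (simp add: Compl_partition)
    then have gCc: "g \<in> Cc"
      by (rule CcI[OF _ K(1) gK])
    obtain B where B: "0 \<le> B" "\<And>x. cmod (g x) \<le> B"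
      by (rule Cc_bounded[OF gCc]) (use that in blast)
    obtain S :: "'g op" where S: "complex_linear S" "\<And>\<xi> c. coef (S \<xi>) c = g (\<rho> c) * coef \<xi> c"
      using multiplication_operator_exists[of "\<lambda>c. g (\<rho> c)" B] B by auto
    have "rep g S"
      by (rule rep_multiplication[OF gCc _ S]) (simp add: g_def)
    then have "S \<in> supported_rep W"
      using gCc K gK by (auto intro: supported_repI)
    moreover have "norm (T - S) \<le> \<epsilon>"
    proof -
      have "cmod (f x - g x) \<le> \<epsilon>" if "x \<in> units G" for x
      proof (cases "cmod (f x) \<le> \<epsilon>")
        case True
        then show ?thesis using that by (simp add: g_def t_def)
      next
        case False
        have "f x - g x = of_real (1 - t x) * f x"
          using that by (simp add: g_def algebra_simps)
        moreover have "cmod (f x) \<noteq> 0" using False \<epsilon> by linarith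
        then have "1 - t x = \<epsilon> / cmod (f x)"
          using False by (simp add: t_def diff_divide_distrib)
        ultimately show ?thesis
          using False \<epsilon> by (simp add: norm_mult norm_divide)
      qed
      then obtain D :: "'g op" where D: "norm D \<le> \<epsilon>" "\<And>\<xi> c. coef (D \<xi>) c = (f (\<rho> c) - g (\<rho> c)) * coef \<xi> c"
        using multiplication_operator_exists[of "\<lambda>c. f (\<rho> c) - g (\<rho> c)" \<epsilon>] \<epsilon> by auto
      have "T - S = D"
        by (intro blinfun_eqI ell2_eqI)
          (simp add: blinfun.diff_left coef_diff f(2) S(2) D(2) algebra_simps)
      then show ?thesis using D by simp
    qed
    ultimately show "\<exists>S\<in>supported_rep W. dist S T < \<epsilon>'"
      using \<open>0 < \<epsilon>'\<close> by (intro bexI[of _ S]) (auto simp: dist_norm norm_minus_commute \<epsilon>_def)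
  qed
qed

text \<open>The inclusion of the supported ideal in the vanishing one is general; the separation
  hypothesis supplies equality once both meet the diagonal in the same set.\<close>

lemma vanishing_eq_supported:
  assumes W: "invariant W" and sep: "C0_separates_ideals G"
  shows "vanishing_off W = closure (supported_rep W)"
proof (rule inj_onD[OF sep[unfolded C0_separates_ideals_def]])
  show "vanishing_off W \<inter> diagonal G = closure (supported_rep W) \<inter> diagonal G"
    using supported_subset_vanishing[OF W] diagonal_vanishing_subset_supported[OF W] by blast
qed (simp_all add: closed_ideal_vanishing[OF W] closed_ideal_supported[OF W])

section \<open>Cutting down to the diagonal\<close>

lemma coef_delta_diff_le:
  fixes S T :: "'i op"
  shows "cmod (coef (S (delta c)) c - coef (T (delta c)) c) \<le> norm (S - T)"
proof -
  have "cmod (coef ((S - T) (delta c)) c) \<le> norm ((S - T) (delta c))"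
    by (rule norm_coef_le)
  also have "\<dots> \<le> norm (S - T)"
    using norm_blinfun[of "S - T" "delta c"] by (simp add: norm_delta)
  finally show ?thesis by (simp add: blinfun.diff_left coef_diff)
qed

text \<open>Diagonal matrix entries compute the conditional expectation: for a represented function
  they are its values on units, and they depend contractively on the operator.\<close>

lemma expectation_approx:
  fixes S T :: "'g op"
  assumes "f \<in> Cc" "rep f S"
  shows "cmod (coef (T (delta c)) c - f (\<rho> c)) \<le> norm (T - S)"
  using coef_delta_diff_le[of T c S] by (simp add: rep_delta[OF assms] mult_inv_right)

lemma open_below2E:
  assumes "open_below2 G U V" "compact F" "F \<subseteq> U"
  obtains Y1 Y2 where "Y1 \<subseteq> V" "Y2 \<subseteq> V" "Y1 \<inter> Y2 = {}" "compact_below G F Y1" "compact_below G F Y2"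
  using assms unfolding open_below2_def by (elim allE[of _ F]) auto

section \<open>The conditional expectation of an element of the algebra\<close>

context
  fixes a :: "'g op" and e :: "'g \<Rightarrow> real"
  assumes a: "a \<in> reduced_cstar G"
    and e: "\<And>c. coef (a (delta c)) c = of_real (e c)"
begin

lemma expectation_range: "e (\<rho> c) = e c"
proof (rule ccontr)
  assume ne: "\<not> ?thesis"
  obtain f S where f: "f \<in> Cc" "rep f S" "norm (a - S) < \<bar>e (\<rho> c) - e c\<bar> / 2"
    by (rule reduced_approx[OF a, of "\<bar>e (\<rho> c) - e c\<bar> / 2"]) (use ne in auto)
  have "cmod (of_real (e (\<rho> c)) - of_real (e c)) \<le> cmod (of_real (e (\<rho> c)) - f (\<rho> c)) + cmod (of_real (e c) - f (\<rho> c))"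
    using norm_triangle_ineq4[of "of_real (e (\<rho> c)) - f (\<rho> c)" "of_real (e c) - f (\<rho> c)"] by simp
  also have "\<dots> < \<bar>e (\<rho> c) - e c\<bar>"
    using expectation_approx[OF f(1,2), of a c] expectation_approx[OF f(1,2), of a "\<rho> c"] f(3) by (simp add: e)
  finally show False
    by (simp flip: of_real_diff)
qed

text \<open>It is a uniform limit of functions \<open>f (\<rho> c)\<close> with \<open>f\<close>
  continuous.\<close>

lemma expectation_continuous: "continuous_on UNIV e"
proof -
  have "\<exists>f. f \<in> Cc \<and> (\<forall>c. cmod (of_real (e c) - f (\<rho> c)) \<le> inverse (real (Suc n)))" for n
  proof -
    obtain f S where f: "f \<in> Cc" "rep f S" "norm (a - S) < inverse (real (Suc n))"
      by (rule reduced_approx[OF a, of "inverse (real (Suc n))"]) auto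
    have "cmod (of_real (e c) - f (\<rho> c)) \<le> inverse (real (Suc n))" for c
      using expectation_approx[OF f(1,2), of a c] f(3) unfolding e by linarith
    then show ?thesis using f(1) by blast
  qed
  then obtain f where f: "\<And>n. f n \<in> Cc" "\<And>n c. cmod (of_real (e c) - f n (\<rho> c)) \<le> inverse (real (Suc n))"
    by metis
  have "continuous_on UNIV (\<lambda>c. complex_of_real (e c))"
  proof (rule uniform_limit_theorem)
    show "\<forall>\<^sub>F n in sequentially. continuous_on UNIV (\<lambda>c. f n (\<rho> c))"
      by (intro always_eventually allI continuous_on_compose2[OF Cc_continuous[OF f(1), of UNIV]] continuous_intros) auto
    show "uniform_limit UNIV (\<lambda>n c. f n (\<rho> c)) (\<lambda>c. complex_of_real (e c)) sequentially"
      unfolding uniform_limit_iff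
    proof (intro allI impI)
      fix r :: real assume "0 < r"
      then have "\<forall>\<^sub>F n in sequentially. inverse (real (Suc n)) < r"
        using order_tendstoD(2)[OF LIMSEQ_inverse_real_of_nat] by blast
      then show "\<forall>\<^sub>F n in sequentially. \<forall>c\<in>UNIV. dist (f n (\<rho> c)) (complex_of_real (e c)) < r"
        by (rule eventually_mono) (use f(2) in \<open>auto simp: dist_norm norm_minus_commute intro: le_less_trans\<close>)
    qed
  qed simp
  then have "continuous_on UNIV (\<lambda>c. Re (complex_of_real (e c)))"
    by (rule continuous_on_Re)
  then show ?thesis by simp
qed

text \<open>The expectation vanishes at infinity on the unit space: outside the support of an
  approximating function it is smaller than the approximation error.\<close>

lemma expectation_compact:
  assumes "0 < \<eta>"
  shows "compact {x \<in> units G. \<eta> \<le> e x}"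
proof -
  obtain f S where f: "f \<in> Cc" "rep f S" "norm (a - S) < \<eta>"
    by (rule reduced_approx[OF a assms])
  obtain K where K: "compact K" "\<And>x. x \<notin> K \<Longrightarrow> f x = 0"
    by (rule CcE[OF f(1)]) (use that in blast)
  have "x \<in> K" if "x \<in> units G" "\<eta> \<le> e x" for x
  proof (rule ccontr)
    assume "x \<notin> K"
    then have "\<bar>e x\<bar> \<le> norm (a - S)"
      using expectation_approx[OF f(1,2), of a x] K(2)[of x] that(1) by (simp add: e units_iff)
    then show False using that(2) f(3) by simp
  qed
  then have "{x \<in> units G. \<eta> \<le> e x} = K \<inter> (units G \<inter> {x. \<eta> \<le> e x})"
    by auto
  moreover have "closed {x. \<eta> \<le> e x}"
    by (intro closed_Collect_le continuous_intros expectation_continuous)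
  ultimately show ?thesis
    using K(1) closed_units by (metis closed_Int compact_Int_closed)
qed

lemma cut_to_diagonal:
  assumes pi: "purely_infinite_groupoid G"
    and small: "\<And>M. open_in_units G M \<Longrightarrow> groupoid_small G M"
    and K: "compact K" "K \<subseteq> {\<rho> c |c. 0 < e (\<sigma> c)}" and "0 < \<delta>"
  shows "\<exists>V\<in>reduced_cstar G. \<exists>(H :: 'g op) h. norm ((adj V o\<^sub>L a o\<^sub>L V) - H) \<le> \<delta>
    \<and> (\<forall>x\<in>K. h x = 1) \<and> (\<forall>\<xi> c. coef (H \<xi>) c = of_real (h (\<rho> c)) * coef \<xi> c)"
proof (cases "K = {}")
  \<comment> \<open>Pure infiniteness speaks about non-empty sets only, so empty \<open>K\<close> is
    settled separately, with all operators zero.\<close>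
  case True
  have "(0 :: 'g op) \<in> reduced_cstar G"
    by (rule rep_in_reduced[OF _ rep_zero]) (simp add: CcI[where K = "{}"])
  moreover have "adj 0 o\<^sub>L a o\<^sub>L 0 = (0 :: 'g op)"
    by (rule blinfun_eqI) (simp add: blinfun.zero_right)
  ultimately show ?thesis
    using True \<open>0 < \<delta>\<close> by (intro bexI[of _ 0] exI[of _ 0] exI[of _ "\<lambda>_. 0"]) (auto simp: coef_simps)
next
  case False
  note ce = continuous_on_compose2[OF expectation_continuous]
  have op_e: "open {c. r < e (\<sigma> c)}" for r
    by (intro open_Collect_less continuous_intros ce) auto
  \<comment> \<open>Positivity of \<open>e\<close> along arrows ending in \<open>K\<close> is made
    uniform by compactness. The factor 2 leaves room between the closed level
    \<open>2 * \<eta>\<close> and the open level \<open>\<eta>\<close> used below.\<close>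
  define P where "P n = \<rho> ` {c. 2 / real (Suc n) < e (\<sigma> c)}" for n
  have "K \<subseteq> (\<Union>n\<in>UNIV. P n)"
  proof
    fix x assume "x \<in> K"
    then obtain c where c: "x = \<rho> c" "0 < e (\<sigma> c)" using K(2) by auto
    then obtain n where "inverse (real (Suc n)) < e (\<sigma> c) / 2"
      using reals_Archimedean[of "e (\<sigma> c) / 2"] by auto
    then have "2 / real (Suc n) < e (\<sigma> c)" by (simp add: field_simps)
    then show "x \<in> (\<Union>n\<in>UNIV. P n)" using c unfolding P_def by blast
  qed
  moreover have "open (P n)" for n
    unfolding P_def by (intro open_range_image op_e)
  ultimately obtain D where D: "finite D" "K \<subseteq> (\<Union>n\<in>D. P n)"
    using compactE_image[OF K(1), of UNIV P] by metis
  define \<eta> where "\<eta> = 1 / real (Suc (Max D))"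
  have \<eta>: "0 < \<eta>" by (simp add: \<eta>_def)
  have K\<eta>: "K \<subseteq> \<rho> ` {c. 2 * \<eta> < e (\<sigma> c)}"
  proof
    fix x assume "x \<in> K"
    then obtain n c where nc: "n \<in> D" "x = \<rho> c" "2 / real (Suc n) < e (\<sigma> c)"
      using D(2) unfolding P_def by blast
    have "n \<le> Max D" using D(1) nc(1) by simp
    then have "2 * \<eta> \<le> 2 / real (Suc n)"
      by (simp add: \<eta>_def field_simps)
    then have "2 * \<eta> < e (\<sigma> c)" using nc(3) by linarith
    then show "x \<in> \<rho> ` {c. 2 * \<eta> < e (\<sigma> c)}" using nc(2) by blast
  qed
  \<comment> \<open>Two errors of size \<open>\<delta>'\<close> arise, from replacing
    \<open>a\<close> by \<open>S\<close> and \<open>g\<close> by \<open>e\<close>. Each is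
    multiplied by the squared norm of \<open>V\<close>, at most \<open>1 / \<eta>\<close>, so
    together they give \<open>\<delta>\<close>.\<close>
  define \<delta>' where "\<delta>' = \<delta> * \<eta> / 2"
  have \<delta>': "0 < \<delta>'" using \<open>0 < \<delta>\<close> \<eta> by (simp add: \<delta>'_def)
  obtain g S where g: "g \<in> Cc" "rep g S" "norm (a - S) < \<delta>'"
    by (rule reduced_approx[OF a \<delta>'])
  obtain L where L: "compact L" "\<And>x. x \<notin> L \<Longrightarrow> g x = 0"
    by (rule CcE[OF g(1)]) (use that in blast)
  define M where "M = {x \<in> units G. \<eta> < e x}"
  have "open (units G \<inter> {x. \<eta> < e x})"
    by (intro open_Int open_units open_Collect_less continuous_intros expectation_continuous)
  then have M: "open_in_units G M"
    unfolding M_def open_in_units_iff by (auto simp: Int_def)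
  define K1 where "K1 = {x \<in> units G. 2 * \<eta> \<le> e x}"
  have K1: "compact K1" "K1 \<subseteq> M"
    unfolding K1_def M_def using \<eta> expectation_compact[of "2 * \<eta>"] by auto
  \<comment> \<open>Since the units are open, the off-unit part of the support of \<open>g\<close>
    is compact and can be fed into groupoid smallness.\<close>
  have "compact (L \<inter> - units G)"
    using L(1) open_units by (intro compact_Int_closed) auto
  then obtain F Y where FY: "compact F" "open_in_units G Y" "F \<subseteq> Y" "Y \<subseteq> M"
      "K1 \<subseteq> \<rho> ` set_mult G UNIV F" "set_mult G (set_mult G Y (L \<inter> - units G)) Y = {}"
    using small[OF M] K1 unfolding groupoid_small_def by (metis Int_lower2)
  have Yu: "Y \<subseteq> units G" "open Y" using FY(2) by (auto simp: open_in_units_iff)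
  define Y1 where "Y1 = \<rho> ` (\<sigma> -` Y)"
  have Y1_eq: "Y1 = \<rho> ` set_mult G UNIV Y"
    unfolding Y1_def rng_set_mult_UNIV[OF Yu(1)] by auto
  have KY1: "K \<subseteq> Y1"
  proof
    fix x assume "x \<in> K"
    then obtain c where c: "x = \<rho> c" "2 * \<eta> < e (\<sigma> c)" using K\<eta> by blast
    then have "\<sigma> c \<in> K1" by (simp add: K1_def)
    \<comment> \<open>Smallness links the level set to \<open>F\<close>; composing with the arrow
      from the level set to \<open>x\<close> links \<open>x\<close> to \<open>Y\<close>.\<close>
    then obtain b where b: "\<sigma> c = \<rho> b" "\<sigma> b \<in> F"
      using FY(5) rng_set_mult_UNIV[of F] FY(3) Yu by auto
    then have "\<rho> (c \<cdot> b) = x" "\<sigma> (c \<cdot> b) \<in> Y"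
      using c FY(3) by auto
    then show "x \<in> Y1" unfolding Y1_def by blast
  qed
  have "open Y1"
    unfolding Y1_def by (intro open_range_image open_vimage Yu continuous_intros)
  then have "open_in_units G Y1"
    unfolding open_in_units_iff by (auto simp: Y1_def)
  moreover have "Y1 \<noteq> {}" using KY1 False by blast
  moreover then have "Y \<noteq> {}" by (auto simp: Y1_def)
  ultimately have "open_below2 G Y1 Y"
    using pi FY(2) Y1_eq unfolding purely_infinite_groupoid_def by blast
  then obtain Z where Z: "Z \<subseteq> Y" "compact_below G K Z"
    using K(1) KY1 by (rule open_below2E)
  have eZ: "\<eta> < e x" if "x \<in> Z" for x
    using that Z(1) FY(4) by (auto simp: M_def)
  obtain v V h and H :: "'g op" where V: "v \<in> Cc" "rep v V" "\<And>\<xi> c. coef (V \<xi>) c \<noteq> 0 \<Longrightarrow> \<rho> c \<in> Z"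
    "\<And>x. x \<in> K \<Longrightarrow> h x = 1" "complex_linear H" "norm H \<le> 1" "\<And>\<xi> c. coef (H \<xi>) c = of_real (h (\<rho> c)) * coef \<xi> c"
    "\<And>\<xi> \<zeta>. ((\<lambda>c. of_real (e (\<rho> c)) * (cnj (coef (V \<xi>) c) * coef (V \<zeta>) c)) has_sum cinner \<xi> (H \<zeta>)) UNIV"
    by (rule compact_below_transport[OF K(1) Z(2) expectation_continuous])
      (use eZ \<eta> less_trans that in blast)+
  have Vlin: "complex_linear V" by (rule rep_linear[OF V(1,2)])
  \<comment> \<open>On the support of \<open>V\<close> the weight \<open>e\<close> exceeds
    \<open>\<eta>\<close>, so the weighted form, which is that of \<open>H\<close>, dominates
    \<open>\<eta>\<close> times the squared norm.\<close>
  have V_bound: "norm (V \<xi>) \<le> norm \<xi> / sqrt \<eta>" for \<xi>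
  proof -
    have "\<eta> * (norm (V \<xi>))\<^sup>2 \<le> Re (cinner \<xi> (H \<xi>))"
    proof (rule has_sum_mono)
      show "((\<lambda>c. \<eta> * (cmod (coef (V \<xi>) c))\<^sup>2) has_sum \<eta> * (norm (V \<xi>))\<^sup>2) UNIV"
        by (intro has_sum_cmult_right has_sum_norm_ell2)
      show "((\<lambda>c. Re (of_real (e (\<rho> c)) * (cnj (coef (V \<xi>) c) * coef (V \<xi>) c))) has_sum Re (cinner \<xi> (H \<xi>))) UNIV"
        by (rule has_sum_Re[OF V(8)])
      fix c
      have "Re (of_real (e (\<rho> c)) * (cnj (coef (V \<xi>) c) * coef (V \<xi>) c)) = e (\<rho> c) * (cmod (coef (V \<xi>) c))\<^sup>2"
        unfolding cmod_power2 by (simp add: power2_eq_square)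
      moreover have "\<eta> * (cmod (coef (V \<xi>) c))\<^sup>2 \<le> e (\<rho> c) * (cmod (coef (V \<xi>) c))\<^sup>2"
        using V(3)[of \<xi> c] eZ[of "\<rho> c"]
        by (cases "coef (V \<xi>) c = 0") (simp, intro mult_right_mono less_imp_le, simp_all)
      ultimately show "\<eta> * (cmod (coef (V \<xi>) c))\<^sup>2
          \<le> Re (of_real (e (\<rho> c)) * (cnj (coef (V \<xi>) c) * coef (V \<xi>) c))"
        by (simp only:)
    qed
    also have "\<dots> \<le> cmod (cinner \<xi> (H \<xi>))" by (rule complex_Re_le_cmod)
    also have "\<dots> \<le> norm \<xi> * norm (H \<xi>)" by (rule norm_cinner_le)
    also have "\<dots> \<le> norm \<xi> * norm \<xi>"
      using norm_blinfun[of H \<xi>] V(6) mult_right_mono[OF V(6), of "norm \<xi>"]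
      by (intro mult_left_mono) auto
    finally have "(sqrt \<eta> * norm (V \<xi>))\<^sup>2 \<le> (norm \<xi>)\<^sup>2"
      unfolding power_mult_distrib power2_eq_square[of "norm \<xi>"] using \<eta> by simp
    then have "sqrt \<eta> * norm (V \<xi>) \<le> norm \<xi>"
      by (rule power2_le_imp_le) simp
    then show ?thesis using \<eta> by (simp add: field_simps)
  qed
  have ge: "cmod (g (\<rho> c) - of_real (e (\<rho> c))) \<le> \<delta>'" for c
    using expectation_approx[OF g(1,2), of a "\<rho> c"] g(3) by (simp add: e norm_minus_commute)
  obtain D :: "'g op" where D: "norm D \<le> \<delta>'" "\<And>\<xi> c. coef (D \<xi>) c = (g (\<rho> c) - of_real (e (\<rho> c))) * coef \<xi> c"
    using multiplication_operator_exists[of "\<lambda>c. g (\<rho> c) - of_real (e (\<rho> c))" \<delta>'] ge \<delta>' by auto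
  \<comment> \<open>Between vectors supported over \<open>Y\<close> the non-unit part of
    \<open>g\<close> drops out and \<open>S\<close> acts as multiplication by \<open>g\<close>.
    Removing the weight \<open>e\<close> leaves exactly the form of \<open>D\<close>.\<close>
  have diag: "cinner (V \<zeta>) (S (V \<xi>)) - cinner \<zeta> (H \<xi>) = cinner (V \<zeta>) (D (V \<xi>))" for \<zeta> \<xi>
  proof -
    have S: "coef (S (V \<xi>)) c = g (\<rho> c) * coef (V \<xi>) c" if "\<rho> c \<in> Z" for c
    proof (rule rep_off_diagonal_zero[OF g(1,2) _ Yu(1) FY(6)])
      show "a \<in> L \<inter> - units G" if "g a \<noteq> 0" "a \<notin> units G" for a
        using that L(2)[of a] by auto
    qed (use that Z(1) V(3) in auto)
    have "cnj (coef (V \<zeta>) c) * coef (S (V \<xi>)) c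
        = of_real (e (\<rho> c)) * (cnj (coef (V \<zeta>) c) * coef (V \<xi>) c) + cnj (coef (V \<zeta>) c) * coef (D (V \<xi>)) c" for c
      using S[of c] V(3)[of \<zeta> c] by (cases "coef (V \<zeta>) c = 0") (simp_all add: D(2) algebra_simps)
    then have "((\<lambda>c. cnj (coef (V \<zeta>) c) * coef (S (V \<xi>)) c) has_sum cinner \<zeta> (H \<xi>) + cinner (V \<zeta>) (D (V \<xi>))) UNIV"
      using has_sum_add[OF V(8)[of \<zeta> \<xi>] has_sum_cinner[of "V \<zeta>" "D (V \<xi>)"]] by simp
    then have "cinner (V \<zeta>) (S (V \<xi>)) = cinner \<zeta> (H \<xi>) + cinner (V \<zeta>) (D (V \<xi>))"
      using has_sum_cinner has_sum_unique by blast
    then show ?thesis by simp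
  qed
  have "norm ((adj V o\<^sub>L a o\<^sub>L V) - H) \<le> \<delta>"
  proof (rule norm_blinfun_bound)
    fix \<xi>
    show "norm (((adj V o\<^sub>L a o\<^sub>L V) - H) \<xi>) \<le> \<delta> * norm \<xi>"
    proof (rule norm_le_by_cinner)
      fix \<zeta>
      have "cinner \<zeta> (((adj V o\<^sub>L a o\<^sub>L V) - H) \<xi>) = cinner (V \<zeta>) (a (V \<xi>)) - cinner \<zeta> (H \<xi>)"
        by (simp add: blinfun.diff_left cinner_diff_right cinner_adj[OF Vlin])
      also have "\<dots> = cinner (V \<zeta>) ((a - S) (V \<xi>)) + cinner (V \<zeta>) (D (V \<xi>))"
        unfolding diag[symmetric] by (simp add: blinfun.diff_left cinner_diff_right)
      finally have "cmod (cinner \<zeta> (((adj V o\<^sub>L a o\<^sub>L V) - H) \<xi>))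
          \<le> cmod (cinner (V \<zeta>) ((a - S) (V \<xi>))) + cmod (cinner (V \<zeta>) (D (V \<xi>)))"
        by (simp add: norm_triangle_ineq)
      also have "\<dots> \<le> norm (V \<zeta>) * (\<delta>' * norm (V \<xi>)) + norm (V \<zeta>) * (\<delta>' * norm (V \<xi>))"
      proof -
        have "cmod (cinner (V \<zeta>) (T (V \<xi>))) \<le> norm (V \<zeta>) * (\<delta>' * norm (V \<xi>))" if "norm T \<le> \<delta>'" for T :: "'g op"
        proof -
          have "norm (T (V \<xi>)) \<le> norm T * norm (V \<xi>)" by (rule norm_blinfun)
          also have "\<dots> \<le> \<delta>' * norm (V \<xi>)" using that by (intro mult_right_mono) auto
          finally show ?thesis
            by (intro order_trans[OF norm_cinner_le] mult_left_mono) auto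
        qed
        then show ?thesis using D(1) g(3) by (intro add_mono) auto
      qed
      also have "\<dots> = 2 * \<delta>' * (norm (V \<zeta>) * norm (V \<xi>))" by simp
      also have "\<dots> \<le> 2 * \<delta>' * ((norm \<zeta> / sqrt \<eta>) * (norm \<xi> / sqrt \<eta>))"
        using \<delta>' \<eta> by (intro mult_left_mono mult_mono V_bound) auto
      also have "\<dots> = \<delta> * norm \<xi> * norm \<zeta>"
        using \<eta> by (simp add: \<delta>'_def)
      finally show "cmod (cinner \<zeta> (((adj V o\<^sub>L a o\<^sub>L V) - H) \<xi>)) \<le> \<delta> * norm \<xi> * norm \<zeta>" .
    qed (use \<open>0 < \<delta>\<close> in simp)
  qed (use \<open>0 < \<delta>\<close> in simp)
  then show ?thesis
    using V(4,7) rep_in_reduced[OF V(1,2)] by blast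
qed

end

section \<open>Cuntz comparison in the reduced algebra\<close>

lemma reduced_cuntz_below:
  assumes sep: "C0_separates_ideals G" and pi: "purely_infinite_groupoid G"
    and small: "\<And>M. open_in_units G M \<Longrightarrow> groupoid_small G M"
    and x: "x \<in> reduced_cstar G" and y: "y \<in> reduced_cstar G"
    and ideal: "adj y o\<^sub>L y \<in> ideal_generated (reduced_cstar G) (adj x o\<^sub>L x)"
  shows "cuntz_below (reduced_cstar G) (adj y o\<^sub>L y) (adj x o\<^sub>L x)"
proof -
  define a where "a = adj x o\<^sub>L x"
  define b where "b = adj y o\<^sub>L y"
  define e where "e c = (norm (x (delta c)))\<^sup>2" for c
  note lin = reduced_linear[OF x] reduced_linear[OF y]
  have a: "a \<in> reduced_cstar G"
    unfolding a_def by (intro reduced_compose reduced_adj x)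
  have e: "coef (a (delta c)) c = of_real (e c)" for c
    unfolding a_def e_def cinner_delta_left[symmetric] by (rule norm_adj_self[OF lin(1)])
  define W where "W = {\<rho> c |c. 0 < e (\<sigma> c)}"
  have W: "invariant W"
    unfolding invariant_def
  proof (intro allI iffI)
    fix c
    show "\<rho> c \<in> W" if mem: "\<sigma> c \<in> W"
    proof -
      obtain d where "\<sigma> c = \<rho> d" "0 < e (\<sigma> d)" using mem by (auto simp: W_def)
      then show ?thesis unfolding W_def by (intro CollectI exI[of _ "c \<cdot> d"]) simp
    qed
    show "\<sigma> c \<in> W" if mem: "\<rho> c \<in> W"
    proof -
      obtain d where "\<rho> c = \<rho> d" "0 < e (\<sigma> d)" using mem by (auto simp: W_def)
      then show ?thesis unfolding W_def by (intro CollectI exI[of _ "\<iota> c \<cdot> d"]) simp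
    qed
  qed
  \<comment> \<open>For an arrow with range outside \<open>W\<close> the expectation is zero, and it
    equals the squared norm of \<open>x\<close> at the basis vector; hence \<open>a\<close> kills
    that vector.\<close>
  have "a \<xi> = 0" if \<xi>: "\<And>c. \<rho> c \<in> W \<Longrightarrow> coef \<xi> c = 0" for \<xi>
  proof (rule complex_linear_zero_on_basis[OF reduced_linear[OF a]])
    fix c assume "coef \<xi> c \<noteq> 0"
    then have "\<rho> c \<notin> W" using \<xi> by blast
    then have "\<not> 0 < e (\<rho> c)"
      unfolding W_def by (metis (mono_tags, lifting) mem_Collect_eq range_range source_range)
    then have "e c = 0"
      using expectation_range[OF a e, of c] by (simp add: e_def)
    then show "a (delta c) = 0"
      by (simp add: e_def a_def blinfun.zero_right)
  qed
  then have "a \<in> vanishing_off W" using a by (simp add: vanishing_off_def)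
  then have "b \<in> vanishing_off W"
    using ideal closed_ideal_vanishing[OF W] unfolding ideal_generated_def a_def b_def by blast
  \<comment> \<open>Vanishing passes from \<open>b\<close> to \<open>y\<close> because the form of
    \<open>b\<close> is the squared norm of \<open>y \<xi>\<close>.\<close>
  then have "y \<xi> = 0" if "\<And>c. \<rho> c \<in> W \<Longrightarrow> coef \<xi> c = 0" for \<xi>
    using norm_adj_self[OF lin(2), of \<xi>] that
    by (simp add: vanishing_off_def b_def cinner_def[of \<xi> 0] coef_simps)
  then have "y \<in> closure (supported_rep W)"
    using y vanishing_eq_supported[OF W sep] by (auto simp: vanishing_off_def)
  then obtain X where X: "\<And>n. X n \<in> supported_rep W" "X \<longlonglongrightarrow> y"
    unfolding closure_sequential by blast
  have Xlin: "complex_linear (X n)" for n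
    using X(1)[of n] supported_rep_subset[of W] rep_linear by blast
  have Xlim: "(\<lambda>n. adj (X n) o\<^sub>L X n) \<longlonglongrightarrow> b"
    unfolding b_def by (intro tendsto_compose tendsto_adj Xlin lin X(2))
  have approx: "\<exists>r\<in>reduced_cstar G. norm ((adj r o\<^sub>L a o\<^sub>L r) - b) < \<epsilon>" if pos_\<epsilon>: "0 < \<epsilon>" for \<epsilon>
  proof -
    have "\<exists>N. \<forall>n\<ge>N. norm ((adj (X n) o\<^sub>L X n) - b) < \<epsilon> / 2"
      using pos_\<epsilon> by (intro LIMSEQ_D[OF Xlim]) simp
    then obtain n where n: "norm ((adj (X n) o\<^sub>L X n) - b) < \<epsilon> / 2"
      by blast
    define T where "T = X n"
    have Tlin: "complex_linear T" using Xlin by (simp add: T_def)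
    obtain f K where f: "f \<in> Cc" "rep f T" "compact K" "\<rho> ` K \<subseteq> W" "\<And>x. x \<notin> K \<Longrightarrow> f x = 0"
      using supported_repE[OF X(1)[of n]] unfolding T_def by metis
    \<comment> \<open>The error is sandwiched between \<open>T\<close> and its adjoint, which costs
      the squared norm of \<open>T\<close>; the summand 1 covers the case
      \<open>T = 0\<close>.\<close>
    define \<delta> where "\<delta> = \<epsilon> / (2 * ((norm T)\<^sup>2 + 1))"
    have pos: "0 < (norm T)\<^sup>2 + 1" by (simp add: add_nonneg_pos)
    then have \<delta>: "0 < \<delta>" using pos_\<epsilon> by (simp add: \<delta>_def)
    have "compact (\<rho> ` K)"
      by (intro compact_continuous_image f continuous_intros)
    then obtain V h and H :: "'g op" where V: "V \<in> reduced_cstar G" "norm ((adj V o\<^sub>L a o\<^sub>L V) - H) \<le> \<delta>"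
        "\<And>x. x \<in> \<rho> ` K \<Longrightarrow> h x = 1" "\<And>\<xi> c. coef (H \<xi>) c = of_real (h (\<rho> c)) * coef \<xi> c"
      using cut_to_diagonal[OF a e pi small _ f(4)[unfolded W_def] \<delta>] by blast
    have HT: "H o\<^sub>L T = T"
    proof (intro blinfun_eqI ell2_eqI)
      fix \<xi> c
      have "coef (T \<xi>) c = 0" if "\<rho> c \<notin> \<rho> ` K"
      proof -
        have "f a = 0" if "\<rho> a = \<rho> c" for a
          using f(5)[of a] that \<open>\<rho> c \<notin> \<rho> ` K\<close> by (metis imageI)
        then show ?thesis by (simp add: rep_apply[OF f(1,2)])
      qed
      then show "coef ((H o\<^sub>L T) \<xi>) c = coef (T \<xi>) c"
        using V(3)[of "\<rho> c"] by (cases "\<rho> c \<in> \<rho> ` K") (simp_all add: V(4))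
    qed
    \<comment> \<open>Compressing \<open>a\<close> by \<open>V\<close> gives nearly
      \<open>H\<close>, and \<open>H\<close> acts as a unit on \<open>T\<close>, so compressing by
      \<open>r\<close> gives nearly \<open>adj T\<close> times \<open>T\<close>.\<close>
    define r where "r = V o\<^sub>L T"
    define E where "E = (adj V o\<^sub>L a o\<^sub>L V) - H"
    have "r \<in> reduced_cstar G"
      unfolding r_def by (intro reduced_compose V rep_in_reduced[OF f(1,2)])
    moreover have "(adj r o\<^sub>L a o\<^sub>L r) - b = (adj T o\<^sub>L E o\<^sub>L T) + ((adj T o\<^sub>L T) - b)"
    proof (rule blinfun_eqI)
      fix \<xi>
      have "H (T \<xi>) = T \<xi>"
        using HT by (metis blinfun_apply_blinfun_compose)
      then show "((adj r o\<^sub>L a o\<^sub>L r) - b) \<xi> = ((adj T o\<^sub>L E o\<^sub>L T) + ((adj T o\<^sub>L T) - b)) \<xi>"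
        by (simp add: r_def E_def adj_compose[OF reduced_linear[OF V(1)] Tlin] blinfun.diff_left
            blinfun.add_left blinfun.diff_right)
    qed
    then have "norm ((adj r o\<^sub>L a o\<^sub>L r) - b) \<le> norm (adj T o\<^sub>L E o\<^sub>L T) + norm ((adj T o\<^sub>L T) - b)"
      by (simp only: norm_triangle_ineq)
    moreover have "norm (adj T o\<^sub>L E o\<^sub>L T) \<le> \<epsilon> / 2"
    proof -
      have "norm (adj T o\<^sub>L E o\<^sub>L T) \<le> norm (adj T) * norm E * norm T"
        by (intro order_trans[OF norm_blinfun_compose] mult_right_mono norm_blinfun_compose) simp
      also have "\<dots> \<le> norm T * \<delta> * norm T"
        using V(2) norm_adj_le[OF Tlin] \<delta> by (intro mult_right_mono mult_mono) (auto simp: E_def)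
      also have "\<dots> = \<delta> * (norm T)\<^sup>2" by (simp add: power2_eq_square)
      also have "\<dots> \<le> \<delta> * ((norm T)\<^sup>2 + 1)" using \<delta> by (intro mult_left_mono) auto
      also have "\<dots> = \<epsilon> / 2"
        unfolding \<delta>_def using pos by (simp only: times_divide_eq_left mult.commute[of 2] divide_divide_eq_left[symmetric]
            nonzero_mult_div_cancel_right less_imp_neq[THEN not_sym] not_False_eq_True)
      finally show ?thesis .
    qed
    ultimately show ?thesis
      using n by (intro bexI[of _ r]) (auto simp: T_def)
  qed
  have "\<exists>r\<in>reduced_cstar G. norm ((adj r o\<^sub>L a o\<^sub>L r) - b) < inverse (real (Suc n))" for n
    by (rule approx) simp
  then obtain r where r: "\<And>n. r n \<in> reduced_cstar G" "\<And>n. norm ((adj (r n) o\<^sub>L a o\<^sub>L r n) - b) < inverse (real (Suc n))"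
    by metis
  have "(\<lambda>n. (adj (r n) o\<^sub>L a o\<^sub>L r n) - b) \<longlonglongrightarrow> 0"
    by (rule Lim_null_comparison[OF _ LIMSEQ_inverse_real_of_nat])
      (use r(2) in \<open>auto intro!: always_eventually less_imp_le\<close>)
  then have "(\<lambda>n. adj (r n) o\<^sub>L a o\<^sub>L r n) \<longlonglongrightarrow> b"
    by (rule LIM_zero_cancel)
  then show ?thesis
    unfolding cuntz_below_def a_def[symmetric] b_def[symmetric] using r(1) by blast
qed

section \<open>Absence of characters\<close>

text \<open>If \<open>h z\<close> were 1, the sum \<open>w\<close> of all positive powers of
  \<open>z\<close> would satisfy \<open>w = z w + z\<close>, hence \<open>h w = h w + 1\<close>. The
  series starts at \<open>z\<close> itself, so no identity element is used.\<close>

lemma character_contractive: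
  assumes h: "character (reduced_cstar G) h" and z: "z \<in> reduced_cstar G" "norm z < 1"
  shows "h z \<noteq> 1"
proof
  assume hz: "h z = 1"
  define p where "p = rec_nat z (\<lambda>_ q. z o\<^sub>L q)"
  have p0: "p 0 = z" and pS: "p (Suc n) = z o\<^sub>L p n" for n
    by (simp_all add: p_def)
  have pA: "p n \<in> reduced_cstar G" for n
    by (induction n) (simp_all add: p0 pS z reduced_compose)
  have bound: "norm (p n) \<le> norm z ^ Suc n" for n
  proof (induction n)
    case (Suc n)
    then show ?case
      unfolding pS by (intro order_trans[OF norm_blinfun_compose]) (simp add: mult_left_mono)
  qed (simp add: p0)
  have "summable (\<lambda>n. norm z ^ Suc n)"
    using z(2) by (subst summable_Suc_iff) (simp add: summable_geometric)
  then have sp: "summable p"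
    by (rule summable_comparison_test'[where N = 0]) (rule bound)
  define w where "w = suminf p"
  have "(\<Sum>i<n. p i) \<in> reduced_cstar G" for n
    by (induction n) (simp_all add: pA reduced_add rep_in_reduced[OF _ rep_zero] CcI[where K = "{}"])
  then have w: "w \<in> reduced_cstar G"
    unfolding w_def by (rule closed_sequentially[OF closed_reduced _ summable_LIMSEQ[OF sp]])
  have tail: "(\<Sum>n. p (Suc n)) = z o\<^sub>L w"
    unfolding w_def pS
    by (rule bounded_linear.suminf[symmetric, OF bounded_bilinear.bounded_linear_right[OF bounded_bilinear_blinfun_compose] sp])
  have "w = (z o\<^sub>L w) + z"
    using suminf_split_head[OF sp] unfolding tail w_def[symmetric] p0 by simp
  moreover have "h ((z o\<^sub>L w) + z) = h z * h w + h z"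
    using h z(1) w reduced_compose[OF z(1) w] by (simp add: character_def)
  ultimately have "h w = h w + 1"
    by (simp add: hz)
  then show False by simp
qed

lemma no_character:
  assumes ne: "units G \<noteq> {}" and pi: "purely_infinite_groupoid G"
  shows "\<not> character (reduced_cstar G) h"
proof
  assume h: "character (reduced_cstar G) h"
  have h_mult: "h (S o\<^sub>L T) = h S * h T" and h_add: "h (S + T) = h S + h T"
    if "S \<in> reduced_cstar G" "T \<in> reduced_cstar G" for S T
    using h that by (simp_all add: character_def)
  have zero: "(0 :: 'g op) \<in> reduced_cstar G"
    by (rule rep_in_reduced[OF _ rep_zero]) (simp add: CcI[where K = "{}"])
  have h0: "h 0 = 0" using h_add[OF zero zero] by simp
  have h_rep: "h T = 0" if f: "f \<in> Cc" "rep f T" for f T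
  proof -
    note T = rep_in_reduced[OF f]
    obtain K where K: "compact K" "\<And>x. x \<notin> K \<Longrightarrow> f x = 0"
      by (rule CcE[OF f(1)]) (use that in blast)
    have \<rho>K: "compact (\<rho> ` K)"
      by (intro compact_continuous_image K continuous_intros)
    have u: "open_in_units G (units G)" by (simp add: open_in_units_iff open_units)
    have "units G \<subseteq> \<rho> ` set_mult G UNIV (units G)"
      using rng_set_mult_UNIV[of "units G"] by (auto simp: units_iff) metis
    then have "open_below2 G (units G) (units G)"
      using pi u ne unfolding purely_infinite_groupoid_def by blast
    then obtain Y1 Y2 where Y: "Y1 \<inter> Y2 = {}" "compact_below G (\<rho> ` K) Y1" "compact_below G (\<rho> ` K) Y2"
      by (rule open_below2E[OF _ \<rho>K]) auto
    \<comment> \<open>Each target set yields an operator that is isometric as far as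
      \<open>T\<close> can see: its compression \<open>H\<close> of the identity fixes
      \<open>T\<close> from the left.\<close>
    have iso: "\<exists>V H. V \<in> reduced_cstar G \<and> (\<forall>\<xi> c. coef (V \<xi>) c \<noteq> 0 \<longrightarrow> \<rho> c \<in> Y) \<and> adj V o\<^sub>L V = H \<and> H o\<^sub>L T = T"
      if below: "compact_below G (\<rho> ` K) Y" for Y
    proof -
      obtain v V h and H :: "'g op" where V: "v \<in> Cc" "rep v V" "\<And>\<xi> c. coef (V \<xi>) c \<noteq> 0 \<Longrightarrow> \<rho> c \<in> Y"
        "\<And>x. x \<in> \<rho> ` K \<Longrightarrow> h x = 1" "complex_linear H" "norm H \<le> 1" "\<And>\<xi> c. coef (H \<xi>) c = of_real (h (\<rho> c)) * coef \<xi> c"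
        "\<And>\<xi> \<zeta>. ((\<lambda>c. of_real 1 * (cnj (coef (V \<xi>) c) * coef (V \<zeta>) c)) has_sum cinner \<xi> (H \<zeta>)) UNIV"
        by (rule compact_below_transport[OF \<rho>K below continuous_on_const[of _ 1]]) (use that in auto)
      have "adj V o\<^sub>L V = H"
      proof (intro blinfun_eqI ell2_eq_by_cinner)
        fix \<xi> \<zeta>
        have "cinner \<zeta> (H \<xi>) = cinner (V \<zeta>) (V \<xi>)"
          using V(8)[of \<zeta> \<xi>] has_sum_cinner[of "V \<zeta>" "V \<xi>"] has_sum_unique by fastforce
        then show "cinner \<zeta> ((adj V o\<^sub>L V) \<xi>) = cinner \<zeta> (H \<xi>)"
          by (simp add: cinner_adj[OF rep_linear[OF V(1,2)]])
      qed
      moreover have "H o\<^sub>L T = T"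
      proof (intro blinfun_eqI ell2_eqI)
        fix \<xi> c
        have "coef (T \<xi>) c = 0" if "\<rho> c \<notin> \<rho> ` K"
        proof -
          have "f a = 0" if "\<rho> a = \<rho> c" for a
            using K(2)[of a] that \<open>\<rho> c \<notin> \<rho> ` K\<close> by (metis imageI)
          then show ?thesis by (simp add: rep_apply[OF f(1,2)])
        qed
        then show "coef ((H o\<^sub>L T) \<xi>) c = coef (T \<xi>) c"
          using V(4)[of "\<rho> c"] by (cases "\<rho> c \<in> \<rho> ` K") (simp_all add: V(7))
      qed
      ultimately show ?thesis using rep_in_reduced[OF V(1,2)] V(3) by blast
    qed
    obtain V1 H1 where 1: "V1 \<in> reduced_cstar G" "\<And>\<xi> c. coef (V1 \<xi>) c \<noteq> 0 \<Longrightarrow> \<rho> c \<in> Y1"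
        "adj V1 o\<^sub>L V1 = H1" "H1 o\<^sub>L T = T"
      using iso[OF Y(2)] by blast
    obtain V2 H2 where 2: "V2 \<in> reduced_cstar G" "\<And>\<xi> c. coef (V2 \<xi>) c \<noteq> 0 \<Longrightarrow> \<rho> c \<in> Y2"
        "adj V2 o\<^sub>L V2 = H2" "H2 o\<^sub>L T = T"
      using iso[OF Y(3)] by blast
    have "adj V1 o\<^sub>L V2 = 0"
    proof (intro blinfun_eqI ell2_eq_by_cinner)
      fix \<xi> \<zeta>
      have "cnj (coef (V1 \<zeta>) c) * coef (V2 \<xi>) c = 0" for c
        using 1(2)[of \<zeta> c] 2(2)[of \<xi> c] Y(1) by auto
      then have "cinner (V1 \<zeta>) (V2 \<xi>) = 0"
        unfolding cinner_def by (intro infsum_0) blast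
      then show "cinner \<zeta> ((adj V1 o\<^sub>L V2) \<xi>) = cinner \<zeta> (blinfun_apply 0 \<xi>)"
        by (simp add: cinner_adj[OF reduced_linear[OF 1(1)]] cinner_def[of \<zeta> 0] coef_simps)
    qed
    \<comment> \<open>Orthogonal outputs force \<open>h\<close> to vanish on one of the two factors,
      so on \<open>H1\<close> or on \<open>H2\<close>; either one is a left unit for
      \<open>T\<close>.\<close>
    then have "h (adj V1) * h V2 = 0"
      using h_mult[OF reduced_adj[OF 1(1)] 2(1)] h0 by simp
    then have "h H1 * h H2 = 0"
      using h_mult[OF reduced_adj[OF 1(1)] 1(1)] h_mult[OF reduced_adj[OF 2(1)] 2(1)] 1(3) 2(3) by auto
    moreover have "H1 \<in> reduced_cstar G" "H2 \<in> reduced_cstar G"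
      using reduced_compose reduced_adj 1(1,3) 2(1,3) by blast+
    then have "h T = h H1 * h T" "h T = h H2 * h T"
      using h_mult[OF _ T] 1(4) 2(4) by metis+
    ultimately show ?thesis by auto
  qed
  obtain x where x: "x \<in> reduced_cstar G" "h x \<noteq> 0"
    using h by (auto simp: character_def)
  \<comment> \<open>Since \<open>h\<close> vanishes on a dense subalgebra, an element normalised to
    value 1 differs from a nearby represented function by an element of norm below 1 on which
    \<open>h\<close> is still 1.\<close>
  define y where "y = scale_op (1 / h x) x"
  have y: "y \<in> reduced_cstar G" unfolding y_def by (intro reduced_scale x)
  have hy: "h y = 1" using h x by (simp add: y_def character_def)
  obtain f S where f: "f \<in> Cc" "rep f S" "norm (y - S) < 1"
    by (rule reduced_approx[OF y zero_less_one])
  have z: "y - S \<in> reduced_cstar G"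
    by (intro reduced_diff y rep_in_reduced[OF f(1,2)])
  then have "h (y - S) = 1"
    using h_add[OF z rep_in_reduced[OF f(1,2)]] h_rep[OF f(1,2)] hy by simp
  then show False
    using character_contractive[OF h z f(3)] by blast
qed

end

theorem theoremA:
  fixes G :: "'g::t2_space groupoid"
  assumes "lc_hausdorff_etale_groupoid G"
    and "infinite (units G)"
    and "C0_separates_ideals G"
    and "purely_infinite_groupoid G"
    and "\<And>M. open_in_units G M \<Longrightarrow> groupoid_small G M"
  shows "purely_infinite_cstar (reduced_cstar G)"
proof -
  interpret lc_groupoid G by unfold_locales (fact assms(1))
  have "units G \<noteq> {}" using assms(2) by auto
  then show ?thesis
    unfolding purely_infinite_cstar_def positive_elements_def
    using no_character[OF _ assms(4)] reduced_cuntz_below[OF assms(3,4,5)] by blast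
qed

end
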